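(* Let $k$ be a field and let $H$ be a Hopf algebra over $k$ with antipode $S$ (not required to be invertible). For $n\ge 0$ let $\widehat{\mathcal{K}}^n(H)=H^{\otimes(n+1)}$, with product $$(x^0\otimes\cdots\otimes x^n)(y^0\otimes\cdots\otimes y^m)= x^0\otimes\cdots\otimes x^{n-1}\otimes x^n_{(1)}y^0S(x^n_{(2m+1)})\otimes\cdots\otimes x^n_{(m)}y^{m-1}S(x^n_{(m+2)})\otimes x^n_{(m+1)}y^m$$ and differential $$d(x^0\otimes\cdots\otimes x^n)=-(1\otimes x^0\otimes\cdots\otimes x^n)+\sum_{j=0}^{n-1}(-1)^j\, x^0\otimes\cdots\otimes x^j_{(1)}\otimes x^j_{(2)}\otimes\cdots\otimes x^n+(-1)^n\, x^0\otimes\cdots\otimes x^{n-1}\otimes x^n_{(1)}S(x^n_{(3)})\otimes x^n_{(2)}.$$ Then $\widehat{\mathcal{K}}^*(H)$ is a differential graded $k$-algebra.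
   Context: Sweedler notation is used for iterated comultiplications. A differential graded $k$-algebra is a graded associative unital $k$-algebra with a degree $+1$ differential $d$, $d^2=0$, satisfying $d(\Psi\Phi)=d(\Psi)\Phi+(-1)^{|\Psi|}\Psi d(\Phi)$ for homogeneous $\Psi,\Phi$. *)

theory Defs
  imports "HOL-Algebra.Module" "HOL-Algebra.AbelCoset" HOL.Hull
begin

section \<open>Modules: linear maps, free modules and quotients\<close>

definition module_hom ::
    "('k, 'r) ring_scheme \<Rightarrow> ('k, 'a, 's) module_scheme \<Rightarrow> ('k, 'b, 't) module_scheme \<Rightarrow> ('a \<Rightarrow> 'b) set"
  where "module_hom K M N =
    {f \<in> carrier M \<rightarrow> carrier N.
       (\<forall>x \<in> carrier M. \<forall>y \<in> carrier M. f (x \<oplus>\<^bsub>M\<^esub> y) = f x \<oplus>\<^bsub>N\<^esub> f y) \<and>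
       (\<forall>c \<in> carrier K. \<forall>x \<in> carrier M. f (c \<odot>\<^bsub>M\<^esub> x) = c \<odot>\<^bsub>N\<^esub> f x)}"

text \<open>
  The slots \<^const>\<open>monoid.mult\<close> and \<^const>\<open>one\<close>, which a \<^type>\<open>module_ext\<close> record has
  and the locale \<^locale>\<open>module\<close> ignores, are left undefined.
\<close>

definition free_module :: "('k, 'r) ring_scheme \<Rightarrow> 'b set \<Rightarrow> ('k, 'b \<Rightarrow> 'k) module"
  where "free_module K B =
    \<lparr> carrier = {p. (\<forall>b. p b \<in> carrier K) \<and> (\<forall>b. b \<notin> B \<longrightarrow> p b = \<zero>\<^bsub>K\<^esub>) \<and> finite {b. p b \<noteq> \<zero>\<^bsub>K\<^esub>}},
      monoid.mult = undefined, one = undefined,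
      zero = (\<lambda>b. \<zero>\<^bsub>K\<^esub>),
      add = (\<lambda>p q b. p b \<oplus>\<^bsub>K\<^esub> q b),
      smult = (\<lambda>c p b. c \<otimes>\<^bsub>K\<^esub> p b) \<rparr>"

definition basis_vec :: "('k, 'r) ring_scheme \<Rightarrow> 'b \<Rightarrow> 'b \<Rightarrow> 'k"
  where "basis_vec K b = (\<lambda>b'. if b' = b then \<one>\<^bsub>K\<^esub> else \<zero>\<^bsub>K\<^esub>)"

definition quotient_module :: "('k, 'a, 's) module_scheme \<Rightarrow> 'a set \<Rightarrow> ('k, 'a set) module"
  where "quotient_module M N =
    \<lparr> carrier = a_rcosets\<^bsub>M\<^esub> N,
      monoid.mult = undefined, one = undefined,
      zero = N,
      add = set_add M,
      smult = (\<lambda>c X. \<Union>x \<in> X. N +>\<^bsub>M\<^esub> (c \<odot>\<^bsub>M\<^esub> x)) \<rparr>"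


section \<open>Tensor powers\<close>

text \<open>
  \<open>M\<^sup>\<otimes>\<^sup>n\<close> is the free module on the words \<open>x\<^sub>1 \<dots> x\<^sub>n\<close> of elements of \<open>M\<close>, modulo the submodule
  generated by the relations of multilinearity.
\<close>

definition words :: "('a, 's) partial_object_scheme \<Rightarrow> nat \<Rightarrow> 'a list set"
  where "words M n = {xs. set xs \<subseteq> carrier M \<and> length xs = n}"

definition multilinear_rels ::
    "('k, 'r) ring_scheme \<Rightarrow> ('k, 'a, 's) module_scheme \<Rightarrow> nat \<Rightarrow> ('a list \<Rightarrow> 'k) set"
  where "multilinear_rels K M n =
    (let F = free_module K (words M n) in
     {basis_vec K (xs[i := x \<oplus>\<^bsub>M\<^esub> y]) \<ominus>\<^bsub>F\<^esub> (basis_vec K (xs[i := x]) \<oplus>\<^bsub>F\<^esub> basis_vec K (xs[i := y]))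
        | xs i x y. xs \<in> words M n \<and> i < n \<and> x \<in> carrier M \<and> y \<in> carrier M} \<union>
     {basis_vec K (xs[i := c \<odot>\<^bsub>M\<^esub> x]) \<ominus>\<^bsub>F\<^esub> c \<odot>\<^bsub>F\<^esub> basis_vec K (xs[i := x])
        | xs i c x. xs \<in> words M n \<and> i < n \<and> c \<in> carrier K \<and> x \<in> carrier M})"

definition tensor_null ::
    "('k, 'r) ring_scheme \<Rightarrow> ('k, 'a, 's) module_scheme \<Rightarrow> nat \<Rightarrow> ('a list \<Rightarrow> 'k) set"
  where "tensor_null K M n =
    (\<lambda>N. submodule N K (free_module K (words M n))) hull multilinear_rels K M n"

definition tensor_power ::
    "('k, 'r) ring_scheme \<Rightarrow> ('k, 'a, 's) module_scheme \<Rightarrow> nat \<Rightarrow> ('k, ('a list \<Rightarrow> 'k) set) module"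
  where "tensor_power K M n = quotient_module (free_module K (words M n)) (tensor_null K M n)"

text \<open>The pure tensor \<open>x\<^sub>1 \<otimes> \<dots> \<otimes> x\<^sub>n\<close> for \<open>xs = [x\<^sub>1, \<dots>, x\<^sub>n]\<close>.\<close>

definition tensor ::
    "('k, 'r) ring_scheme \<Rightarrow> ('k, 'a, 's) module_scheme \<Rightarrow> 'a list \<Rightarrow> ('a list \<Rightarrow> 'k) set"
  where "tensor K M xs =
    tensor_null K M (length xs) +>\<^bsub>free_module K (words M (length xs))\<^esub> basis_vec K xs"

definition multilinear ::
    "('k, 'r) ring_scheme \<Rightarrow> ('k, 'a, 's) module_scheme \<Rightarrow> nat \<Rightarrow> ('k, 'b, 't) module_scheme \<Rightarrow>
     ('a list \<Rightarrow> 'b) \<Rightarrow> bool"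
  where "multilinear K M n N f \<longleftrightarrow>
    f \<in> words M n \<rightarrow> carrier N \<and>
    (\<forall>xs \<in> words M n. \<forall>i < n. (\<lambda>x. f (xs[i := x])) \<in> module_hom K M N)"

definition lin_ext ::
    "('k, 'r) ring_scheme \<Rightarrow> ('k, 'a, 't) module_scheme \<Rightarrow> ('b \<Rightarrow> 'a) \<Rightarrow> ('b \<Rightarrow> 'k) \<Rightarrow> 'a"
  where "lin_ext K N f p = (\<Oplus>\<^bsub>N\<^esub>b \<in> {b. p b \<noteq> \<zero>\<^bsub>K\<^esub>}. p b \<odot>\<^bsub>N\<^esub> f b)"

text \<open>
  The linear map \<open>M\<^sup>\<otimes>\<^sup>n \<rightarrow> N\<close> induced by a multilinear map \<open>f\<close>, evaluated at the class \<open>X\<close>: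
  \<open>f\<close> is extended linearly to formal sums and applied to a representative of \<open>X\<close>. For
  multilinear \<open>f\<close> the choice does not matter, see \<open>tensor_lift_coset\<close>,
  \<open>tensor_lift_module_hom\<close> and \<open>tensor_lift_tensor\<close> below.
\<close>

definition tensor_lift ::
    "('k, 'r) ring_scheme \<Rightarrow> ('k, 'b, 't) module_scheme \<Rightarrow> ('a list \<Rightarrow> 'b) \<Rightarrow> ('a list \<Rightarrow> 'k) set \<Rightarrow> 'b"
  where "tensor_lift K N f X = lin_ext K N f (SOME p. p \<in> X)"


subsection \<open>Universal property\<close>

lemma free_module_simps:
  "carrier (free_module K B) = {p. (\<forall>b. p b \<in> carrier K) \<and> (\<forall>b. b \<notin> B \<longrightarrow> p b = \<zero>\<^bsub>K\<^esub>) \<and> finite {b. p b \<noteq> \<zero>\<^bsub>K\<^esub>}}"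
  "zero (free_module K B) = (\<lambda>b. \<zero>\<^bsub>K\<^esub>)"
  "add (free_module K B) = (\<lambda>p q b. p b \<oplus>\<^bsub>K\<^esub> q b)"
  "smult (free_module K B) = (\<lambda>c p b. c \<otimes>\<^bsub>K\<^esub> p b)"
  by (simp_all add: free_module_def)

lemma module_free_module:
  fixes K :: "('k, 'r) ring_scheme" (structure) and B :: "'b set"
  assumes "cring K" shows "module K (free_module K B)"
proof -
  interpret cring K by fact
  have fin2: "finite {b. p b \<oplus> q b \<noteq> \<zero>}" if "finite {b. p b \<noteq> \<zero>}" "finite {b. q b \<noteq> \<zero>}" for p q :: "'b \<Rightarrow> 'k"
    by (rule finite_subset[OF _ finite_UnI[OF that]]) auto
  have finc: "finite {b. c \<otimes> p b \<noteq> \<zero>}" if "finite {b. p b \<noteq> \<zero>}" "c \<in> carrier K" for c and p :: "'b \<Rightarrow> 'k"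
    by (rule finite_subset[OF _ that(1)]) (use that(2) in auto)
  have fini: "finite {b. \<ominus> p b \<noteq> \<zero>}" if "finite {b. p b \<noteq> \<zero>}" for p :: "'b \<Rightarrow> 'k"
    by (rule finite_subset[OF _ that(1)]) auto
  have ag: "abelian_group (free_module K B)"
  proof (rule abelian_groupI)
    fix x assume x: "x \<in> carrier (free_module K B)"
    have "(\<lambda>b. \<ominus> x b) \<in> carrier (free_module K B)"
      using x by (auto simp: free_module_simps intro!: fini)
    moreover have "(\<lambda>b. \<ominus> x b) \<oplus>\<^bsub>free_module K B\<^esub> x = \<zero>\<^bsub>free_module K B\<^esub>"
      using x by (auto simp: free_module_simps l_neg)
    ultimately show "\<exists>y\<in>carrier (free_module K B). y \<oplus>\<^bsub>free_module K B\<^esub> x = \<zero>\<^bsub>free_module K B\<^esub>" by blast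
  qed (auto simp: free_module_simps a_assoc intro!: fin2 ext intro: a_comm)
  show ?thesis
    by (rule moduleI[OF assms ag])
      (auto simp: free_module_simps finc l_distr r_distr m_assoc)
qed

lemma basis_vec_closed:
  assumes "cring K" "b \<in> B" shows "basis_vec K b \<in> carrier (free_module K B)"
proof -
  interpret cring K by fact
  show ?thesis using assms(2) by (auto simp: free_module_simps basis_vec_def)
qed

lemma multilinear_rels_closed:
  assumes "module K M" shows "multilinear_rels K M n \<subseteq> carrier (free_module K (words M n))"
proof -
  interpret module K M by fact
  interpret F: module K "free_module K (words M n)" by (rule module_free_module) unfold_locales
  have w: "xs[i := x] \<in> words M n" if "xs \<in> words M n" "x \<in> carrier M" for xs i x
    using that set_update_subset_insert[of xs i x] by (auto simp: words_def)
  have b: "basis_vec K xs \<in> carrier (free_module K (words M n))" if "xs \<in> words M n" for xs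
    by (rule basis_vec_closed[OF R.is_cring that])
  show ?thesis
    unfolding multilinear_rels_def Let_def
    by (auto intro!: F.minus_closed F.a_closed F.smult_closed b w)
qed

lemma submodule_tensor_null:
  assumes "module K M"
  shows "submodule (tensor_null K M n) K (free_module K (words M n))"
proof -
  interpret module K M by fact
  interpret F: module K "free_module K (words M n)" by (rule module_free_module) unfold_locales
  let ?F = "free_module K (words M n)"
  have car: "submodule (carrier ?F) K ?F" by (rule F.carrier_is_submodule)
  have sub: "tensor_null K M n \<subseteq> carrier ?F"
    unfolding tensor_null_def by (rule hull_minimal[where S = "\<lambda>N. submodule N K ?F", OF multilinear_rels_closed[OF assms] car])
  have E: "\<zero>\<^bsub>?F\<^esub> \<in> N" "\<And>a. a \<in> N \<Longrightarrow> \<ominus>\<^bsub>?F\<^esub> a \<in> N" 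
       "\<And>a b. a \<in> N \<Longrightarrow> b \<in> N \<Longrightarrow> a \<oplus>\<^bsub>?F\<^esub> b \<in> N"
       "\<And>c a. c \<in> carrier K \<Longrightarrow> a \<in> N \<Longrightarrow> c \<odot>\<^bsub>?F\<^esub> a \<in> N" if "submodule N K ?F" for N
    using F.submoduleE[OF that] subgroup.one_closed[OF submodule.axioms(1)[OF that]] by auto
  show ?thesis
  proof (rule F.submoduleI)
    show "tensor_null K M n \<subseteq> carrier ?F" by (rule sub)
  qed (use E in \<open>auto simp: tensor_null_def hull_def\<close>)
qed

lemma quotient_module_simps:
  "carrier (quotient_module M N) = a_rcosets\<^bsub>M\<^esub> N"
  "zero (quotient_module M N) = N"
  "add (quotient_module M N) = set_add M"
  "smult (quotient_module M N) = (\<lambda>c X. \<Union>x \<in> X. N +>\<^bsub>M\<^esub> (c \<odot>\<^bsub>M\<^esub> x))"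
  by (simp_all add: quotient_module_def)

context module begin

lemma abelian_subgroup_submodule:
  assumes "submodule N R M" shows "abelian_subgroup N M"
  by (intro abelian_subgroupI3 additive_subgroupI submodule.axioms(1)[OF assms] abelian_group_axioms)

lemma quotient_smult:
  assumes N: "submodule N R M" and c: "c \<in> carrier R" and x: "x \<in> carrier M"
  shows "c \<odot>\<^bsub>quotient_module M N\<^esub> (N +>\<^bsub>M\<^esub> x) = N +>\<^bsub>M\<^esub> (c \<odot>\<^bsub>M\<^esub> x)"
proof -
  interpret N: abelian_subgroup N M by (rule abelian_subgroup_submodule[OF N])
  have "N +>\<^bsub>M\<^esub> (c \<odot>\<^bsub>M\<^esub> y) = N +>\<^bsub>M\<^esub> (c \<odot>\<^bsub>M\<^esub> x)" if "y \<in> N +>\<^bsub>M\<^esub> x" for y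
  proof -
    from that obtain h where h: "h \<in> N" "y = h \<oplus>\<^bsub>M\<^esub> x"
      by (auto simp: a_r_coset_def')
    have hM: "h \<in> carrier M" using h N.a_subset by auto
    have "c \<odot>\<^bsub>M\<^esub> y = c \<odot>\<^bsub>M\<^esub> h \<oplus>\<^bsub>M\<^esub> c \<odot>\<^bsub>M\<^esub> x"
      using h hM c x by (simp add: smult_r_distr)
    moreover have "c \<odot>\<^bsub>M\<^esub> h \<in> N" using submoduleE(4)[OF N] c h by auto
    ultimately have "c \<odot>\<^bsub>M\<^esub> y \<in> N +>\<^bsub>M\<^esub> (c \<odot>\<^bsub>M\<^esub> x)" by (auto simp: a_r_coset_def')
    thus ?thesis using N.a_repr_independence'[of "c \<odot>\<^bsub>M\<^esub> y" "c \<odot>\<^bsub>M\<^esub> x"] c x by auto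
  qed
  moreover have "x \<in> N +>\<^bsub>M\<^esub> x" using x by (simp add: N.a_rcos_self)
  ultimately have "(\<Union>y \<in> N +>\<^bsub>M\<^esub> x. N +>\<^bsub>M\<^esub> (c \<odot>\<^bsub>M\<^esub> y)) = N +>\<^bsub>M\<^esub> (c \<odot>\<^bsub>M\<^esub> x)" by blast
  thus ?thesis by (simp only: quotient_module_simps)
qed

lemma quotient_carrierE:
  assumes "X \<in> carrier (quotient_module M N)"
  obtains x where "x \<in> carrier M" "X = N +>\<^bsub>M\<^esub> x"
  using assms by (auto simp: quotient_module_simps A_RCOSETS_def')

lemma quotient_carrierI:
  "x \<in> carrier M \<Longrightarrow> N +>\<^bsub>M\<^esub> x \<in> carrier (quotient_module M N)"
  by (auto simp: quotient_module_simps A_RCOSETS_def')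

lemma quotient_add:
  assumes N: "submodule N R M" and "x \<in> carrier M" "y \<in> carrier M"
  shows "(N +>\<^bsub>M\<^esub> x) \<oplus>\<^bsub>quotient_module M N\<^esub> (N +>\<^bsub>M\<^esub> y) = N +>\<^bsub>M\<^esub> (x \<oplus>\<^bsub>M\<^esub> y)"
proof -
  interpret N: abelian_subgroup N M by (rule abelian_subgroup_submodule[OF N])
  show ?thesis using assms by (simp add: quotient_module_simps N.a_rcos_sum)
qed

lemma module_quotient_module:
  assumes N: "submodule N R M"
  shows "module R (quotient_module M N)"
proof -
  interpret N: abelian_subgroup N M by (rule abelian_subgroup_submodule[OF N])
  let ?Q = "quotient_module M N"
  note sums = quotient_add[OF N] quotient_smult[OF N]
  have z: "\<zero>\<^bsub>?Q\<^esub> = N +>\<^bsub>M\<^esub> \<zero>\<^bsub>M\<^esub>"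
    using N.a_subset by (simp add: quotient_module_simps)
  note I = quotient_carrierI[of _ N]
  have ag: "abelian_group ?Q"
  proof (rule abelian_groupI)
    show "\<zero>\<^bsub>?Q\<^esub> \<in> carrier ?Q" unfolding z by (rule I) simp
  next
    fix X Y assume "X \<in> carrier ?Q" "Y \<in> carrier ?Q"
    then obtain x y where x: "x \<in> carrier M" "X = N +>\<^bsub>M\<^esub> x" and y: "y \<in> carrier M" "Y = N +>\<^bsub>M\<^esub> y"
      by (metis quotient_carrierE)
    show "X \<oplus>\<^bsub>?Q\<^esub> Y \<in> carrier ?Q" using x y by (simp add: sums I)
    show "X \<oplus>\<^bsub>?Q\<^esub> Y = Y \<oplus>\<^bsub>?Q\<^esub> X" using x y by (simp add: sums M.a_comm)
    fix Z assume "Z \<in> carrier ?Q"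
    then obtain w where w: "w \<in> carrier M" "Z = N +>\<^bsub>M\<^esub> w" by (rule quotient_carrierE)
    show "X \<oplus>\<^bsub>?Q\<^esub> Y \<oplus>\<^bsub>?Q\<^esub> Z = X \<oplus>\<^bsub>?Q\<^esub> (Y \<oplus>\<^bsub>?Q\<^esub> Z)"
      using x y w by (simp add: sums M.a_assoc)
  next
    fix X assume "X \<in> carrier ?Q"
    then obtain x where x: "x \<in> carrier M" "X = N +>\<^bsub>M\<^esub> x" by (rule quotient_carrierE)
    show "\<zero>\<^bsub>?Q\<^esub> \<oplus>\<^bsub>?Q\<^esub> X = X" using x by (simp add: sums z)
    show "\<exists>Y\<in>carrier ?Q. Y \<oplus>\<^bsub>?Q\<^esub> X = \<zero>\<^bsub>?Q\<^esub>"
      by (rule bexI[of _ "N +>\<^bsub>M\<^esub> (\<ominus>\<^bsub>M\<^esub> x)"]) (use x in \<open>simp_all add: sums z M.l_neg I\<close>)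
  qed
  show ?thesis
  proof (rule moduleI[OF R.is_cring ag])
    fix a b X assume ab: "a \<in> carrier R" "b \<in> carrier R" and "X \<in> carrier ?Q"
    then obtain x where x: "x \<in> carrier M" "X = N +>\<^bsub>M\<^esub> x" by (metis quotient_carrierE)
    show "(a \<oplus> b) \<odot>\<^bsub>?Q\<^esub> X = a \<odot>\<^bsub>?Q\<^esub> X \<oplus>\<^bsub>?Q\<^esub> b \<odot>\<^bsub>?Q\<^esub> X"
      using ab x by (simp add: sums smult_l_distr)
    show "(a \<otimes> b) \<odot>\<^bsub>?Q\<^esub> X = a \<odot>\<^bsub>?Q\<^esub> (b \<odot>\<^bsub>?Q\<^esub> X)"
      using ab x by (simp add: sums smult_assoc1)
  next
    fix a X Y assume a: "a \<in> carrier R" and "X \<in> carrier ?Q" "Y \<in> carrier ?Q"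
    then obtain x y where x: "x \<in> carrier M" "X = N +>\<^bsub>M\<^esub> x" and y: "y \<in> carrier M" "Y = N +>\<^bsub>M\<^esub> y"
      by (metis quotient_carrierE)
    show "a \<odot>\<^bsub>?Q\<^esub> X \<in> carrier ?Q" using a x by (simp add: sums I)
    show "a \<odot>\<^bsub>?Q\<^esub> (X \<oplus>\<^bsub>?Q\<^esub> Y) = a \<odot>\<^bsub>?Q\<^esub> X \<oplus>\<^bsub>?Q\<^esub> a \<odot>\<^bsub>?Q\<^esub> Y"
      using a x y by (simp add: sums smult_r_distr)
  next
    fix X assume "X \<in> carrier ?Q"
    then obtain x where x: "x \<in> carrier M" "X = N +>\<^bsub>M\<^esub> x" by (rule quotient_carrierE)
    show "\<one> \<odot>\<^bsub>?Q\<^esub> X = X" using x by (simp add: sums)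
  qed
qed

end

lemma module_tensor_power:
  assumes "module K M" shows "module K (tensor_power K M n)"
  unfolding tensor_power_def
  using module.module_quotient_module[OF module_free_module submodule_tensor_null[OF assms]] assms
  by (simp add: module_def)

lemma lin_ext_superset:
  assumes "module K N" "f \<in> B \<rightarrow> carrier N" "p \<in> carrier (free_module K B)"
    "finite A" "{b. p b \<noteq> \<zero>\<^bsub>K\<^esub>} \<subseteq> A" "A \<subseteq> B"
  shows "lin_ext K N f p = (\<Oplus>\<^bsub>N\<^esub>b \<in> A. p b \<odot>\<^bsub>N\<^esub> f b)"
proof -
  interpret module K N by fact
  show ?thesis
    unfolding lin_ext_def
    by (rule M.add.finprod_mono_neutral_cong_left)
      (use assms in \<open>auto simp: free_module_simps Pi_iff\<close>)
qed

lemma supp_subset: "p \<in> carrier (free_module K B) \<Longrightarrow> {b. p b \<noteq> \<zero>\<^bsub>K\<^esub>} \<subseteq> B"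
  by (auto simp: free_module_simps)

lemma lin_ext_hom:
  assumes "module K N" "f \<in> B \<rightarrow> carrier N"
  shows "lin_ext K N f \<in> module_hom K (free_module K B) N"
proof -
  interpret module K N by fact
  interpret F: module K "free_module K B" by (rule module_free_module) unfold_locales
  note f = assms(2)
  let ?F = "free_module K B"
  note sup = lin_ext_superset[OF assms]
  have cl: "p b \<odot>\<^bsub>N\<^esub> f b \<in> carrier N" if "p \<in> carrier ?F" "b \<in> B" for p b
    using that f by (auto simp: free_module_simps)
  show ?thesis
    unfolding module_hom_def mem_Collect_eq
  proof (intro conjI ballI)
    show "lin_ext K N f \<in> carrier ?F \<rightarrow> carrier N"
      unfolding lin_ext_def
      by (intro Pi_I M.finsum_closed) (use supp_subset[of _ K B] cl in blast)
  next
    fix p q assume p: "p \<in> carrier ?F" and q: "q \<in> carrier ?F"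
    define A where "A = {b. p b \<noteq> \<zero>\<^bsub>K\<^esub>} \<union> {b. q b \<noteq> \<zero>\<^bsub>K\<^esub>}"
    have A: "finite A" "A \<subseteq> B" using p q by (auto simp: A_def free_module_simps)
    have pq: "p \<oplus>\<^bsub>?F\<^esub> q \<in> carrier ?F" using p q by simp
    have sp: "{b. (p \<oplus>\<^bsub>?F\<^esub> q) b \<noteq> \<zero>\<^bsub>K\<^esub>} \<subseteq> A"
      by (auto simp: A_def free_module_simps)
    have "lin_ext K N f (p \<oplus>\<^bsub>?F\<^esub> q) = (\<Oplus>\<^bsub>N\<^esub>b \<in> A. (p \<oplus>\<^bsub>?F\<^esub> q) b \<odot>\<^bsub>N\<^esub> f b)"
      by (rule sup[OF pq A(1) sp A(2)])
    also have "\<dots> = (\<Oplus>\<^bsub>N\<^esub>b \<in> A. p b \<odot>\<^bsub>N\<^esub> f b \<oplus>\<^bsub>N\<^esub> q b \<odot>\<^bsub>N\<^esub> f b)"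
      using p q f A(2) by (intro M.finsum_cong') (auto simp: free_module_simps Pi_iff smult_l_distr subset_iff)
    also have "\<dots> = (\<Oplus>\<^bsub>N\<^esub>b \<in> A. p b \<odot>\<^bsub>N\<^esub> f b) \<oplus>\<^bsub>N\<^esub> (\<Oplus>\<^bsub>N\<^esub>b \<in> A. q b \<odot>\<^bsub>N\<^esub> f b)"
      using A(2) cl[OF p] cl[OF q] by (intro M.finsum_addf) auto
    also have "(\<Oplus>\<^bsub>N\<^esub>b \<in> A. p b \<odot>\<^bsub>N\<^esub> f b) = lin_ext K N f p"
      using sup[OF p A(1) _ A(2)] by (auto simp: A_def)
    also have "(\<Oplus>\<^bsub>N\<^esub>b \<in> A. q b \<odot>\<^bsub>N\<^esub> f b) = lin_ext K N f q"
      using sup[OF q A(1) _ A(2)] by (auto simp: A_def)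
    finally show "lin_ext K N f (p \<oplus>\<^bsub>?F\<^esub> q) = lin_ext K N f p \<oplus>\<^bsub>N\<^esub> lin_ext K N f q" .
  next
    fix c p assume c: "c \<in> carrier K" and p: "p \<in> carrier ?F"
    define A where "A = {b. p b \<noteq> \<zero>\<^bsub>K\<^esub>}"
    have A: "finite A" "A \<subseteq> B" using p by (auto simp: A_def free_module_simps)
    have cp: "c \<odot>\<^bsub>?F\<^esub> p \<in> carrier ?F" using c p by simp
    have sp: "{b. (c \<odot>\<^bsub>?F\<^esub> p) b \<noteq> \<zero>\<^bsub>K\<^esub>} \<subseteq> A"
      using c by (auto simp: A_def free_module_simps)
    have "lin_ext K N f (c \<odot>\<^bsub>?F\<^esub> p) = (\<Oplus>\<^bsub>N\<^esub>b \<in> A. (c \<odot>\<^bsub>?F\<^esub> p) b \<odot>\<^bsub>N\<^esub> f b)"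
      by (rule sup[OF cp A(1) sp A(2)])
    also have "\<dots> = (\<Oplus>\<^bsub>N\<^esub>b \<in> A. c \<odot>\<^bsub>N\<^esub> (p b \<odot>\<^bsub>N\<^esub> f b))"
      using p c f A(2) by (intro M.finsum_cong') (auto simp: free_module_simps Pi_iff smult_assoc1 subset_iff)
    also have "\<dots> = c \<odot>\<^bsub>N\<^esub> (\<Oplus>\<^bsub>N\<^esub>b \<in> A. p b \<odot>\<^bsub>N\<^esub> f b)"
      using A cl[OF p] c by (intro finsum_smult_ldistr[symmetric]) auto
    also have "(\<Oplus>\<^bsub>N\<^esub>b \<in> A. p b \<odot>\<^bsub>N\<^esub> f b) = lin_ext K N f p"
      by (simp add: A_def lin_ext_def)
    finally show "lin_ext K N f (c \<odot>\<^bsub>?F\<^esub> p) = c \<odot>\<^bsub>N\<^esub> lin_ext K N f p" .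
  qed
qed

lemma lin_ext_basis_vec:
  assumes "module K N" "f b \<in> carrier N" "\<one>\<^bsub>K\<^esub> \<noteq> \<zero>\<^bsub>K\<^esub>"
  shows "lin_ext K N f (basis_vec K b) = f b"
proof -
  interpret module K N by fact
  have "{b'. basis_vec K b b' \<noteq> \<zero>\<^bsub>K\<^esub>} = {b}" using assms(3) by (auto simp: basis_vec_def)
  thus ?thesis using assms(2) by (simp add: lin_ext_def basis_vec_def)
qed

lemma module_hom_simps:
  assumes "f \<in> module_hom K M N"
  shows "x \<in> carrier M \<Longrightarrow> f x \<in> carrier N"
    and "x \<in> carrier M \<Longrightarrow> y \<in> carrier M \<Longrightarrow> f (x \<oplus>\<^bsub>M\<^esub> y) = f x \<oplus>\<^bsub>N\<^esub> f y"
    and "c \<in> carrier K \<Longrightarrow> x \<in> carrier M \<Longrightarrow> f (c \<odot>\<^bsub>M\<^esub> x) = c \<odot>\<^bsub>N\<^esub> f x"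
  using assms by (auto simp: module_hom_def)

lemma module_hom_minus:
  assumes "module K M" "module K N" "f \<in> module_hom K M N" "x \<in> carrier M" "y \<in> carrier M"
  shows "f (x \<ominus>\<^bsub>M\<^esub> y) = f x \<ominus>\<^bsub>N\<^esub> f y"
proof -
  interpret M: module K M by fact
  interpret N: module K N by fact
  note h = module_hom_simps[OF assms(3)]
  have m: "\<ominus>\<^bsub>M\<^esub> y = (\<ominus>\<^bsub>K\<^esub> \<one>\<^bsub>K\<^esub>) \<odot>\<^bsub>M\<^esub> y" using assms(5) by (simp add: M.smult_l_minus)
  have "f (\<ominus>\<^bsub>M\<^esub> y) = \<ominus>\<^bsub>N\<^esub> f y"
    using assms(5) h(1)[OF assms(5)] unfolding m by (simp add: h N.smult_l_minus)
  thus ?thesis using assms(4,5) by (simp add: a_minus_def h)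
qed

lemma lin_ext_null:
  assumes "field K" "module K M" "module K N" "multilinear K M n N f" "r \<in> tensor_null K M n"
  shows "lin_ext K N f r = \<zero>\<^bsub>N\<^esub>"
proof -
  interpret K: field K by fact
  interpret M: module K M by fact
  interpret N: module K N by fact
  let ?F = "free_module K (words M n)"
  interpret F: module K ?F by (rule module_free_module) unfold_locales
  have f: "f \<in> words M n \<rightarrow> carrier N" and
    ml: "\<And>xs i. xs \<in> words M n \<Longrightarrow> i < n \<Longrightarrow> (\<lambda>x. f (xs[i := x])) \<in> module_hom K M N"
    using assms(4) by (auto simp: multilinear_def)
  note L = lin_ext_hom[OF assms(3) f]
  note h = module_hom_simps[OF L]
  note minus = module_hom_minus[OF F.module_axioms assms(3) L]
  have w: "xs[i := x] \<in> words M n" if "xs \<in> words M n" "x \<in> carrier M" for xs i x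
    using that set_update_subset_insert[of xs i x] by (auto simp: words_def)
  have b: "basis_vec K xs \<in> carrier ?F" if "xs \<in> words M n" for xs
    by (rule basis_vec_closed[OF K.is_cring that])
  have Lb: "lin_ext K N f (basis_vec K xs) = f xs" if "xs \<in> words M n" for xs
    using that f by (intro lin_ext_basis_vec assms(3)) auto
  let ?Z = "{p \<in> carrier ?F. lin_ext K N f p = \<zero>\<^bsub>N\<^esub>}"
  have z: "lin_ext K N f \<zero>\<^bsub>?F\<^esub> = \<zero>\<^bsub>N\<^esub>"
    by (simp add: lin_ext_def free_module_simps)
  have "submodule ?Z K ?F"
  proof (rule F.submoduleI)
    show "\<zero>\<^bsub>?F\<^esub> \<in> ?Z" using z by simp
    show "\<ominus>\<^bsub>?F\<^esub> a \<in> ?Z" if "a \<in> ?Z" for a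
    proof -
      have "\<ominus>\<^bsub>?F\<^esub> a = \<zero>\<^bsub>?F\<^esub> \<ominus>\<^bsub>?F\<^esub> a" using that by (simp add: a_minus_def)
      thus ?thesis using minus[of "\<zero>\<^bsub>?F\<^esub>" a] that z by (simp add: a_minus_def)
    qed
  qed (auto simp: h)
  moreover have "multilinear_rels K M n \<subseteq> ?Z"
  proof
    fix r assume r: "r \<in> multilinear_rels K M n"
    have rF: "r \<in> carrier ?F" using r multilinear_rels_closed[OF assms(2)] by blast
    from r consider (add) xs i x y where
        "r = basis_vec K (xs[i := x \<oplus>\<^bsub>M\<^esub> y]) \<ominus>\<^bsub>?F\<^esub> (basis_vec K (xs[i := x]) \<oplus>\<^bsub>?F\<^esub> basis_vec K (xs[i := y]))"
        "xs \<in> words M n" "i < n" "x \<in> carrier M" "y \<in> carrier M"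
      | (smult) xs i c x where
        "r = basis_vec K (xs[i := c \<odot>\<^bsub>M\<^esub> x]) \<ominus>\<^bsub>?F\<^esub> c \<odot>\<^bsub>?F\<^esub> basis_vec K (xs[i := x])"
        "xs \<in> words M n" "i < n" "c \<in> carrier K" "x \<in> carrier M"
      unfolding multilinear_rels_def Let_def by blast
    hence "lin_ext K N f r = \<zero>\<^bsub>N\<^esub>"
    proof cases
      case add
      note m = module_hom_simps[OF ml[OF add(2,3)]]
      show ?thesis using add(2-) m(1)[of x] m(1)[of y]
        by (simp add: add(1) minus h Lb b w m(2)[OF add(4,5)] a_minus_def[of N] N.r_neg)
    next
      case smult
      note m = module_hom_simps[OF ml[OF smult(2,3)]]
      show ?thesis using smult(2-) m(1)[of x]
        by (simp add: smult(1) minus h Lb b w m(3)[OF smult(4,5)] a_minus_def[of N] N.r_neg)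
    qed
    thus "r \<in> ?Z" using rF by simp
  qed
  ultimately have "tensor_null K M n \<subseteq> ?Z"
    unfolding tensor_null_def using hull_minimal[where S = "\<lambda>N. submodule N K ?F"] by blast
  thus ?thesis using assms(5) by blast
qed

lemma tensor_lift_coset:
  assumes "field K" "module K M" "module K N" "multilinear K M n N f"
    "p \<in> carrier (free_module K (words M n))"
  shows "tensor_lift K N f (tensor_null K M n +>\<^bsub>free_module K (words M n)\<^esub> p) = lin_ext K N f p"
proof -
  interpret K: field K by fact
  interpret N: module K N by fact
  let ?F = "free_module K (words M n)" and ?R = "tensor_null K M n"
  interpret F: module K ?F by (rule module_free_module) unfold_locales
  have f: "f \<in> words M n \<rightarrow> carrier N" using assms(4) by (auto simp: multilinear_def)
  note h = module_hom_simps[OF lin_ext_hom[OF assms(3) f]]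
  note R = submodule_tensor_null[OF assms(2), of n]
  interpret R: abelian_subgroup ?R ?F by (rule F.abelian_subgroup_submodule[OF R])
  define q where "q = (SOME q. q \<in> ?R +>\<^bsub>?F\<^esub> p)"
  have "q \<in> ?R +>\<^bsub>?F\<^esub> p"
    unfolding q_def using R.a_rcos_self[OF assms(5)] by (rule someI[of "\<lambda>q. q \<in> ?R +>\<^bsub>?F\<^esub> p"])
  then obtain r where r: "r \<in> ?R" "q = r \<oplus>\<^bsub>?F\<^esub> p" by (auto simp: a_r_coset_def')
  have "lin_ext K N f q = lin_ext K N f r \<oplus>\<^bsub>N\<^esub> lin_ext K N f p"
    using r R.a_subset assms(5) by (auto simp: h)
  hence "lin_ext K N f q = lin_ext K N f p"
    using lin_ext_null[OF assms(1-4) r(1)] h(1)[OF assms(5)] by simp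
  thus ?thesis by (simp add: tensor_lift_def q_def)
qed

lemma tensor_lift_module_hom:
  assumes "field K" "module K M" "module K N" "multilinear K M n N f"
  shows "tensor_lift K N f \<in> module_hom K (tensor_power K M n) N"
proof -
  interpret K: field K by fact
  let ?F = "free_module K (words M n)" and ?R = "tensor_null K M n"
  interpret F: module K ?F by (rule module_free_module) unfold_locales
  have f: "f \<in> words M n \<rightarrow> carrier N" using assms(4) by (auto simp: multilinear_def)
  note h = module_hom_simps[OF lin_ext_hom[OF assms(3) f]]
  note R = submodule_tensor_null[OF assms(2), of n]
  show ?thesis
    unfolding module_hom_def tensor_power_def
    by (auto elim!: F.quotient_carrierE
      simp: F.quotient_add[OF R] F.quotient_smult[OF R] tensor_lift_coset[OF assms] h)
qed

lemma tensor_lift_tensor: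
  assumes "field K" "module K M" "module K N" "multilinear K M n N f" "xs \<in> words M n"
  shows "tensor_lift K N f (tensor K M xs) = f xs"
proof -
  interpret K: field K by fact
  have f: "f xs \<in> carrier N" using assms(4,5) by (auto simp: multilinear_def)
  have n: "length xs = n" using assms(5) by (simp add: words_def)
  show ?thesis
    unfolding tensor_def n
      tensor_lift_coset[OF assms(1-4) basis_vec_closed[OF K.is_cring assms(5)]]
    by (rule lin_ext_basis_vec[of K N f xs, OF assms(3) f]) simp
qed


section \<open>Hopf algebras\<close>

locale assoc_algebra = field K + ring A + module K A for K and A (structure) +
  assumes smult_mult_left:
      "\<lbrakk>c \<in> carrier K; x \<in> carrier A; y \<in> carrier A\<rbrakk> \<Longrightarrow> (c \<odot> x) \<otimes> y = c \<odot> (x \<otimes> y)"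
    and smult_mult_right:
      "\<lbrakk>c \<in> carrier K; x \<in> carrier A; y \<in> carrier A\<rbrakk> \<Longrightarrow> x \<otimes> (c \<odot> y) = c \<odot> (x \<otimes> y)"

record ('k, 'h) hopf = "('k, 'h) module" +
  comult :: "'h \<Rightarrow> ('h list \<Rightarrow> 'k) set"
  counit :: "'h \<Rightarrow> 'k"
  antipode :: "'h \<Rightarrow> 'h"

text \<open>The product \<open>(a \<otimes> b)(c \<otimes> d) = ac \<otimes> bd\<close> of \<open>A \<otimes> A\<close>.\<close>

definition tensor_square_mult ::
    "('k, 'r) ring_scheme \<Rightarrow> ('k, 'a, 's) module_scheme \<Rightarrow>
     ('a list \<Rightarrow> 'k) set \<Rightarrow> ('a list \<Rightarrow> 'k) set \<Rightarrow> ('a list \<Rightarrow> 'k) set"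
  where "tensor_square_mult K A X Y =
    tensor_lift K (tensor_power K A 2)
      (\<lambda>xs. tensor_lift K (tensor_power K A 2)
         (\<lambda>ys. tensor K A [xs ! 0 \<otimes>\<^bsub>A\<^esub> ys ! 0, xs ! 1 \<otimes>\<^bsub>A\<^esub> ys ! 1]) Y) X"

text \<open>\<open>x\<^sup>0 \<otimes> \<dots> \<otimes> x\<^sup>j\<^sub>(\<^sub>1\<^sub>) \<otimes> x\<^sup>j\<^sub>(\<^sub>2\<^sub>) \<otimes> \<dots> \<otimes> x\<^sup>n\<close> for \<open>xs = [x\<^sup>0, \<dots>, x\<^sup>n]\<close>.\<close>

definition comult_at ::
    "('k, 'r) ring_scheme \<Rightarrow> ('k, 'h, 's) hopf_scheme \<Rightarrow> nat \<Rightarrow> 'h list \<Rightarrow> ('h list \<Rightarrow> 'k) set"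
  where "comult_at K H j xs =
    tensor_lift K (tensor_power K H (length xs + 1))
      (\<lambda>zs. tensor K H (take j xs @ zs @ drop (Suc j) xs)) (comult H (xs ! j))"

text \<open>
  The iterated comultiplication \<open>x\<^sub>(\<^sub>1\<^sub>) \<otimes> \<dots> \<otimes> x\<^sub>(\<^sub>r\<^sub>+\<^sub>1\<^sub>)\<close>. Note that \<open>r\<close> counts comultiplications,
  so that the value lies in the tensor power of order \<open>r + 1\<close>; and that in a list \<open>zs\<close> of
  Sweedler components \<open>x\<^sub>(\<^sub>i\<^sub>)\<close> is \<open>zs ! (i - 1)\<close>.
\<close>

primrec iter_comult ::
    "('k, 'r) ring_scheme \<Rightarrow> ('k, 'h, 's) hopf_scheme \<Rightarrow> nat \<Rightarrow> 'h \<Rightarrow> ('h list \<Rightarrow> 'k) set"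
  where
    "iter_comult K H 0 x = tensor K H [x]"
  | "iter_comult K H (Suc r) x =
       tensor_lift K (tensor_power K H (r + 2)) (comult_at K H 0) (iter_comult K H r x)"

locale bialgebra = assoc_algebra K H for K and H :: "('k, 'h, 's) hopf_scheme" (structure) +
  assumes comult_hom: "comult H \<in> module_hom K H (tensor_power K H 2)"
    and comult_one: "comult H \<one> = tensor K H [\<one>, \<one>]"
    and comult_mult:
      "\<lbrakk>x \<in> carrier H; y \<in> carrier H\<rbrakk> \<Longrightarrow>
        comult H (x \<otimes> y) = tensor_square_mult K H (comult H x) (comult H y)"
    and counit_ring_hom: "counit H \<in> ring_hom H K"
    and counit_smult:
      "\<lbrakk>c \<in> carrier K; x \<in> carrier H\<rbrakk> \<Longrightarrow> counit H (c \<odot> x) = c \<otimes>\<^bsub>K\<^esub> counit H x"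
    and coassoc:
      "x \<in> carrier H \<Longrightarrow>
        tensor_lift K (tensor_power K H 3) (comult_at K H 0) (comult H x) =
        tensor_lift K (tensor_power K H 3) (comult_at K H 1) (comult H x)"
    and counit_left:
      "x \<in> carrier H \<Longrightarrow> tensor_lift K H (\<lambda>zs. counit H (zs ! 0) \<odot> zs ! 1) (comult H x) = x"
    and counit_right:
      "x \<in> carrier H \<Longrightarrow> tensor_lift K H (\<lambda>zs. counit H (zs ! 1) \<odot> zs ! 0) (comult H x) = x"

locale hopf_algebra = bialgebra +
  assumes antipode_hom: "antipode H \<in> module_hom K H H"
    and antipode_left:
      "x \<in> carrier H \<Longrightarrow>
        tensor_lift K H (\<lambda>zs. antipode H (zs ! 0) \<otimes> zs ! 1) (comult H x) = counit H x \<odot> \<one>"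
    and antipode_right:
      "x \<in> carrier H \<Longrightarrow>
        tensor_lift K H (\<lambda>zs. zs ! 0 \<otimes> antipode H (zs ! 1)) (comult H x) = counit H x \<odot> \<one>"


section \<open>Differential graded algebras\<close>

definition koszul_sign :: "('k, 'r) ring_scheme \<Rightarrow> nat \<Rightarrow> 'k"
  where "koszul_sign K n = (\<ominus>\<^bsub>K\<^esub> \<one>\<^bsub>K\<^esub>) [^]\<^bsub>K\<^esub> n"

text \<open>
  A differential graded algebra concentrated in nonnegative degrees, given by the family of its
  homogeneous components \<open>A n\<close>, the products \<open>A n \<times> A m \<rightarrow> A (n + m)\<close>, the unit in \<open>A 0\<close>
  and the differentials \<open>A n \<rightarrow> A (n + 1)\<close>.
\<close>

locale dg_algebra = field K for K :: "('k, 'r) ring_scheme" +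
  fixes A :: "nat \<Rightarrow> ('k, 'a, 's) module_scheme"
    and mul :: "nat \<Rightarrow> nat \<Rightarrow> 'a \<Rightarrow> 'a \<Rightarrow> 'a"
    and unit :: 'a
    and d :: "nat \<Rightarrow> 'a \<Rightarrow> 'a"
  assumes component_module: "module K (A n)"
    and mul_linear_right: "x \<in> carrier (A n) \<Longrightarrow> mul n m x \<in> module_hom K (A m) (A (n + m))"
    and mul_linear_left: "y \<in> carrier (A m) \<Longrightarrow> (\<lambda>x. mul n m x y) \<in> module_hom K (A n) (A (n + m))"
    and mul_assoc:
      "\<lbrakk>x \<in> carrier (A n); y \<in> carrier (A m); z \<in> carrier (A l)\<rbrakk> \<Longrightarrow>
        mul (n + m) l (mul n m x y) z = mul n (m + l) x (mul m l y z)"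
    and unit_closed: "unit \<in> carrier (A 0)"
    and unit_mul: "x \<in> carrier (A n) \<Longrightarrow> mul 0 n unit x = x"
    and mul_unit: "x \<in> carrier (A n) \<Longrightarrow> mul n 0 x unit = x"
    and d_linear: "d n \<in> module_hom K (A n) (A (n + 1))"
    and d_d: "x \<in> carrier (A n) \<Longrightarrow> d (n + 1) (d n x) = \<zero>\<^bsub>A (n + 2)\<^esub>"
    and leibniz:
      "\<lbrakk>x \<in> carrier (A n); y \<in> carrier (A m)\<rbrakk> \<Longrightarrow>
        d (n + m) (mul n m x y) =
          mul (n + 1) m (d n x) y \<oplus>\<^bsub>A (n + m + 1)\<^esub>
          koszul_sign K n \<odot>\<^bsub>A (n + m + 1)\<^esub> mul n (m + 1) x (d m y)"


section \<open>The algebra \<open>K\<^sup>*(H)\<close>\<close>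

definition Khat ::
    "('k, 'r) ring_scheme \<Rightarrow> ('k, 'h, 's) hopf_scheme \<Rightarrow> nat \<Rightarrow> ('k, ('h list \<Rightarrow> 'k) set) module"
  where "Khat K H n = tensor_power K H (n + 1)"

definition Khat_mult_pure ::
    "('k, 'r) ring_scheme \<Rightarrow> ('k, 'h, 's) hopf_scheme \<Rightarrow> nat \<Rightarrow> nat \<Rightarrow>
     'h list \<Rightarrow> 'h list \<Rightarrow> ('h list \<Rightarrow> 'k) set"
  where "Khat_mult_pure K H n m xs ys =
    tensor_lift K (Khat K H (n + m))
      (\<lambda>zs. tensor K H
         (take n xs @
          map (\<lambda>i. zs ! i \<otimes>\<^bsub>H\<^esub> ys ! i \<otimes>\<^bsub>H\<^esub> antipode H (zs ! (2 * m - i))) [0..<m] @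
          [zs ! m \<otimes>\<^bsub>H\<^esub> ys ! m]))
      (iter_comult K H (2 * m) (xs ! n))"

definition Khat_mult ::
    "('k, 'r) ring_scheme \<Rightarrow> ('k, 'h, 's) hopf_scheme \<Rightarrow> nat \<Rightarrow> nat \<Rightarrow>
     ('h list \<Rightarrow> 'k) set \<Rightarrow> ('h list \<Rightarrow> 'k) set \<Rightarrow> ('h list \<Rightarrow> 'k) set"
  where "Khat_mult K H n m X Y =
    tensor_lift K (Khat K H (n + m))
      (\<lambda>xs. tensor_lift K (Khat K H (n + m)) (Khat_mult_pure K H n m xs) Y) X"

definition Khat_diff_pure ::
    "('k, 'r) ring_scheme \<Rightarrow> ('k, 'h, 's) hopf_scheme \<Rightarrow> nat \<Rightarrow> 'h list \<Rightarrow> ('h list \<Rightarrow> 'k) set"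
  where "Khat_diff_pure K H n xs =
    (let T = Khat K H (n + 1) in
      (\<ominus>\<^bsub>T\<^esub> tensor K H (\<one>\<^bsub>H\<^esub> # xs)) \<oplus>\<^bsub>T\<^esub>
      (\<Oplus>\<^bsub>T\<^esub>j \<in> {..<n}. koszul_sign K j \<odot>\<^bsub>T\<^esub> comult_at K H j xs) \<oplus>\<^bsub>T\<^esub>
      koszul_sign K n \<odot>\<^bsub>T\<^esub>
        tensor_lift K T
          (\<lambda>zs. tensor K H (take n xs @ [zs ! 0 \<otimes>\<^bsub>H\<^esub> antipode H (zs ! 2), zs ! 1]))
          (iter_comult K H 2 (xs ! n)))"

definition Khat_diff ::
    "('k, 'r) ring_scheme \<Rightarrow> ('k, 'h, 's) hopf_scheme \<Rightarrow> nat \<Rightarrow>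
     ('h list \<Rightarrow> 'k) set \<Rightarrow> ('h list \<Rightarrow> 'k) set"
  where "Khat_diff K H n = tensor_lift K (Khat K H (n + 1)) (Khat_diff_pure K H n)"

end

theory Submission
  imports Defs
begin

text \<open>
  Put \<open>\<omega> = 1 \<otimes> 1\<close>, an element of degree 1. On an element \<open>X\<close> of degree \<open>n\<close> the differential
  is \<open>d X = - \<omega> X + D X + (-1)\<^sup>n X \<omega>\<close>, where \<open>D X\<close> is the alternating sum over \<open>j < n\<close>
  of the comultiplications of the \<open>j\<close>-th factor. As \<open>D \<omega> = \<omega>\<^sup>2\<close>, the claims on \<open>d\<close> follow
  from associativity, from \<open>D\<^sup>2 = 0\<close> and from the Leibniz rule for \<open>D\<close>. The equations
  \<open>(x \<otimes> X) Y = x \<otimes> X Y\<close> and \<open>D (x \<otimes> X) = \<Delta> x \<otimes> X - x \<otimes> D X\<close> reduce these to the case where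
  the left factor is a single \<open>x \<in> H\<close>. Multiplication by \<open>x\<close> sends \<open>y \<otimes> Y\<close> to
  \<open>x\<^sub>1 y S(x\<^sub>3) \<otimes> x\<^sub>2 Y\<close>; this is an action of \<open>H\<close> because \<open>S\<close> is antimultiplicative, and it
  commutes with \<open>D\<close> because \<open>S\<close> is anticomultiplicative.
\<close>

section \<open>Linear maps\<close>

text \<open>The differential is D minus the graded commutator with \<omega>, so
  \<open>d\<^sup>2 = 0\<close> comes down to a Maurer-Cartan equation for \<omega>. The choice of
  \<omega> is forced: right multiplication by it is exactly the last summand of the differential. D
  leaves out the last factor because there x acts by plain multiplication: comultiplying
  \<open>x y\<close> gives \<open>x\<^sub>1 y\<^sub>1 \<otimes> x\<^sub>2 y\<^sub>2\<close>, whereas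
  acting on the comultiplication of y gives \<open>x\<^sub>1 y\<^sub>1 S(x\<^sub>3) \<otimes>
  x\<^sub>2 y\<^sub>2\<close>. The obstacle is that the product uses 2m + 1 legs at once, while an
  induction wants three. Coassociativity splits the two outer legs off an iterated comultiplication,
  and the nesting of the pairs i and 2m - i turns the formula into a recursion. Elements are classes
  of formal sums without distinguished Sweedler components. Sweedler sums are therefore lifts along
  the comultiplication, and identities between them are tested on pure tensors by linearity.\<close>

lemma foldSetD_cong_on:
  assumes "(B, z) \<in> foldSetD D f e" "\<And>x. x \<in> B \<Longrightarrow> f x = g x"
  shows "(B, z) \<in> foldSetD D g e"
  using assms
proof induct
  case emptyI thus ?case by (simp add: foldSetD.emptyI)
next
  case (insertI x A y)
  have "f x = g x" "(A, y) \<in> foldSetD D g e" using insertI by auto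
  thus ?case using insertI(1,2) by (metis foldSetD.insertI)
qed

text \<open>Unlike in the library rule, the summands need not be elements of the carrier.\<close>

lemma finsum_cong_on:
  assumes "\<And>x. x \<in> B \<Longrightarrow> f x = g x"
  shows "finsum G f B = finsum G g B"
proof -
  have "(B, z) \<in> foldSetD (carrier G) (\<lambda>x. add G (f x)) e \<longleftrightarrow>
      (B, z) \<in> foldSetD (carrier G) (\<lambda>x. add G (g x)) e" for z e
    using assms by (auto intro: foldSetD_cong_on)
  thus ?thesis by (simp add: finsum_def finprod_def foldD_def comp_def)
qed

lemma module_hom_finsum:
  assumes "module K N" "module K N'" "\<phi> \<in> module_hom K N N'" "finite S" "g \<in> S \<rightarrow> carrier N"
  shows "\<phi> (\<Oplus>\<^bsub>N\<^esub>b \<in> S. g b) = (\<Oplus>\<^bsub>N'\<^esub>b \<in> S. \<phi> (g b))"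
proof -
  interpret N: module K N by fact
  interpret N': module K N' by fact
  note h = module_hom_simps[OF assms(3)]
  \<comment> \<open>\<open>module_hom\<close> does not list zero among what is preserved; it is
    recovered from 0 + 0 = 0 by cancellation.\<close>
  have "\<phi> \<zero>\<^bsub>N\<^esub> \<oplus>\<^bsub>N'\<^esub> \<phi> \<zero>\<^bsub>N\<^esub> = \<phi> \<zero>\<^bsub>N\<^esub>"
    using h(2)[of "\<zero>\<^bsub>N\<^esub>" "\<zero>\<^bsub>N\<^esub>"] by simp
  hence z: "\<phi> \<zero>\<^bsub>N\<^esub> = \<zero>\<^bsub>N'\<^esub>"
    using h(1)[of "\<zero>\<^bsub>N\<^esub>"] by simp
  show ?thesis using assms(4,5)
  proof induct
    case empty thus ?case by (simp add: z)
  next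
    case (insert b S)
    thus ?case by (simp add: h Pi_iff)
  qed
qed

lemma module_hom_comp:
  "\<lbrakk>\<phi> \<in> module_hom K N N'; g \<in> module_hom K M N\<rbrakk> \<Longrightarrow> (\<lambda>x. \<phi> (g x)) \<in> module_hom K M N'"
  by (auto simp: module_hom_def Pi_iff)

lemma module_hom_id: "(\<lambda>x. x) \<in> module_hom K M M"
  by (auto simp: module_hom_def)

text \<open>Linearity looks at the carrier only. This lets a map be exchanged for a recursion
  formula that is known merely for elements of the carrier.\<close>

lemma module_hom_cong:
  assumes "module K M" "\<And>x. x \<in> carrier M \<Longrightarrow> f x = g x" "f \<in> module_hom K M N"
  shows "g \<in> module_hom K M N"
proof -
  interpret module K M by fact
  show ?thesis using assms(2,3) by (auto simp: module_hom_def Pi_iff)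
qed

lemma module_hom_zero:
  assumes "module K N" "module K N'" "\<phi> \<in> module_hom K N N'"
  shows "\<phi> \<zero>\<^bsub>N\<^esub> = \<zero>\<^bsub>N'\<^esub>"
  using module_hom_finsum[OF assms, of "{}" "\<lambda>_. undefined"] assms(1,2)
  by (simp add: module_def abelian_group_def abelian_monoid.finsum_empty)

lemma module_hom_add:
  assumes "module K N" "f \<in> module_hom K M N" "g \<in> module_hom K M N"
  shows "(\<lambda>x. f x \<oplus>\<^bsub>N\<^esub> g x) \<in> module_hom K M N"
proof -
  interpret module K N by fact
  show ?thesis using assms(2,3)
    by (auto simp: module_hom_def Pi_iff smult_r_distr M.a_ac)
qed

lemma module_hom_smult:
  assumes "module K N" "f \<in> module_hom K M N" "c \<in> carrier K"
  shows "(\<lambda>x. c \<odot>\<^bsub>N\<^esub> f x) \<in> module_hom K M N"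
proof -
  interpret module K N by fact
  show ?thesis using assms(2,3)
    by (auto simp: module_hom_def Pi_iff smult_r_distr smult_assoc1[symmetric] R.m_comm)
qed

lemma module_hom_uminus:
  assumes "module K N" "f \<in> module_hom K M N"
  shows "(\<lambda>x. \<ominus>\<^bsub>N\<^esub> f x) \<in> module_hom K M N"
proof -
  interpret module K N by fact
  show ?thesis using assms(2)
    by (auto simp: module_hom_def Pi_iff M.minus_add smult_r_minus)
qed

lemma module_hom_const_zero:
  assumes "module K N"
  shows "(\<lambda>x. \<zero>\<^bsub>N\<^esub>) \<in> module_hom K M N"
proof -
  interpret module K N by fact
  show ?thesis by (auto simp: module_hom_def)
qed

lemma module_hom_sum:
  assumes "module K N" "finite S" "\<And>j. j \<in> S \<Longrightarrow> f j \<in> module_hom K M N"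
  shows "(\<lambda>x. \<Oplus>\<^bsub>N\<^esub>j \<in> S. f j x) \<in> module_hom K M N"
proof -
  interpret module K N by fact
  have c: "f j x \<in> carrier N" if "j \<in> S" "x \<in> carrier M" for j x
    using module_hom_simps(1)[OF assms(3)] that by blast
  show ?thesis unfolding module_hom_def mem_Collect_eq
  proof (intro conjI ballI)
    show "(\<lambda>x. \<Oplus>\<^bsub>N\<^esub>j \<in> S. f j x) \<in> carrier M \<rightarrow> carrier N"
      using c by (auto intro!: M.finsum_closed)
  next
    fix x y assume xy: "x \<in> carrier M" "y \<in> carrier M"
    have "(\<Oplus>\<^bsub>N\<^esub>j \<in> S. f j (x \<oplus>\<^bsub>M\<^esub> y)) = (\<Oplus>\<^bsub>N\<^esub>j \<in> S. f j x \<oplus>\<^bsub>N\<^esub> f j y)"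
      using c xy by (intro M.finsum_cong') (auto simp: module_hom_simps(2)[OF assms(3)])
    also have "\<dots> = (\<Oplus>\<^bsub>N\<^esub>j \<in> S. f j x) \<oplus>\<^bsub>N\<^esub> (\<Oplus>\<^bsub>N\<^esub>j \<in> S. f j y)"
      using c xy by (intro M.finsum_addf) auto
    finally show "(\<Oplus>\<^bsub>N\<^esub>j \<in> S. f j (x \<oplus>\<^bsub>M\<^esub> y)) = (\<Oplus>\<^bsub>N\<^esub>j \<in> S. f j x) \<oplus>\<^bsub>N\<^esub> (\<Oplus>\<^bsub>N\<^esub>j \<in> S. f j y)" .
  next
    fix a x assume ax: "a \<in> carrier K" "x \<in> carrier M"
    have "(\<Oplus>\<^bsub>N\<^esub>j \<in> S. f j (a \<odot>\<^bsub>M\<^esub> x)) = (\<Oplus>\<^bsub>N\<^esub>j \<in> S. a \<odot>\<^bsub>N\<^esub> f j x)"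
      using c ax by (intro M.finsum_cong') (auto simp: module_hom_simps(3)[OF assms(3)])
    also have "\<dots> = a \<odot>\<^bsub>N\<^esub> (\<Oplus>\<^bsub>N\<^esub>j \<in> S. f j x)"
      using c ax by (intro finsum_smult_ldistr[symmetric] assms(2)) auto
    finally show "(\<Oplus>\<^bsub>N\<^esub>j \<in> S. f j (a \<odot>\<^bsub>M\<^esub> x)) = a \<odot>\<^bsub>N\<^esub> (\<Oplus>\<^bsub>N\<^esub>j \<in> S. f j x)" .
  qed
qed

section \<open>Words of fixed length\<close>

lemma Nil_in_words [simp]: "[] \<in> words M n \<longleftrightarrow> n = 0"
  by (auto simp: words_def)

lemma words_0 [simp]: "xs \<in> words M 0 \<longleftrightarrow> xs = []"
  by (auto simp: words_def)

lemma Cons_in_words [simp]: "x # xs \<in> words M (Suc n) \<longleftrightarrow> x \<in> carrier M \<and> xs \<in> words M n"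
  by (auto simp: words_def)

lemma words_SucE:
  assumes "xs \<in> words M (Suc n)"
  obtains y ys where "xs = y # ys" "y \<in> carrier M" "ys \<in> words M n"
  using assms by (cases xs) (auto simp: words_def)

lemma append_in_words: "xs \<in> words M n \<Longrightarrow> ys \<in> words M m \<Longrightarrow> xs @ ys \<in> words M (n + m)"
  by (auto simp: words_def)

lemma length_words: "xs \<in> words M n \<Longrightarrow> length xs = n"
  by (simp add: words_def)

section \<open>Tensor powers over a field\<close>

locale field_module = K: field K + module K M
  for K :: "('k, 'r) ring_scheme" and M :: "('k, 'a, 's) module_scheme" (structure)
begin

abbreviation T :: "nat \<Rightarrow> ('k, ('a list \<Rightarrow> 'k) set) module"
  where "T n \<equiv> tensor_power K M n"

lemma module_M: "module K M" by unfold_locales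
lemma field_K: "field K" by unfold_locales

lemma module_T: "module K (T n)"
  by (rule module_tensor_power[OF module_M])

text \<open>
  A lift evaluates at a representative of the class which does not depend on the map that is
  lifted. Hence it is a fixed finite sum, and is natural and linear in that map even if the map
  is not multilinear.
\<close>

lemma tensor_lift_finsum:
  assumes "X \<in> carrier (T n)"
  defines "p \<equiv> SOME p. p \<in> X"
  defines "S \<equiv> {b. p b \<noteq> \<zero>\<^bsub>K\<^esub>}"
  shows "finite S" "S \<subseteq> words M n" "p b \<in> carrier K"
    "tensor_lift K N f X = (\<Oplus>\<^bsub>N\<^esub>b \<in> S. p b \<odot>\<^bsub>N\<^esub> f b)"
proof -
  let ?F = "free_module K (words M n)" and ?R = "tensor_null K M n"
  interpret F: module K ?F by (rule module_free_module) (rule K.is_cring)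
  note R = submodule_tensor_null[OF module_M, of n]
  interpret R: abelian_subgroup ?R ?F by (rule F.abelian_subgroup_submodule[OF R])
  from assms(1) obtain q where q: "q \<in> carrier ?F" "X = ?R +>\<^bsub>?F\<^esub> q"
    unfolding tensor_power_def by (rule F.quotient_carrierE)
  have "p \<in> X" unfolding p_def q(2) using R.a_rcos_self[OF q(1)] by (rule someI[of "\<lambda>x. x \<in> ?R +>\<^bsub>?F\<^esub> q"])
  then obtain r where "r \<in> ?R" "p = r \<oplus>\<^bsub>?F\<^esub> q" using q(2) by (auto simp: a_r_coset_def')
  hence "p \<in> carrier ?F" using q R.a_subset by auto
  thus "finite S" "S \<subseteq> words M n" "p b \<in> carrier K" 
    "tensor_lift K N f X = (\<Oplus>\<^bsub>N\<^esub>b \<in> S. p b \<odot>\<^bsub>N\<^esub> f b)"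
    by (auto simp: free_module_simps tensor_lift_def lin_ext_def p_def S_def)
qed

lemma tensor_lift_closed:
  assumes "module K N" "X \<in> carrier (T n)" "\<And>zs. zs \<in> words M n \<Longrightarrow> f zs \<in> carrier N"
  shows "tensor_lift K N f X \<in> carrier N"
proof -
  interpret N: module K N by fact
  note L = tensor_lift_finsum[OF assms(2)]
  show ?thesis using L(1-3) assms(3) unfolding L(4)
    by (intro N.M.finsum_closed) (auto simp: Pi_iff subset_iff)
qed

lemma tensor_lift_cong:
  assumes "X \<in> carrier (T n)" "\<And>zs. zs \<in> words M n \<Longrightarrow> f zs = g zs"
  shows "tensor_lift K N f X = tensor_lift K N g X"
proof -
  note L = tensor_lift_finsum[OF assms(1)]
  show ?thesis unfolding L(4)
    by (rule finsum_cong_on) (metis L(2) assms(2) subsetD)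
qed

lemma module_hom_tensor_lift:
  assumes "module K N" "module K N'" "\<phi> \<in> module_hom K N N'" "X \<in> carrier (T n)"
    "\<And>zs. zs \<in> words M n \<Longrightarrow> f zs \<in> carrier N"
  shows "\<phi> (tensor_lift K N f X) = tensor_lift K N' (\<lambda>zs. \<phi> (f zs)) X"
proof -
  interpret N: module K N by fact
  interpret N': module K N' by fact
  note h = module_hom_simps[OF assms(3)]
  note L = tensor_lift_finsum[OF assms(4)]
  have c: "zs \<in> {b. (SOME p. p \<in> X) b \<noteq> \<zero>\<^bsub>K\<^esub>} \<Longrightarrow> f zs \<in> carrier N" for zs
    using L(2) assms(5) by blast
  show ?thesis unfolding L(4)
    by (subst module_hom_finsum[OF assms(1-3) L(1)])
      (use L(3) in \<open>auto intro!: finsum_cong_on h(3) c[simplified]\<close>)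
qed

text \<open>Fubini for finite sums: both sides run over the supports of one representative of
  \<open>X\<close> and one of \<open>Y\<close>. In Sweedler notation it lets the legs of two
  independent elements be expanded in either order.\<close>

lemma tensor_lift_swap:
  assumes "module K N" "X \<in> carrier (T n)" "Y \<in> carrier (T m)"
    "\<And>xs ys. xs \<in> words M n \<Longrightarrow> ys \<in> words M m \<Longrightarrow> f xs ys \<in> carrier N"
  shows "tensor_lift K N (\<lambda>xs. tensor_lift K N (f xs) Y) X = tensor_lift K N (\<lambda>ys. tensor_lift K N (\<lambda>xs. f xs ys) X) Y"
proof -
  interpret N: module K N by fact
  note L = tensor_lift_finsum[OF assms(2)] and L' = tensor_lift_finsum[OF assms(3)]
  define p where "p = (SOME p. p \<in> X)"
  define q where "q = (SOME p. p \<in> Y)"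
  define S where "S = {b. p b \<noteq> \<zero>\<^bsub>K\<^esub>}"
  define S' where "S' = {b. q b \<noteq> \<zero>\<^bsub>K\<^esub>}"
  note L = L[folded p_def, folded S_def] and L' = L'[folded q_def, folded S'_def]
  have c: "f xs ys \<in> carrier N" if "xs \<in> S" "ys \<in> S'" for xs ys
    using assms(4) L(2) L'(2) that by blast
  \<comment> \<open>The induction runs over a part \<open>A\<close> of the support for
    \<open>X\<close>, with the support for \<open>Y\<close> held fixed.\<close>
  have "(\<Oplus>\<^bsub>N\<^esub>xs \<in> A. p xs \<odot>\<^bsub>N\<^esub> (\<Oplus>\<^bsub>N\<^esub>ys \<in> S'. q ys \<odot>\<^bsub>N\<^esub> f xs ys))
      = (\<Oplus>\<^bsub>N\<^esub>ys \<in> S'. q ys \<odot>\<^bsub>N\<^esub> (\<Oplus>\<^bsub>N\<^esub>xs \<in> A. p xs \<odot>\<^bsub>N\<^esub> f xs ys))" if "finite A" "A \<subseteq> S" for A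
    using that
  proof induct
    case empty
    have "(\<Oplus>\<^bsub>N\<^esub>ys \<in> S'. q ys \<odot>\<^bsub>N\<^esub> \<zero>\<^bsub>N\<^esub>) = (\<Oplus>\<^bsub>N\<^esub>ys \<in> S'. \<zero>\<^bsub>N\<^esub>)"
      using L'(3) by (intro N.M.finsum_cong') auto
    thus ?case by simp
  next
    case (insert x A)
    have c1: "p x' \<odot>\<^bsub>N\<^esub> f x' ys \<in> carrier N" "p x' \<odot>\<^bsub>N\<^esub> (q ys \<odot>\<^bsub>N\<^esub> f x' ys) \<in> carrier N" "q ys \<odot>\<^bsub>N\<^esub> f x' ys \<in> carrier N"
      if "x' \<in> insert x A" "ys \<in> S'" for x' ys
      using that insert c L(3) L'(3) by auto
    have c2: "(\<Oplus>\<^bsub>N\<^esub>xs \<in> A. p xs \<odot>\<^bsub>N\<^esub> f xs ys) \<in> carrier N" if "ys \<in> S'" for ys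
      using that c1 by (intro N.M.finsum_closed) auto
    have "(\<Oplus>\<^bsub>N\<^esub>xs \<in> insert x A. p xs \<odot>\<^bsub>N\<^esub> (\<Oplus>\<^bsub>N\<^esub>ys \<in> S'. q ys \<odot>\<^bsub>N\<^esub> f xs ys)) =
      p x \<odot>\<^bsub>N\<^esub> (\<Oplus>\<^bsub>N\<^esub>ys \<in> S'. q ys \<odot>\<^bsub>N\<^esub> f x ys) \<oplus>\<^bsub>N\<^esub> (\<Oplus>\<^bsub>N\<^esub>ys \<in> S'. q ys \<odot>\<^bsub>N\<^esub> (\<Oplus>\<^bsub>N\<^esub>xs \<in> A. p xs \<odot>\<^bsub>N\<^esub> f xs ys))"
      using insert L(3) L'(3) c1 by (subst N.M.finsum_insert) (auto intro!: N.smult_closed N.M.finsum_closed)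
    also have "p x \<odot>\<^bsub>N\<^esub> (\<Oplus>\<^bsub>N\<^esub>ys \<in> S'. q ys \<odot>\<^bsub>N\<^esub> f x ys) = (\<Oplus>\<^bsub>N\<^esub>ys \<in> S'. p x \<odot>\<^bsub>N\<^esub> (q ys \<odot>\<^bsub>N\<^esub> f x ys))"
      using c1 L L' by (intro N.finsum_smult_ldistr) auto
    also have "\<dots> \<oplus>\<^bsub>N\<^esub> (\<Oplus>\<^bsub>N\<^esub>ys \<in> S'. q ys \<odot>\<^bsub>N\<^esub> (\<Oplus>\<^bsub>N\<^esub>xs \<in> A. p xs \<odot>\<^bsub>N\<^esub> f xs ys)) =
        (\<Oplus>\<^bsub>N\<^esub>ys \<in> S'. p x \<odot>\<^bsub>N\<^esub> (q ys \<odot>\<^bsub>N\<^esub> f x ys) \<oplus>\<^bsub>N\<^esub> q ys \<odot>\<^bsub>N\<^esub> (\<Oplus>\<^bsub>N\<^esub>xs \<in> A. p xs \<odot>\<^bsub>N\<^esub> f xs ys))"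
      using c1 c2 L'(3) by (intro N.M.finsum_addf[symmetric]) auto
    \<comment> \<open>Exchanging the scalars \<open>p x\<close> and \<open>q ys\<close> uses
      commutativity of K.\<close>
    also have "\<dots> = (\<Oplus>\<^bsub>N\<^esub>ys \<in> S'. q ys \<odot>\<^bsub>N\<^esub> (\<Oplus>\<^bsub>N\<^esub>xs \<in> insert x A. p xs \<odot>\<^bsub>N\<^esub> f xs ys))"
    proof (rule N.M.finsum_cong')
      fix ys assume ys: "ys \<in> S'"
      have "(\<Oplus>\<^bsub>N\<^esub>xs \<in> insert x A. p xs \<odot>\<^bsub>N\<^esub> f xs ys) = p x \<odot>\<^bsub>N\<^esub> f x ys \<oplus>\<^bsub>N\<^esub> (\<Oplus>\<^bsub>N\<^esub>xs \<in> A. p xs \<odot>\<^bsub>N\<^esub> f xs ys)"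
        using insert c1 ys by (subst N.M.finsum_insert) auto
      thus "p x \<odot>\<^bsub>N\<^esub> (q ys \<odot>\<^bsub>N\<^esub> f x ys) \<oplus>\<^bsub>N\<^esub> q ys \<odot>\<^bsub>N\<^esub> (\<Oplus>\<^bsub>N\<^esub>xs \<in> A. p xs \<odot>\<^bsub>N\<^esub> f xs ys) =
          q ys \<odot>\<^bsub>N\<^esub> (\<Oplus>\<^bsub>N\<^esub>xs \<in> insert x A. p xs \<odot>\<^bsub>N\<^esub> f xs ys)"
        using ys c1[of x ys] c2[OF ys] c[of x ys] insert.prems L(3)[of x] L'(3)[of ys]
        by (simp add: N.smult_r_distr N.smult_assoc1[symmetric] K.m_comm)
    qed (use c1 L'(3) in \<open>auto intro!: N.smult_closed N.M.finsum_closed\<close>)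
    finally show ?case .
  qed
  from this[OF L(1) subset_refl] show ?thesis unfolding L(4) L'(4) .
qed

text \<open>Here the class \<open>X\<close> is fixed and the lifted map carries the parameter.
  Linearity in \<open>X\<close> itself is \<open>tensor_lift_hom\<close>, which asks for
  multilinearity.\<close>

lemma tensor_lift_linear:
  assumes "module K N" "X \<in> carrier (T n)" "\<And>zs. zs \<in> words M n \<Longrightarrow> (\<lambda>x. f x zs) \<in> module_hom K N' N"
  shows "(\<lambda>x. tensor_lift K N (f x) X) \<in> module_hom K N' N"
proof -
  note L = tensor_lift_finsum[OF assms(2)]
  show ?thesis unfolding L(4)
    by (intro module_hom_sum[OF assms(1)] module_hom_smult[OF assms(1)] L(1,3) assms(3)) (use L(2) in blast)
qed

section \<open>Multilinear maps on words\<close>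

lemma multilinear_closed: "multilinear K M n N f \<Longrightarrow> xs \<in> words M n \<Longrightarrow> f xs \<in> carrier N"
  by (auto simp: multilinear_def)

lemma multilinear_insert:
  assumes "multilinear K M n N f" "us \<in> words M i" "vs \<in> words M j" "Suc (i + j) = n"
  shows "(\<lambda>x. f (us @ x # vs)) \<in> module_hom K M N"
proof -
  \<comment> \<open>The letter at the tested place is overwritten at once, so zero is only a
    placeholder.\<close>
  have "us @ \<zero>\<^bsub>M\<^esub> # vs \<in> words M n" using assms(2-4) by (auto simp: words_def)
  moreover have "(us @ \<zero>\<^bsub>M\<^esub> # vs)[i := x] = us @ x # vs" for x
    using assms(2) by (auto simp: words_def)
  moreover have "i < n" using assms(4) by simp
  ultimately show ?thesis using assms(1) unfolding multilinear_def by fastforce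
qed

lemma multilinear_hd:
  assumes "multilinear K M (Suc n) N f" "xs \<in> words M n"
  shows "(\<lambda>x. f (x # xs)) \<in> module_hom K M N"
  using multilinear_insert[OF assms(1), of "[]" 0 xs n] assms(2) by simp

lemma multilinear_last:
  assumes "multilinear K M (Suc n) N f" "xs \<in> words M n"
  shows "(\<lambda>x. f (xs @ [x])) \<in> module_hom K M N"
  using multilinear_insert[OF assms(1), of xs n "[]" 0] assms(2) by simp

lemma multilinear_prepend:
  assumes "multilinear K M n' N f" "us \<in> words M i" "i + n = n'"
  shows "multilinear K M n N (\<lambda>xs. f (us @ xs))"
  unfolding multilinear_def
proof (intro conjI Pi_I ballI allI impI)
  fix xs assume "xs \<in> words M n"
  thus "f (us @ xs) \<in> carrier N"
    using assms append_in_words[OF assms(2)] by (blast intro: multilinear_closed)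
next
  fix xs i' assume *: "xs \<in> words M n" "i' < n"
  have "us @ xs \<in> words M n'" "i + i' < n'" using * assms append_in_words[OF assms(2)] by auto
  hence "(\<lambda>x. f ((us @ xs)[i + i' := x])) \<in> module_hom K M N"
    using assms(1) unfolding multilinear_def by blast
  thus "(\<lambda>x. f (us @ xs[i' := x])) \<in> module_hom K M N"
    using assms(2) by (simp add: list_update_append length_words)
qed

lemma multilinear_append:
  assumes "multilinear K M n' N f" "vs \<in> words M j" "n + j = n'"
  shows "multilinear K M n N (\<lambda>xs. f (xs @ vs))"
  unfolding multilinear_def
proof (intro conjI Pi_I ballI allI impI)
  fix xs assume "xs \<in> words M n"
  thus "f (xs @ vs) \<in> carrier N"
    using assms append_in_words[OF _ assms(2)] by (blast intro: multilinear_closed)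
next
  fix xs i' assume *: "xs \<in> words M n" "i' < n"
  have "xs @ vs \<in> words M n'" "i' < n'" using * assms append_in_words[OF _ assms(2)] by auto
  hence "(\<lambda>x. f ((xs @ vs)[i' := x])) \<in> module_hom K M N"
    using assms(1) unfolding multilinear_def by blast
  thus "(\<lambda>x. f (xs[i' := x] @ vs)) \<in> module_hom K M N"
    using * by (simp add: list_update_append length_words)
qed

lemma multilinear_Cons:
  "multilinear K M (Suc n) N f \<Longrightarrow> x \<in> carrier M \<Longrightarrow> multilinear K M n N (\<lambda>xs. f (x # xs))"
  using multilinear_prepend[of "Suc n" N f "[x]" 1 n] by simp

lemma multilinear_snoc:
  "multilinear K M (Suc n) N f \<Longrightarrow> x \<in> carrier M \<Longrightarrow> multilinear K M n N (\<lambda>xs. f (xs @ [x]))"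
  using multilinear_append[of "Suc n" N f "[x]" 1 n] by simp

lemma multilinear_0: "f [] \<in> carrier N \<Longrightarrow> multilinear K M 0 N f"
  by (auto simp: multilinear_def)

text \<open>The definition speaks of updates at arbitrary places; this recursion on the length suits
  maps that are given by their effect on the head of a word.\<close>

lemma multilinear_SucI:
  assumes "\<And>xs. xs \<in> words M n \<Longrightarrow> (\<lambda>x. f (x # xs)) \<in> module_hom K M N"
    and "\<And>x. x \<in> carrier M \<Longrightarrow> multilinear K M n N (\<lambda>xs. f (x # xs))"
  shows "multilinear K M (Suc n) N f"
  unfolding multilinear_def
proof (intro conjI Pi_I ballI allI impI)
  fix xs assume "xs \<in> words M (Suc n)"
  thus "f xs \<in> carrier N" by (elim words_SucE) (use assms(2) multilinear_closed in blast)
next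
  fix xs i assume "xs \<in> words M (Suc n)" and i: "i < Suc n"
  then obtain y ys where y: "xs = y # ys" "y \<in> carrier M" "ys \<in> words M n" by (blast elim: words_SucE)
  show "(\<lambda>x. f (xs[i := x])) \<in> module_hom K M N"
  proof (cases i)
    case 0
    thus ?thesis using assms(1) y by simp
  next
    case (Suc i')
    thus ?thesis using assms(2)[OF y(2)] y i by (simp add: multilinear_def)
  qed
qed

lemma module_hom_multilinear:
  assumes "\<phi> \<in> module_hom K N N'" "multilinear K M n N f"
  shows "multilinear K M n N' (\<lambda>xs. \<phi> (f xs))"
  unfolding multilinear_def
proof (intro conjI Pi_I ballI allI impI)
  fix xs assume "xs \<in> words M n"
  thus "\<phi> (f xs) \<in> carrier N'"
    using module_hom_simps(1)[OF assms(1)] multilinear_closed[OF assms(2)] by blast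
next
  fix xs i assume "xs \<in> words M n" "i < n"
  thus "(\<lambda>x. \<phi> (f (xs[i := x]))) \<in> module_hom K M N'"
    by (intro module_hom_comp[OF assms(1)]) (use assms(2) in \<open>simp add: multilinear_def\<close>)
qed

section \<open>Universal property and generation by pure tensors\<close>

lemma tensor_lift_hom: "module K N \<Longrightarrow> multilinear K M n N f \<Longrightarrow> tensor_lift K N f \<in> module_hom K (T n) N"
  by (rule tensor_lift_module_hom[OF field_K module_M])

lemma tensor_lift_pure:
  "module K N \<Longrightarrow> multilinear K M n N f \<Longrightarrow> xs \<in> words M n \<Longrightarrow> tensor_lift K N f (tensor K M xs) = f xs"
  by (rule tensor_lift_tensor[OF field_K module_M])

lemma tensor_closed:
  assumes "xs \<in> words M n" shows "tensor K M xs \<in> carrier (T n)"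
proof -
  interpret F: module K "free_module K (words M n)" by (rule module_free_module) (rule K.is_cring)
  show ?thesis using assms
    unfolding tensor_power_def tensor_def length_words[OF assms]
    by (intro F.quotient_carrierI basis_vec_closed K.is_cring)
qed

text \<open>Each generating relation lies in \<open>tensor_null\<close> by the property of a hull,
  and two cosets agree once the difference of their representatives lies there.\<close>

lemma multilinear_tensor: "multilinear K M n (T n) (tensor K M)"
proof -
  let ?F = "free_module K (words M n)" and ?R = "tensor_null K M n"
  interpret F: module K ?F by (rule module_free_module) (rule K.is_cring)
  note R = submodule_tensor_null[OF module_M, of n]
  interpret R: abelian_subgroup ?R ?F by (rule F.abelian_subgroup_submodule[OF R])
  have null: "r \<in> multilinear_rels K M n \<Longrightarrow> r \<in> ?R" for r
    unfolding tensor_null_def by (rule hull_subset[THEN subsetD])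
  have w: "xs[i := x] \<in> words M n" if "xs \<in> words M n" "x \<in> carrier M" for xs i x
    using that set_update_subset_insert[of xs i x] by (auto simp: words_def)
  have b: "basis_vec K xs \<in> carrier ?F" if "xs \<in> words M n" for xs
    by (rule basis_vec_closed[OF K.is_cring that])
  have t: "tensor K M xs = ?R +>\<^bsub>?F\<^esub> basis_vec K xs" if "xs \<in> words M n" for xs
    by (simp add: tensor_def length_words[OF that])
  have eq: "?R +>\<^bsub>?F\<^esub> p = ?R +>\<^bsub>?F\<^esub> q"
    if "p \<in> carrier ?F" "q \<in> carrier ?F" "p \<ominus>\<^bsub>?F\<^esub> q \<in> ?R" for p q
  proof (rule R.a_repr_independence'[OF _ that(2), symmetric])
    have "p = (p \<ominus>\<^bsub>?F\<^esub> q) \<oplus>\<^bsub>?F\<^esub> q"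
      using that by (simp add: a_minus_def F.M.a_assoc F.M.l_neg)
    thus "p \<in> ?R +>\<^bsub>?F\<^esub> q" unfolding a_r_coset_def' using that(3) by blast
  qed
  show ?thesis
    unfolding multilinear_def module_hom_def mem_Collect_eq
  proof (intro conjI Pi_I ballI allI impI)
    fix xs i x y assume *: "xs \<in> words M n" "i < n" "x \<in> carrier M" "y \<in> carrier M"
    have "basis_vec K (xs[i := x \<oplus>\<^bsub>M\<^esub> y]) \<ominus>\<^bsub>?F\<^esub> (basis_vec K (xs[i := x]) \<oplus>\<^bsub>?F\<^esub> basis_vec K (xs[i := y])) \<in> ?R"
      by (rule null) (use * in \<open>auto simp: multilinear_rels_def Let_def\<close>)
    thus "tensor K M (xs[i := x \<oplus>\<^bsub>M\<^esub> y]) = tensor K M (xs[i := x]) \<oplus>\<^bsub>T n\<^esub> tensor K M (xs[i := y])"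
      using * by (simp add: t w tensor_power_def F.quotient_add[OF R] b eq)
  next
    fix xs i c x assume *: "xs \<in> words M n" "i < n" "c \<in> carrier K" "x \<in> carrier M"
    have "basis_vec K (xs[i := c \<odot>\<^bsub>M\<^esub> x]) \<ominus>\<^bsub>?F\<^esub> c \<odot>\<^bsub>?F\<^esub> basis_vec K (xs[i := x]) \<in> ?R"
      by (rule null) (use * in \<open>auto simp: multilinear_rels_def Let_def\<close>)
    thus "tensor K M (xs[i := c \<odot>\<^bsub>M\<^esub> x]) = c \<odot>\<^bsub>T n\<^esub> tensor K M (xs[i := x])"
      using * by (simp add: t w tensor_power_def F.quotient_smult[OF R] b eq)
  qed (auto intro: tensor_closed w)
qed

text \<open>Pure tensors generate. The induction is over a finite set that contains the support of a
  representative, and clears one coefficient at a time.\<close>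

lemma tensor_power_hom_eqI:
  assumes "module K N" "\<phi> \<in> module_hom K (T n) N" "\<psi> \<in> module_hom K (T n) N"
    and eq: "\<And>xs. xs \<in> words M n \<Longrightarrow> \<phi> (tensor K M xs) = \<psi> (tensor K M xs)"
    and X: "X \<in> carrier (T n)"
  shows "\<phi> X = \<psi> X"
proof -
  let ?F = "free_module K (words M n)" and ?R = "tensor_null K M n"
  interpret F: module K ?F by (rule module_free_module) (rule K.is_cring)
  interpret N: module K N by fact
  note R = submodule_tensor_null[OF module_M, of n]
  note h = module_hom_simps[OF assms(2)] and h' = module_hom_simps[OF assms(3)]
  have main: "\<phi> (?R +>\<^bsub>?F\<^esub> p) = \<psi> (?R +>\<^bsub>?F\<^esub> p)"
    if "finite A" "p \<in> carrier ?F" "{b. p b \<noteq> \<zero>\<^bsub>K\<^esub>} \<subseteq> A" for A p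
    using that
  proof (induct A arbitrary: p)
    case empty
    \<comment> \<open>A formal sum with empty support is its own multiple by zero, so both values
      are multiples by zero.\<close>
    hence "p = \<zero>\<^bsub>K\<^esub> \<odot>\<^bsub>?F\<^esub> p" by (auto simp: free_module_simps)
    moreover have "\<zero>\<^bsub>K\<^esub> \<odot>\<^bsub>N\<^esub> \<phi> (?R +>\<^bsub>?F\<^esub> p) = \<zero>\<^bsub>K\<^esub> \<odot>\<^bsub>N\<^esub> \<psi> (?R +>\<^bsub>?F\<^esub> p)"
      using F.quotient_carrierI[OF empty(1), of ?R] h(1) h'(1) by (simp add: tensor_power_def)
    ultimately show ?case
      using F.quotient_carrierI[OF empty(1), of ?R] F.quotient_smult[OF R K.zero_closed empty(1)]
        h(3)[of "\<zero>\<^bsub>K\<^esub>"] h'(3)[of "\<zero>\<^bsub>K\<^esub>"] by (metis K.zero_closed tensor_power_def)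
  next
    case (insert b A)
    show ?case
    proof (cases "b \<in> words M n")
      case False
      \<comment> \<open>The bounding set may contain points that are not words; the coefficient
        there is zero.\<close>
      hence "p b = \<zero>\<^bsub>K\<^esub>" using insert.prems by (auto simp: free_module_simps)
      hence "{b. p b \<noteq> \<zero>\<^bsub>K\<^esub>} \<subseteq> A" using insert.prems(2) by auto
      thus ?thesis using insert.prems(1) by (rule insert.hyps(3)[rotated])
    next
      case True
      define q where "q = p(b := \<zero>\<^bsub>K\<^esub>)"
      have q: "q \<in> carrier ?F" using insert.prems
        by (auto simp: q_def free_module_simps elim: finite_subset[rotated])
      have pb: "p b \<in> carrier K" using insert.prems by (auto simp: free_module_simps)
      have bF: "basis_vec K b \<in> carrier ?F" by (rule basis_vec_closed[OF K.is_cring True])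
      have "p = q \<oplus>\<^bsub>?F\<^esub> p b \<odot>\<^bsub>?F\<^esub> basis_vec K b"
        using insert.prems(1) pb by (auto simp: fun_eq_iff q_def free_module_simps basis_vec_def)
      hence p: "?R +>\<^bsub>?F\<^esub> p = (?R +>\<^bsub>?F\<^esub> q) \<oplus>\<^bsub>T n\<^esub> p b \<odot>\<^bsub>T n\<^esub> tensor K M b"
        using q pb bF True
        by (simp add: tensor_power_def tensor_def length_words[OF True] F.quotient_add[OF R] F.quotient_smult[OF R])
      have "{b. q b \<noteq> \<zero>\<^bsub>K\<^esub>} \<subseteq> A" using insert.prems(2) by (auto simp: q_def)
      hence IH: "\<phi> (?R +>\<^bsub>?F\<^esub> q) = \<psi> (?R +>\<^bsub>?F\<^esub> q)" using q by (rule insert.hyps(3)[rotated])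
      interpret Tn: module K "T n" by (rule module_T)
      have "?R +>\<^bsub>?F\<^esub> q \<in> carrier (T n)" using F.quotient_carrierI[OF q] by (simp add: tensor_power_def)
      thus ?thesis using IH pb tensor_closed[OF True] unfolding p by (simp add: h h' eq[OF True])
    qed
  qed
  from X obtain q where q: "q \<in> carrier ?F" "X = ?R +>\<^bsub>?F\<^esub> q"
    unfolding tensor_power_def by (rule F.quotient_carrierE)
  have "finite {b. q b \<noteq> \<zero>\<^bsub>K\<^esub>}" using q(1) by (simp add: free_module_simps)
  from main[OF this q(1) subset_refl] show ?thesis unfolding q(2) .
qed

section \<open>Prepending a factor\<close>

definition tensor_cons :: "nat \<Rightarrow> 'a \<Rightarrow> ('a list \<Rightarrow> 'k) set \<Rightarrow> ('a list \<Rightarrow> 'k) set"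
  where "tensor_cons n h Y = tensor_lift K (T (Suc n)) (\<lambda>ys. tensor K M (h # ys)) Y"

lemma tensor_cons_hom_right: "h \<in> carrier M \<Longrightarrow> tensor_cons n h \<in> module_hom K (T n) (T (Suc n))"
  unfolding tensor_cons_def
  by (intro tensor_lift_hom module_T multilinear_Cons multilinear_tensor)

lemma tensor_cons_hom_left: "Y \<in> carrier (T n) \<Longrightarrow> (\<lambda>h. tensor_cons n h Y) \<in> module_hom K M (T (Suc n))"
  unfolding tensor_cons_def
  by (intro tensor_lift_linear[where n = n] module_T multilinear_hd[OF multilinear_tensor])

lemma tensor_cons_closed: "h \<in> carrier M \<Longrightarrow> Y \<in> carrier (T n) \<Longrightarrow> tensor_cons n h Y \<in> carrier (T (Suc n))"
  by (rule module_hom_simps(1)[OF tensor_cons_hom_right])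

lemma tensor_cons_tensor:
  "h \<in> carrier M \<Longrightarrow> ys \<in> words M n \<Longrightarrow> tensor_cons n h (tensor K M ys) = tensor K M (h # ys)"
  unfolding tensor_cons_def
  by (intro tensor_lift_pure[where n = n] module_T multilinear_Cons multilinear_tensor)

text \<open>The tail \<open>Y\<close> is an arbitrary element rather than a pure tensor, so that
  recursion formulas and induction hypotheses about tails apply to it directly.\<close>

lemma tensor_power_Suc_hom_eqI:
  assumes "module K N" "\<phi> \<in> module_hom K (T (Suc n)) N" "\<psi> \<in> module_hom K (T (Suc n)) N"
    and "\<And>h Y. h \<in> carrier M \<Longrightarrow> Y \<in> carrier (T n) \<Longrightarrow> \<phi> (tensor_cons n h Y) = \<psi> (tensor_cons n h Y)"
    and "X \<in> carrier (T (Suc n))"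
  shows "\<phi> X = \<psi> X"
proof (rule tensor_power_hom_eqI[OF assms(1-3) _ assms(5)])
  fix xs assume "xs \<in> words M (Suc n)"
  then obtain y ys where y: "xs = y # ys" "y \<in> carrier M" "ys \<in> words M n" by (rule words_SucE)
  show "\<phi> (tensor K M xs) = \<psi> (tensor K M xs)"
    using assms(4)[OF y(2) tensor_closed[OF y(3)]] y by (simp add: tensor_cons_tensor)
qed

lemma tensor_power_1_hom_eqI:
  assumes "module K N" "\<phi> \<in> module_hom K (T (Suc 0)) N" "\<psi> \<in> module_hom K (T (Suc 0)) N"
    and "\<And>h. h \<in> carrier M \<Longrightarrow> \<phi> (tensor K M [h]) = \<psi> (tensor K M [h])"
    and "X \<in> carrier (T (Suc 0))"
  shows "\<phi> X = \<psi> X"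
  by (rule tensor_power_hom_eqI[OF assms(1-3) _ assms(5)]) (auto elim!: words_SucE assms(4))

lemma multilinear_cong:
  assumes "multilinear K M n N f" "\<And>xs. xs \<in> words M n \<Longrightarrow> g xs = f xs"
  shows "multilinear K M n N g"
  unfolding multilinear_def
proof (intro conjI Pi_I ballI allI impI)
  fix xs assume xs: "xs \<in> words M n"
  thus "g xs \<in> carrier N" using multilinear_closed[OF assms(1)] assms(2) by simp
  fix i assume "i < n"
  hence "(\<lambda>x. f (xs[i := x])) \<in> module_hom K M N" using assms(1) xs by (simp add: multilinear_def)
  moreover have "f (xs[i := x]) = g (xs[i := x])" if "x \<in> carrier M" for x
    using that xs set_update_subset_insert[of xs i x] by (intro assms(2)[symmetric]) (auto simp: words_def)
  ultimately show "(\<lambda>x. g (xs[i := x])) \<in> module_hom K M N"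
    by (rule module_hom_cong[OF module_M, rotated])
qed

text \<open>In the product the legs i and 2m - i of the acting element are used together, so the
  induction there removes both ends of a word of legs in one step.\<close>

lemma multilinear_both_endsI:
  assumes "\<And>zs c. zs \<in> words M n \<Longrightarrow> c \<in> carrier M \<Longrightarrow> (\<lambda>a. f (a # zs @ [c])) \<in> module_hom K M N"
    and "\<And>zs a. zs \<in> words M n \<Longrightarrow> a \<in> carrier M \<Longrightarrow> (\<lambda>c. f (a # zs @ [c])) \<in> module_hom K M N"
    and "\<And>a c. a \<in> carrier M \<Longrightarrow> c \<in> carrier M \<Longrightarrow> multilinear K M n N (\<lambda>zs. f (a # zs @ [c]))"
  shows "multilinear K M (Suc (Suc n)) N f"
  unfolding multilinear_def
proof (intro conjI Pi_I ballI allI impI)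
  have split: "\<exists>a zs c. xs = a # zs @ [c] \<and> a \<in> carrier M \<and> zs \<in> words M n \<and> c \<in> carrier M"
    if "xs \<in> words M (Suc (Suc n))" for xs
  proof -
    from that obtain a ys where a: "xs = a # ys" "a \<in> carrier M" "ys \<in> words M (Suc n)" by (rule words_SucE)
    from a(3) have "ys \<noteq> []" by auto
    then obtain zs c where "ys = zs @ [c]" by (metis rev_exhaust)
    with a show ?thesis by (auto simp: words_def)
  qed
  fix xs assume "xs \<in> words M (Suc (Suc n))"
  then obtain a zs c where xs: "xs = a # zs @ [c]" "a \<in> carrier M" "zs \<in> words M n" "c \<in> carrier M"
    using split by blast
  show "f xs \<in> carrier N" unfolding xs(1)
    using multilinear_closed[OF assms(3)[OF xs(2,4)] xs(3)] .
  fix i assume "i < Suc (Suc n)"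
  \<comment> \<open>The updated place is the first, the last or an inner one; inner places are
    shifted by one because of the head.\<close>
  then consider "i = 0" | "i = Suc n" | j where "i = Suc j" "j < n" by (metis less_Suc_eq less_Suc_eq_0_disj)
  thus "(\<lambda>x. f (xs[i := x])) \<in> module_hom K M N"
  proof cases
    case 1 thus ?thesis using assms(1)[OF xs(3,4)] by (simp add: xs(1))
  next
    case 2 thus ?thesis using assms(2)[OF xs(3,2)] length_words[OF xs(3)] by (simp add: xs(1) list_update_append)
  next
    case 3
    have "(\<lambda>x. f (a # zs[j := x] @ [c])) \<in> module_hom K M N"
      using assms(3)[OF xs(2,4)] xs(3) 3(2) by (simp add: multilinear_def)
    thus ?thesis using 3 length_words[OF xs(3)] by (simp add: xs(1) list_update_append)
  qed
qed

lemma multilinear_lift_inner: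
  assumes "module K N" "Y \<in> carrier (T m)" "\<And>ys. ys \<in> words M m \<Longrightarrow> multilinear K M n N (\<lambda>xs. f xs ys)"
  shows "multilinear K M n N (\<lambda>xs. tensor_lift K N (f xs) Y)"
  unfolding multilinear_def
  by (intro conjI Pi_I ballI allI impI tensor_lift_closed[OF assms(1,2)] tensor_lift_linear[OF assms(1,2)])
    (use assms(3) in \<open>auto simp: multilinear_def\<close>)

text \<open>Agreement with \<open>\<phi>\<close> on pure tensors makes the lifted map inherit
  multilinearity from \<open>\<phi>\<close>. This serves to identify the lift of
  \<open>Khat_diff_pure\<close>.\<close>

lemma tensor_lift_eq_hom:
  assumes "module K N" "\<phi> \<in> module_hom K (T n) N" "\<And>xs. xs \<in> words M n \<Longrightarrow> f xs = \<phi> (tensor K M xs)"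
    "X \<in> carrier (T n)"
  shows "tensor_lift K N f X = \<phi> X"
proof -
  note m = module_hom_multilinear[OF assms(2) multilinear_tensor]
  have "tensor_lift K N f X = tensor_lift K N (\<lambda>xs. \<phi> (tensor K M xs)) X"
    by (rule tensor_lift_cong[OF assms(4)]) (rule assms(3))
  also have "\<dots> = \<phi> X"
    by (rule tensor_power_hom_eqI[OF assms(1) tensor_lift_hom[OF assms(1) m] assms(2) _ assms(4)])
      (rule tensor_lift_pure[OF assms(1) m])
  finally show ?thesis .
qed

lemma tensor_cons_tensor_lift:
  assumes "h \<in> carrier M" "X \<in> carrier (T m)" "\<And>xs. xs \<in> words M m \<Longrightarrow> f xs \<in> carrier (T n)"
  shows "tensor_cons n h (tensor_lift K (T n) f X) = tensor_lift K (T (Suc n)) (\<lambda>xs. tensor_cons n h (f xs)) X"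
  by (rule module_hom_tensor_lift[OF module_T module_T tensor_cons_hom_right[OF assms(1)] assms(2,3)])

section \<open>Koszul signs\<close>

abbreviation sgn where "sgn \<equiv> koszul_sign K"

lemma sgn_closed: "sgn n \<in> carrier K"
  by (simp add: koszul_sign_def)

lemma sgn_0: "sgn 0 = \<one>\<^bsub>K\<^esub>"
  by (simp add: koszul_sign_def)

lemma sgn_Suc: "sgn (Suc n) = \<ominus>\<^bsub>K\<^esub> sgn n"
  by (simp add: koszul_sign_def K.r_minus)

lemma sgn_add: "sgn (n + m) = sgn n \<otimes>\<^bsub>K\<^esub> sgn m"
  by (simp add: koszul_sign_def K.nat_pow_mult)

lemma sgn_square: "sgn n \<otimes>\<^bsub>K\<^esub> sgn n = \<one>\<^bsub>K\<^esub>"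
  by (induct n) (simp_all add: sgn_0 sgn_Suc sgn_closed K.l_minus K.r_minus)

lemma minus_sgn_mult_sgn: "(\<ominus>\<^bsub>K\<^esub> sgn n) \<otimes>\<^bsub>K\<^esub> sgn n = \<ominus>\<^bsub>K\<^esub> \<one>\<^bsub>K\<^esub>"
  by (simp add: K.l_minus sgn_closed sgn_square)

end

section \<open>Sweedler calculus\<close>

sublocale assoc_algebra \<subseteq> field_module K A
  by unfold_locales

context bialgebra
begin

lemma words_2E:
  assumes "xs \<in> words H 2"
  obtains a b where "xs = [a, b]" "a \<in> carrier H" "b \<in> carrier H"
  using assms by (auto simp: numeral_2_eq_2 elim!: words_SucE)

lemma comult_closed: "x \<in> carrier H \<Longrightarrow> comult H x \<in> carrier (T 2)"
  by (rule module_hom_simps(1)[OF comult_hom])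

text \<open>Sweedler notation as a binder: the two bound variables stand for
  \<open>x\<^sub>1\<close> and \<open>x\<^sub>2\<close>, and nesting produces further legs.
  \<open>N\<close> has to be named because it is where the finite sum is formed.\<close>

definition sweedler :: "('k, 'b, 't) module_scheme \<Rightarrow> ('h \<Rightarrow> 'h \<Rightarrow> 'b) \<Rightarrow> 'h \<Rightarrow> 'b"
  where "sweedler N f x = tensor_lift K N (\<lambda>zs. f (zs ! 0) (zs ! 1)) (comult H x)"

definition bilin :: "('k, 'b, 't) module_scheme \<Rightarrow> ('h \<Rightarrow> 'h \<Rightarrow> 'b) \<Rightarrow> bool"
  where "bilin N f \<longleftrightarrow>
    (\<forall>b \<in> carrier H. (\<lambda>a. f a b) \<in> module_hom K H N) \<and> (\<forall>a \<in> carrier H. (\<lambda>b. f a b) \<in> module_hom K H N)"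

definition trilin :: "('k, 'b, 't) module_scheme \<Rightarrow> ('h \<Rightarrow> 'h \<Rightarrow> 'h \<Rightarrow> 'b) \<Rightarrow> bool"
  where "trilin N f \<longleftrightarrow>
    (\<forall>b \<in> carrier H. \<forall>c \<in> carrier H. (\<lambda>a. f a b c) \<in> module_hom K H N) \<and>
    (\<forall>a \<in> carrier H. \<forall>c \<in> carrier H. (\<lambda>b. f a b c) \<in> module_hom K H N) \<and>
    (\<forall>a \<in> carrier H. \<forall>b \<in> carrier H. (\<lambda>c. f a b c) \<in> module_hom K H N)"

lemma bilinI:
  assumes "\<And>b. b \<in> carrier H \<Longrightarrow> (\<lambda>a. f a b) \<in> module_hom K H N"
    "\<And>a. a \<in> carrier H \<Longrightarrow> (\<lambda>b. f a b) \<in> module_hom K H N"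
  shows "bilin N f"
  using assms by (simp add: bilin_def)

lemma trilinI:
  assumes "\<And>b c. b \<in> carrier H \<Longrightarrow> c \<in> carrier H \<Longrightarrow> (\<lambda>a. f a b c) \<in> module_hom K H N"
    "\<And>a c. a \<in> carrier H \<Longrightarrow> c \<in> carrier H \<Longrightarrow> (\<lambda>b. f a b c) \<in> module_hom K H N"
    "\<And>a b. a \<in> carrier H \<Longrightarrow> b \<in> carrier H \<Longrightarrow> (\<lambda>c. f a b c) \<in> module_hom K H N"
  shows "trilin N f"
  using assms by (simp add: trilin_def)

lemma bilin_closed: "bilin N f \<Longrightarrow> a \<in> carrier H \<Longrightarrow> b \<in> carrier H \<Longrightarrow> f a b \<in> carrier N"
  by (auto simp: bilin_def dest: module_hom_simps(1))

lemma trilin_closed: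
  "trilin N f \<Longrightarrow> a \<in> carrier H \<Longrightarrow> b \<in> carrier H \<Longrightarrow> c \<in> carrier H \<Longrightarrow> f a b c \<in> carrier N"
  unfolding trilin_def using module_hom_simps(1)[of "\<lambda>c. f a b c"] by blast

lemma bilin_hom_left:
  "bilin N f \<Longrightarrow> g \<in> module_hom K N' H \<Longrightarrow> b \<in> carrier H \<Longrightarrow> (\<lambda>a. f (g a) b) \<in> module_hom K N' N"
  using module_hom_comp[of "\<lambda>a. f a b" K H N g N'] by (simp add: bilin_def)

lemma bilin_hom_right:
  "bilin N f \<Longrightarrow> g \<in> module_hom K N' H \<Longrightarrow> a \<in> carrier H \<Longrightarrow> (\<lambda>b. f a (g b)) \<in> module_hom K N' N"
  using module_hom_comp[of "f a" K H N g N'] by (simp add: bilin_def)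

lemma bilin_multilinear: "bilin N f \<Longrightarrow> multilinear K H 2 N (\<lambda>zs. f (zs ! 0) (zs ! 1))"
  unfolding numeral_2_eq_2
  by (intro multilinear_SucI multilinear_0) (auto simp: bilin_def elim!: words_SucE dest: module_hom_simps(1))

lemma trilin_multilinear: "trilin N f \<Longrightarrow> multilinear K H 3 N (\<lambda>zs. f (zs ! 0) (zs ! 1) (zs ! 2))"
  using trilin_closed[of N f] unfolding numeral_2_eq_2 numeral_3_eq_3
  by (intro multilinear_SucI multilinear_0) (auto simp: trilin_def elim!: words_SucE)

lemma sweedler_closed:
  assumes "module K N" "x \<in> carrier H" "\<And>a b. a \<in> carrier H \<Longrightarrow> b \<in> carrier H \<Longrightarrow> f a b \<in> carrier N"
  shows "sweedler N f x \<in> carrier N"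
  unfolding sweedler_def
  by (rule tensor_lift_closed[OF assms(1) comult_closed[OF assms(2)]]) (auto elim!: words_2E assms(3))

lemma sweedler_cong:
  assumes "x \<in> carrier H" "\<And>a b. a \<in> carrier H \<Longrightarrow> b \<in> carrier H \<Longrightarrow> f a b = g a b"
  shows "sweedler N f x = sweedler N g x"
  unfolding sweedler_def
  by (rule tensor_lift_cong[OF comult_closed[OF assms(1)]]) (auto elim!: words_2E assms(2))

lemma module_hom_sweedler:
  assumes "module K N" "module K N'" "\<phi> \<in> module_hom K N N'" "x \<in> carrier H"
    "\<And>a b. a \<in> carrier H \<Longrightarrow> b \<in> carrier H \<Longrightarrow> f a b \<in> carrier N"
  shows "\<phi> (sweedler N f x) = sweedler N' (\<lambda>a b. \<phi> (f a b)) x"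
  unfolding sweedler_def
  by (rule module_hom_tensor_lift[OF assms(1-3) comult_closed[OF assms(4)]]) (auto elim!: words_2E assms(5))

lemma sweedler_swap:
  assumes "module K N" "x \<in> carrier H" "y \<in> carrier H"
    "\<And>a b c d. a \<in> carrier H \<Longrightarrow> b \<in> carrier H \<Longrightarrow> c \<in> carrier H \<Longrightarrow> d \<in> carrier H \<Longrightarrow> f a b c d \<in> carrier N"
  shows "sweedler N (\<lambda>a b. sweedler N (\<lambda>c d. f a b c d) y) x = sweedler N (\<lambda>c d. sweedler N (\<lambda>a b. f a b c d) x) y"
  unfolding sweedler_def
  by (rule tensor_lift_swap[OF assms(1) comult_closed[OF assms(2)] comult_closed[OF assms(3)]])
    (auto elim!: words_2E intro!: assms(4))

lemma sweedler_hom_inner: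
  assumes "module K N" "x \<in> carrier H"
    "\<And>a b. a \<in> carrier H \<Longrightarrow> b \<in> carrier H \<Longrightarrow> (\<lambda>u. f u a b) \<in> module_hom K N' N"
  shows "(\<lambda>u. sweedler N (f u) x) \<in> module_hom K N' N"
  unfolding sweedler_def
  by (rule tensor_lift_linear[OF assms(1) comult_closed[OF assms(2)]]) (auto elim!: words_2E intro!: assms(3))

lemma sweedler_hom_outer:
  assumes "module K N" "bilin N f" "g \<in> module_hom K N' H"
  shows "(\<lambda>u. sweedler N f (g u)) \<in> module_hom K N' N"
  unfolding sweedler_def
  by (rule module_hom_comp[OF tensor_lift_hom[OF assms(1) bilin_multilinear[OF assms(2)]]])
    (rule module_hom_comp[OF comult_hom assms(3)])

lemma sweedler_hom: "module K N \<Longrightarrow> bilin N f \<Longrightarrow> sweedler N f \<in> module_hom K H N"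
  using sweedler_hom_outer[OF _ _ module_hom_id] .

lemma sweedler_tensor:
  assumes "module K N" "bilin N f" "x \<in> carrier H" "a \<in> carrier H" "b \<in> carrier H" "comult H x = tensor K H [a, b]"
  shows "sweedler N f x = f a b"
  unfolding sweedler_def assms(6)
  by (subst tensor_lift_pure[OF assms(1) bilin_multilinear[OF assms(2)]]) (use assms in \<open>auto simp: numeral_2_eq_2\<close>)

lemma sweedler_one: "module K N \<Longrightarrow> bilin N f \<Longrightarrow> sweedler N f \<one> = f \<one> \<one>"
  by (rule sweedler_tensor) (auto simp: comult_one)

section \<open>Coassociativity and multiplicativity in Sweedler form\<close>

lemma comult_at_words:
  assumes "xs \<in> words H n" "j < n" "zs \<in> words H 2"
  shows "take j xs @ zs @ drop (Suc j) xs \<in> words H (Suc n)"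
  using assms by (auto simp: words_def dest: in_set_takeD in_set_dropD)

lemma nth_words: "xs \<in> words H n \<Longrightarrow> j < n \<Longrightarrow> xs ! j \<in> carrier H"
  by (auto simp: words_def)

lemma comult_at_closed:
  assumes "xs \<in> words H n" "j < n"
  shows "comult_at K H j xs \<in> carrier (T (Suc n))"
  unfolding comult_at_def length_words[OF assms(1)]
  using tensor_lift_closed[OF module_T comult_closed[OF nth_words[OF assms]]
      tensor_closed[OF comult_at_words[OF assms]]] by simp

text \<open>Passes from lifts of formal sums to Sweedler sums; coassociativity and the iterated
  comultiplication are both translated through it.\<close>

lemma tensor_lift_comult_at:
  assumes "module K N" "multilinear K H (Suc n) N F" "xs \<in> words H n" "j < n"
  shows "tensor_lift K N F (comult_at K H j xs) =
    sweedler N (\<lambda>a b. F (take j xs @ a # b # drop (Suc j) xs)) (xs ! j)"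
proof -
  note w = comult_at_words[OF assms(3,4)] and c = comult_closed[OF nth_words[OF assms(3,4)]]
  have "tensor_lift K N F (comult_at K H j xs) =
      tensor_lift K N (\<lambda>zs. tensor_lift K N F (tensor K H (take j xs @ zs @ drop (Suc j) xs))) (comult H (xs ! j))"
    unfolding comult_at_def length_words[OF assms(3)]
    using module_hom_tensor_lift[OF module_T assms(1) tensor_lift_hom[OF assms(1,2)] c tensor_closed[OF w]] by simp
  also have "\<dots> = tensor_lift K N (\<lambda>zs. F (take j xs @ zs ! 0 # zs ! 1 # drop (Suc j) xs)) (comult H (xs ! j))"
  proof (rule tensor_lift_cong[OF c])
    fix zs assume zs: "zs \<in> words H 2"
    from zs obtain a b where ab: "zs = [a, b]" by (rule words_2E)
    show "tensor_lift K N F (tensor K H (take j xs @ zs @ drop (Suc j) xs)) = F (take j xs @ zs ! 0 # zs ! 1 # drop (Suc j) xs)"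
      unfolding tensor_lift_pure[OF assms(1,2) w[OF zs]] by (simp add: ab)
  qed
  finally show ?thesis unfolding sweedler_def .
qed

text \<open>The axiom is an equation in the third tensor power; a trilinear \<open>f\<close> induces
  a linear map out of it, which is applied to both sides.\<close>

lemma sweedler_coassoc:
  assumes "module K N" "trilin N f" "x \<in> carrier H"
  shows "sweedler N (\<lambda>a b. sweedler N (\<lambda>c d. f c d b) a) x = sweedler N (\<lambda>a b. sweedler N (\<lambda>c d. f a c d) b) x"
proof -
  let ?F = "\<lambda>zs. f (zs ! 0) (zs ! 1) (zs ! 2)"
  note F = trilin_multilinear[OF assms(2)]
  have F': "multilinear K H (Suc 2) N ?F" using F by (simp add: numeral_3_eq_3 numeral_2_eq_2)
  \<comment> \<open>Place 0 splits the first leg and place 1 the second, which gives the two sides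
    of the claim.\<close>
  have *: "tensor_lift K N ?F (tensor_lift K (T 3) (comult_at K H j) (comult H x)) =
      sweedler N (\<lambda>a b. sweedler N (\<lambda>c d. ?F (take j [a, b] @ c # d # drop (Suc j) [a, b])) ([a, b] ! j)) x"
    if j: "j < 2" for j
  proof -
    have cl: "comult_at K H j zs \<in> carrier (T 3)" if "zs \<in> words H 2" for zs
      using comult_at_closed[OF that j] by (simp add: numeral_3_eq_3 numeral_2_eq_2)
    have "tensor_lift K N ?F (tensor_lift K (T 3) (comult_at K H j) (comult H x)) =
        tensor_lift K N (\<lambda>zs. tensor_lift K N ?F (comult_at K H j zs)) (comult H x)"
      by (rule module_hom_tensor_lift[OF module_T assms(1) tensor_lift_hom[OF assms(1) F] comult_closed[OF assms(3)] cl])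
    also have "\<dots> = tensor_lift K N (\<lambda>zs. sweedler N (\<lambda>c d. ?F (take j [zs ! 0, zs ! 1] @ c # d # drop (Suc j) [zs ! 0, zs ! 1])) ([zs ! 0, zs ! 1] ! j)) (comult H x)"
    proof (rule tensor_lift_cong[OF comult_closed[OF assms(3)]])
      fix zs assume zs: "zs \<in> words H 2"
      from zs obtain a b where ab: "zs = [a, b]" "a \<in> carrier H" "b \<in> carrier H" by (rule words_2E)
      show "tensor_lift K N ?F (comult_at K H j zs) = 
          sweedler N (\<lambda>c d. ?F (take j [zs ! 0, zs ! 1] @ c # d # drop (Suc j) [zs ! 0, zs ! 1])) ([zs ! 0, zs ! 1] ! j)"
        unfolding tensor_lift_comult_at[OF assms(1) F' zs j] by (simp add: ab)
    qed
    finally show ?thesis by (simp only: sweedler_def)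
  qed
  show ?thesis
    using *[of 0] *[of 1] coassoc[OF assms(3)] by (simp add: numeral_2_eq_2)
qed

text \<open>The linear map induced by \<open>f\<close> is carried through the two nested lifts of
  \<open>tensor_square_mult\<close>. Read from right to left, the equation merges the legs of two
  factors.\<close>

lemma sweedler_mult:
  assumes "module K N" "bilin N f" "x \<in> carrier H" "y \<in> carrier H"
  shows "sweedler N f (x \<otimes> y) = sweedler N (\<lambda>a b. sweedler N (\<lambda>c d. f (a \<otimes> c) (b \<otimes> d)) y) x"
proof -
  let ?F = "\<lambda>zs. f (zs ! 0) (zs ! 1)"
  note F = bilin_multilinear[OF assms(2)]
  note cx = comult_closed[OF assms(3)] and cy = comult_closed[OF assms(4)]
  note h = module_hom_tensor_lift[OF module_T assms(1) tensor_lift_hom[OF assms(1) F]]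
  have w: "[xs ! 0 \<otimes> ys ! 0, xs ! 1 \<otimes> ys ! 1] \<in> words H 2" if "xs \<in> words H 2" "ys \<in> words H 2" for xs ys
    using that by (elim words_2E) (simp add: numeral_2_eq_2)
  note wc = tensor_closed[OF w]
  have "sweedler N f (x \<otimes> y) = 
    tensor_lift K N (\<lambda>xs. tensor_lift K N ?F (tensor_lift K (T 2) (\<lambda>ys. tensor K H [xs ! 0 \<otimes> ys ! 0, xs ! 1 \<otimes> ys ! 1]) (comult H y))) (comult H x)"
    unfolding sweedler_def comult_mult[OF assms(3,4)] tensor_square_mult_def
    by (rule h[OF cx]) (rule tensor_lift_closed[OF module_T cy wc])
  also have "\<dots> = tensor_lift K N (\<lambda>xs. tensor_lift K N (\<lambda>ys. f (xs ! 0 \<otimes> ys ! 0) (xs ! 1 \<otimes> ys ! 1)) (comult H y)) (comult H x)"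
  proof (rule tensor_lift_cong[OF cx])
    fix xs assume xs: "xs \<in> words H 2"
    show "tensor_lift K N ?F (tensor_lift K (T 2) (\<lambda>ys. tensor K H [xs ! 0 \<otimes> ys ! 0, xs ! 1 \<otimes> ys ! 1]) (comult H y)) =
        tensor_lift K N (\<lambda>ys. f (xs ! 0 \<otimes> ys ! 0) (xs ! 1 \<otimes> ys ! 1)) (comult H y)"
      by (subst h[OF cy], erule wc[OF xs], rule tensor_lift_cong[OF cy])
        (subst tensor_lift_pure[OF assms(1) F w[OF xs]], auto)
  qed
  finally show ?thesis by (simp add: sweedler_def)
qed

section \<open>The counit\<close>

lemma counit_closed: "x \<in> carrier H \<Longrightarrow> counit H x \<in> carrier K"
  using counit_ring_hom by (auto simp: ring_hom_def)

lemma counit_one: "counit H \<one> = \<one>\<^bsub>K\<^esub>"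
  using counit_ring_hom by (auto simp: ring_hom_def)

lemma sweedler_counit_left:
  assumes "module K N" "f \<in> module_hom K H N" "x \<in> carrier H"
  shows "sweedler N (\<lambda>a b. counit H a \<odot>\<^bsub>N\<^esub> f b) x = f x"
proof -
  have "f x = f (sweedler H (\<lambda>a b. counit H a \<odot> b) x)"
    using counit_left[OF assms(3)] by (simp add: sweedler_def)
  also have "\<dots> = sweedler N (\<lambda>a b. f (counit H a \<odot> b)) x"
    by (rule module_hom_sweedler[OF module_M assms]) (simp add: counit_closed)
  also have "\<dots> = sweedler N (\<lambda>a b. counit H a \<odot>\<^bsub>N\<^esub> f b) x"
    by (rule sweedler_cong[OF assms(3)]) (simp add: counit_closed module_hom_simps[OF assms(2)])
  finally show ?thesis ..
qed

lemma sweedler_counit_right: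
  assumes "module K N" "f \<in> module_hom K H N" "x \<in> carrier H"
  shows "sweedler N (\<lambda>a b. counit H b \<odot>\<^bsub>N\<^esub> f a) x = f x"
proof -
  have "f x = f (sweedler H (\<lambda>a b. counit H b \<odot> a) x)"
    using counit_right[OF assms(3)] by (simp add: sweedler_def)
  also have "\<dots> = sweedler N (\<lambda>a b. f (counit H b \<odot> a)) x"
    by (rule module_hom_sweedler[OF module_M assms]) (simp add: counit_closed)
  also have "\<dots> = sweedler N (\<lambda>a b. counit H b \<odot>\<^bsub>N\<^esub> f a) x"
    by (rule sweedler_cong[OF assms(3)]) (simp add: counit_closed module_hom_simps[OF assms(2)])
  finally show ?thesis ..
qed

section \<open>Linearity and closure of composite expressions\<close>

lemma mult_hom_left: "g \<in> module_hom K N H \<Longrightarrow> y \<in> carrier H \<Longrightarrow> (\<lambda>u. g u \<otimes> y) \<in> module_hom K N H"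
  by (auto simp: module_hom_def Pi_iff l_distr smult_mult_left)

lemma mult_hom_right: "g \<in> module_hom K N H \<Longrightarrow> y \<in> carrier H \<Longrightarrow> (\<lambda>u. y \<otimes> g u) \<in> module_hom K N H"
  by (auto simp: module_hom_def Pi_iff r_distr smult_mult_right)

lemma tensor_cons_hom_left': "g \<in> module_hom K N H \<Longrightarrow> Y \<in> carrier (T n) \<Longrightarrow> (\<lambda>u. tensor_cons n (g u) Y) \<in> module_hom K N (T (Suc n))"
  by (rule module_hom_comp[OF tensor_cons_hom_left])

lemma tensor_cons_hom_right': "g \<in> module_hom K N (T n) \<Longrightarrow> h \<in> carrier H \<Longrightarrow> (\<lambda>u. tensor_cons n h (g u)) \<in> module_hom K N (T (Suc n))"
  by (rule module_hom_comp[OF tensor_cons_hom_right])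

text \<open>These rules follow the shape of a term: linearity of a nested Sweedler expression in one
  of its legs is reduced to the place where that leg occurs.\<close>

lemmas hom_intros = bilinI trilinI sweedler_hom_inner sweedler_hom_outer sweedler_hom mult_hom_left mult_hom_right
  tensor_cons_hom_left' tensor_cons_hom_right' module_hom_id module_T module_M

lemmas closed_intros = sweedler_closed tensor_cons_closed m_closed one_closed

text \<open>Both maps are summed over the same representative of the comultiplication, so the claim
  is additivity of one finite sum.\<close>

lemma sweedler_add:
  assumes "module K N" "x \<in> carrier H"
    "\<And>a b. a \<in> carrier H \<Longrightarrow> b \<in> carrier H \<Longrightarrow> f a b \<in> carrier N"
    "\<And>a b. a \<in> carrier H \<Longrightarrow> b \<in> carrier H \<Longrightarrow> g a b \<in> carrier N"
  shows "sweedler N (\<lambda>a b. f a b \<oplus>\<^bsub>N\<^esub> g a b) x = sweedler N f x \<oplus>\<^bsub>N\<^esub> sweedler N g x"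
proof -
  interpret N: module K N by fact
  let ?p = "SOME p. p \<in> comult H x"
  note L = tensor_lift_finsum[OF comult_closed[OF assms(2)]]
  have c: "?p zs \<odot>\<^bsub>N\<^esub> f (zs ! 0) (zs ! 1) \<in> carrier N" "?p zs \<odot>\<^bsub>N\<^esub> g (zs ! 0) (zs ! 1) \<in> carrier N"
    "?p zs \<odot>\<^bsub>N\<^esub> (f (zs ! 0) (zs ! 1) \<oplus>\<^bsub>N\<^esub> g (zs ! 0) (zs ! 1)) =
      ?p zs \<odot>\<^bsub>N\<^esub> f (zs ! 0) (zs ! 1) \<oplus>\<^bsub>N\<^esub> ?p zs \<odot>\<^bsub>N\<^esub> g (zs ! 0) (zs ! 1)"
    if z: "zs \<in> {b. ?p b \<noteq> \<zero>\<^bsub>K\<^esub>}" for zs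
  proof -
    obtain a b where ab: "zs = [a, b]" "a \<in> carrier H" "b \<in> carrier H"
      using subsetD[OF L(2) z] by (rule words_2E)
    show "?p zs \<odot>\<^bsub>N\<^esub> f (zs ! 0) (zs ! 1) \<in> carrier N" "?p zs \<odot>\<^bsub>N\<^esub> g (zs ! 0) (zs ! 1) \<in> carrier N"
      "?p zs \<odot>\<^bsub>N\<^esub> (f (zs ! 0) (zs ! 1) \<oplus>\<^bsub>N\<^esub> g (zs ! 0) (zs ! 1)) =
      ?p zs \<odot>\<^bsub>N\<^esub> f (zs ! 0) (zs ! 1) \<oplus>\<^bsub>N\<^esub> ?p zs \<odot>\<^bsub>N\<^esub> g (zs ! 0) (zs ! 1)"
      using ab assms(3,4) L(3)[of zs] by (simp_all add: N.smult_r_distr)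
  qed
  have "sweedler N (\<lambda>a b. f a b \<oplus>\<^bsub>N\<^esub> g a b) x =
      (\<Oplus>\<^bsub>N\<^esub>zs \<in> {b. ?p b \<noteq> \<zero>\<^bsub>K\<^esub>}. ?p zs \<odot>\<^bsub>N\<^esub> f (zs ! 0) (zs ! 1) \<oplus>\<^bsub>N\<^esub> ?p zs \<odot>\<^bsub>N\<^esub> g (zs ! 0) (zs ! 1))"
    unfolding sweedler_def L(4) by (rule finsum_cong_on) (rule c(3))
  also have "\<dots> = sweedler N f x \<oplus>\<^bsub>N\<^esub> sweedler N g x"
    unfolding sweedler_def L(4) by (rule N.M.finsum_addf) (use c(1,2) in auto)
  finally show ?thesis .
qed

lemma sweedler_diff:
  assumes "module K N" "x \<in> carrier H"
    "\<And>a b. a \<in> carrier H \<Longrightarrow> b \<in> carrier H \<Longrightarrow> f a b \<in> carrier N"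
    "\<And>a b. a \<in> carrier H \<Longrightarrow> b \<in> carrier H \<Longrightarrow> g a b \<in> carrier N"
  shows "sweedler N (\<lambda>a b. f a b \<ominus>\<^bsub>N\<^esub> g a b) x = sweedler N f x \<ominus>\<^bsub>N\<^esub> sweedler N g x"
proof -
  interpret N: module K N by fact
  show ?thesis unfolding a_minus_def
    using assms by (subst sweedler_add[OF assms(1,2)])
      (auto simp: module_hom_sweedler[OF assms(1,1) module_hom_uminus[OF assms(1) module_hom_id] assms(2)])
qed

text \<open>This nesting is the normal form for three legs: \<open>a\<close>, \<open>b\<close>,
  \<open>c\<close> are \<open>x\<^sub>1\<close>, \<open>x\<^sub>2\<close>, \<open>x\<^sub>3\<close>,
  and \<open>e\<close> is the leg that is split again.\<close>

lemma module_hom_sweedler2: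
  assumes "module K N" "module K N'" "\<phi> \<in> module_hom K N N'" "x \<in> carrier H"
    "\<And>a b c. a \<in> carrier H \<Longrightarrow> b \<in> carrier H \<Longrightarrow> c \<in> carrier H \<Longrightarrow> f a b c \<in> carrier N"
  shows "\<phi> (sweedler N (\<lambda>e c. sweedler N (\<lambda>a b. f a b c) e) x) =
    sweedler N' (\<lambda>e c. sweedler N' (\<lambda>a b. \<phi> (f a b c)) e) x"
  by (subst module_hom_sweedler[OF assms(1-4)])
    (auto intro!: sweedler_closed assms sweedler_cong module_hom_sweedler[OF assms(1-3)])

subsection \<open>Iterated comultiplication\<close>

lemma multilinear_sweedler:
  assumes "module K N" "x \<in> carrier H" "\<And>a b. a \<in> carrier H \<Longrightarrow> b \<in> carrier H \<Longrightarrow> multilinear K H n N (f a b)"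
  shows "multilinear K H n N (\<lambda>xs. sweedler N (\<lambda>a b. f a b xs) x)"
  unfolding sweedler_def
  by (rule multilinear_lift_inner[OF assms(1) comult_closed[OF assms(2)]]) (auto elim!: words_2E assms(3))

lemma comult_at_0:
  assumes "x \<in> carrier H" "xs \<in> words H n"
  shows "comult_at K H 0 (x # xs) = sweedler (T (Suc (Suc n))) (\<lambda>a b. tensor_cons (Suc n) a (tensor_cons n b (tensor K H xs))) x"
  unfolding comult_at_def sweedler_def using length_words[OF assms(2)] comult_closed[OF assms(1)] assms(2)
  by (auto intro!: tensor_lift_cong[where n = 2] elim!: words_2E simp: tensor_cons_tensor)

lemma comult_at_Suc:
  assumes "x \<in> carrier H" "xs \<in> words H n" "j < n"
  shows "comult_at K H (Suc j) (x # xs) = tensor_cons (Suc n) x (comult_at K H j xs)"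
  unfolding comult_at_def length_words[OF assms(2)]
  using assms comult_closed[OF nth_words[OF assms(2,3)]] tensor_closed[OF comult_at_words[OF assms(2,3)]]
  by (auto intro!: tensor_lift_cong[where n = 2] simp: tensor_cons_tensor_lift[where m = 2] comult_at_words tensor_cons_tensor length_words[OF assms(2)])

lemma multilinear_comult_at:
  "j < n \<Longrightarrow> multilinear K H n (T (Suc n)) (comult_at K H j)"
proof (induct j arbitrary: n)
  case 0
  then obtain m where n: "n = Suc m" by (cases n) auto
  show ?case unfolding n
  proof (rule multilinear_SucI)
    fix xs assume xs: "xs \<in> words H m"
    have "sweedler (T (Suc (Suc m))) (\<lambda>a b. tensor_cons (Suc m) a (tensor_cons m b (tensor K H xs))) \<in>
        module_hom K H (T (Suc (Suc m)))"
      by (intro sweedler_hom hom_intros tensor_closed xs closed_intros)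
    thus "(\<lambda>x. comult_at K H 0 (x # xs)) \<in> module_hom K H (T (Suc (Suc m)))"
      by (rule module_hom_cong[OF module_M comult_at_0[symmetric], rotated -1]) (simp_all add: xs)
  next
    fix x assume x: "x \<in> carrier H"
    have "multilinear K H m (T (Suc (Suc m))) (\<lambda>xs. sweedler (T (Suc (Suc m))) (\<lambda>a b. tensor_cons (Suc m) a (tensor_cons m b (tensor K H xs))) x)"
      using x by (intro multilinear_sweedler module_T module_hom_multilinear[OF tensor_cons_hom_right]
        multilinear_tensor)
    thus "multilinear K H m (T (Suc (Suc m))) (\<lambda>xs. comult_at K H 0 (x # xs))"
      by (rule multilinear_cong) (simp add: comult_at_0[OF x])
  qed
next
  case (Suc j)
  then obtain m where n: "n = Suc m" "j < m" by (cases n) auto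
  show ?case unfolding n(1)
  proof (rule multilinear_SucI)
    fix xs assume xs: "xs \<in> words H m"
    show "(\<lambda>x. comult_at K H (Suc j) (x # xs)) \<in> module_hom K H (T (Suc (Suc m)))"
      by (rule module_hom_cong[OF module_M comult_at_Suc[OF _ xs n(2), symmetric]])
        (auto intro!: tensor_cons_hom_left comult_at_closed xs n)
  next
    fix x assume x: "x \<in> carrier H"
    have "multilinear K H m (T (Suc (Suc m))) (\<lambda>xs. tensor_cons (Suc m) x (comult_at K H j xs))"
      by (intro module_hom_multilinear[OF tensor_cons_hom_right[OF x]] Suc(1) n)
    thus "multilinear K H m (T (Suc (Suc m))) (\<lambda>xs. comult_at K H (Suc j) (x # xs))"
      by (rule multilinear_cong) (simp add: comult_at_Suc[OF x _ n(2)])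
  qed
qed

lemma iter_comult_hom: "iter_comult K H r \<in> module_hom K H (T (Suc r))"
proof (induct r)
  case 0
  show ?case using multilinear_hd[OF multilinear_tensor, of "[]" 0] by simp
next
  case (Suc r)
  have "tensor_lift K (T (Suc (Suc r))) (comult_at K H 0) \<in> module_hom K (T (Suc r)) (T (Suc (Suc r)))"
    by (intro tensor_lift_hom module_T multilinear_comult_at) simp
  from module_hom_comp[OF this Suc] show ?case by simp
qed

lemma iter_comult_closed: "x \<in> carrier H \<Longrightarrow> iter_comult K H r x \<in> carrier (T (Suc r))"
  by (rule module_hom_simps(1)[OF iter_comult_hom])

text \<open>The recursion for \<open>iter_comult\<close> comultiplies at place 0, that is, at the
  head of the list of legs.\<close>

lemma tensor_lift_iter_comult_Suc:
  assumes "module K N" "multilinear K H (Suc (Suc r)) N F" "x \<in> carrier H"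
  shows "tensor_lift K N F (iter_comult K H (Suc r) x) =
    tensor_lift K N (\<lambda>zs. sweedler N (\<lambda>a b. F (a # b # tl zs)) (hd zs)) (iter_comult K H r x)"
proof -
  note c = iter_comult_closed[OF assms(3), of r]
  have "tensor_lift K N F (iter_comult K H (Suc r) x) =
      tensor_lift K N F (tensor_lift K (T (Suc (Suc r))) (comult_at K H 0) (iter_comult K H r x))"
    by simp
  also have "\<dots> = tensor_lift K N (\<lambda>zs. tensor_lift K N F (comult_at K H 0 zs)) (iter_comult K H r x)"
    by (rule module_hom_tensor_lift[OF module_T assms(1) tensor_lift_hom[OF assms(1,2)] c comult_at_closed]) auto
  also have "\<dots> = tensor_lift K N (\<lambda>zs. sweedler N (\<lambda>a b. F (a # b # tl zs)) (hd zs)) (iter_comult K H r x)"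
    by (rule tensor_lift_cong[OF c]) (auto simp: tensor_lift_comult_at[OF assms(1,2)] elim!: words_SucE)
  finally show ?thesis .
qed

lemma multilinear_sweedler_hd:
  assumes "module K N" "multilinear K H (Suc (Suc r)) N F"
  shows "multilinear K H (Suc r) N (\<lambda>zs. sweedler N (\<lambda>a b. F (a # b # tl zs)) (hd zs))"
proof (rule multilinear_SucI)
  fix xs assume xs: "xs \<in> words H r"
  have "bilin N (\<lambda>a b. F (a # b # xs))"
    using multilinear_hd[OF assms(2)] multilinear_hd[OF multilinear_Cons[OF assms(2)]] xs by (auto intro!: bilinI)
  from sweedler_hom_outer[OF assms(1) this module_hom_id]
  show "(\<lambda>x. sweedler N (\<lambda>a b. F (a # b # tl (x # xs))) (hd (x # xs))) \<in> module_hom K H N" by simp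
next
  fix x assume x: "x \<in> carrier H"
  show "multilinear K H r N (\<lambda>xs. sweedler N (\<lambda>a b. F (a # b # tl (x # xs))) (hd (x # xs)))"
    using x by (simp, intro multilinear_sweedler assms(1) multilinear_Cons[OF multilinear_Cons[OF assms(2)]])
qed

text \<open>Only the first leg is ever split, so the second leg of the very first comultiplication
  survives untouched as the last entry.\<close>

lemma iter_comult_snoc:
  assumes "module K N" "multilinear K H (Suc (Suc r)) N F" "x \<in> carrier H"
  shows "tensor_lift K N F (iter_comult K H (Suc r) x) =
    sweedler N (\<lambda>a b. tensor_lift K N (\<lambda>zs. F (zs @ [b])) (iter_comult K H r a)) x"
  using assms(2,3)
proof (induct r arbitrary: F x)
  case 0
  have "tensor_lift K N (\<lambda>zs. F (zs @ [b])) (tensor K H [a]) = F [a, b]" if "a \<in> carrier H" "b \<in> carrier H" for a b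
    using tensor_lift_pure[OF assms(1) multilinear_snoc[OF 0(1) that(2)], of "[a]"] that by simp
  hence "sweedler N (\<lambda>a b. tensor_lift K N (\<lambda>zs. F (zs @ [b])) (iter_comult K H 0 a)) x = sweedler N (\<lambda>a b. F [a, b]) x"
    by (intro sweedler_cong 0) simp
  moreover have "tensor_lift K N F (iter_comult K H (Suc 0) x) = sweedler N (\<lambda>a b. F [a, b]) x"
    using tensor_lift_iter_comult_Suc[OF assms(1) 0] tensor_lift_pure[OF assms(1) multilinear_sweedler_hd[OF assms(1) 0(1)], of "[x]"] 0(2)
    by simp
  ultimately show ?case by simp
next
  case (Suc r)
  let ?G = "\<lambda>zs. sweedler N (\<lambda>a b. F (a # b # tl zs)) (hd zs)"
  have "tensor_lift K N F (iter_comult K H (Suc (Suc r)) x) = tensor_lift K N ?G (iter_comult K H (Suc r) x)"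
    by (rule tensor_lift_iter_comult_Suc[OF assms(1) Suc(2,3)])
  also have "\<dots> = sweedler N (\<lambda>a b. tensor_lift K N (\<lambda>zs. ?G (zs @ [b])) (iter_comult K H r a)) x"
    by (rule Suc(1)[OF multilinear_sweedler_hd[OF assms(1) Suc(2)] Suc(3)])
  also have "\<dots> = sweedler N (\<lambda>a b. tensor_lift K N (\<lambda>zs. F (zs @ [b])) (iter_comult K H (Suc r) a)) x"
  proof (rule sweedler_cong[OF Suc(3)])
    fix a b assume ab: "a \<in> carrier H" "b \<in> carrier H"
    have "tensor_lift K N (\<lambda>zs. F (zs @ [b])) (iter_comult K H (Suc r) a) =
       tensor_lift K N (\<lambda>zs. sweedler N (\<lambda>p q. F ((p # q # tl zs) @ [b])) (hd zs)) (iter_comult K H r a)"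
      by (rule tensor_lift_iter_comult_Suc[OF assms(1) multilinear_snoc[OF Suc(2) ab(2)] ab(1)])
    also have "\<dots> = tensor_lift K N (\<lambda>zs. ?G (zs @ [b])) (iter_comult K H r a)"
      by (rule tensor_lift_cong[OF iter_comult_closed[OF ab(1)]]) (auto elim!: words_SucE)
    finally show "tensor_lift K N (\<lambda>zs. ?G (zs @ [b])) (iter_comult K H r a) =
        tensor_lift K N (\<lambda>zs. F (zs @ [b])) (iter_comult K H (Suc r) a)" ..
  qed
  finally show ?case .
qed

lemma tensor_lift_iter_comult_hom:
  assumes "module K N" "multilinear K H (Suc r) N F" "g \<in> module_hom K N' H"
  shows "(\<lambda>u. tensor_lift K N F (iter_comult K H r (g u))) \<in> module_hom K N' N"
  by (rule module_hom_comp[OF module_hom_comp[OF tensor_lift_hom[OF assms(1,2)] iter_comult_hom] assms(3)])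

text \<open>For the first leg coassociativity enters. The last leg is set aside by
  \<open>iter_comult_snoc\<close>, the induction hypothesis treats the rest, and after one
  reassociation the last leg is put back.\<close>

lemma iter_comult_Cons:
  assumes "module K N" "multilinear K H (Suc (Suc r)) N F" "x \<in> carrier H"
  shows "tensor_lift K N F (iter_comult K H (Suc r) x) =
    sweedler N (\<lambda>a b. tensor_lift K N (\<lambda>zs. F (a # zs)) (iter_comult K H r b)) x"
  using assms(2,3)
proof (induct r arbitrary: F x)
  case 0
  have "tensor_lift K N (\<lambda>zs. F (zs @ [b])) (tensor K H [a]) = F [a, b]"
    "tensor_lift K N (\<lambda>zs. F (a # zs)) (tensor K H [b]) = F [a, b]" if "a \<in> carrier H" "b \<in> carrier H" for a b
    using tensor_lift_pure[OF assms(1) multilinear_snoc[OF 0(1) that(2)], of "[a]"]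
      tensor_lift_pure[OF assms(1) multilinear_Cons[OF 0(1) that(1)], of "[b]"] that by simp_all
  thus ?case unfolding iter_comult_snoc[OF assms(1) 0] by (intro sweedler_cong 0) simp
next
  case (Suc r)
  let ?f = "\<lambda>a b c. tensor_lift K N (\<lambda>zs. F (a # zs @ [c])) (iter_comult K H r b)"
  have F1: "multilinear K H (Suc r) N (\<lambda>zs. F (a # zs @ [c]))" if "a \<in> carrier H" "c \<in> carrier H" for a c
    by (rule multilinear_snoc[OF multilinear_Cons[OF Suc(2) that(1)] that(2)])
  have tri: "trilin N ?f"
  proof (rule trilinI)
    fix b c assume "b \<in> carrier H" "c \<in> carrier H"
    thus "(\<lambda>a. ?f a b c) \<in> module_hom K H N"
      by (intro tensor_lift_linear[OF assms(1) iter_comult_closed]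
        multilinear_hd[OF Suc(2), of "_ @ [c]"]) (auto simp: words_def)
  next
    fix a c assume "a \<in> carrier H" "c \<in> carrier H"
    thus "(\<lambda>b. ?f a b c) \<in> module_hom K H N"
      by (intro tensor_lift_iter_comult_hom assms(1) F1 module_hom_id)
  next
    fix a b assume "a \<in> carrier H" "b \<in> carrier H"
    thus "(\<lambda>c. ?f a b c) \<in> module_hom K H N"
      by (intro tensor_lift_linear[OF assms(1) iter_comult_closed]
        multilinear_last[OF Suc(2), of "a # _", unfolded append_Cons]) (auto simp: words_def)
  qed
  have "tensor_lift K N F (iter_comult K H (Suc (Suc r)) x) =
      sweedler N (\<lambda>a b. tensor_lift K N (\<lambda>zs. F (zs @ [b])) (iter_comult K H (Suc r) a)) x"
    by (rule iter_comult_snoc[OF assms(1) Suc(2,3)])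
  also have "\<dots> = sweedler N (\<lambda>e c. sweedler N (\<lambda>a b. ?f a b c) e) x"
  proof (rule sweedler_cong[OF Suc(3)])
    fix e c assume e: "e \<in> carrier H" "c \<in> carrier H"
    show "tensor_lift K N (\<lambda>zs. F (zs @ [c])) (iter_comult K H (Suc r) e) = sweedler N (\<lambda>a b. ?f a b c) e"
      using Suc(1)[OF multilinear_snoc[OF Suc(2) e(2)] e(1)] by simp
  qed
  also have "\<dots> = sweedler N (\<lambda>a e. sweedler N (\<lambda>b c. ?f a b c) e) x"
    by (rule sweedler_coassoc[OF assms(1) tri Suc(3)])
  also have "\<dots> = sweedler N (\<lambda>a b. tensor_lift K N (\<lambda>zs. F (a # zs)) (iter_comult K H (Suc r) b)) x"
    by (intro sweedler_cong Suc(3) iter_comult_snoc[symmetric] assms(1) multilinear_Cons[OF Suc(2)])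
  finally show ?case .
qed

text \<open>The two outer legs are those that the product places around the first letter of its
  right factor; the inner ones form the iterated comultiplication of the middle leg. This is the
  origin of the recursion for the product.\<close>

lemma iter_comult_both_ends:
  assumes "module K N" "multilinear K H (Suc (Suc (Suc r))) N F" "x \<in> carrier H"
  shows "tensor_lift K N F (iter_comult K H (Suc (Suc r)) x) =
    sweedler N (\<lambda>e c. sweedler N (\<lambda>a b. tensor_lift K N (\<lambda>zs. F (a # zs @ [c])) (iter_comult K H r b)) e) x"
  unfolding iter_comult_snoc[OF assms] 
  by (intro sweedler_cong assms(3))
    (use iter_comult_Cons[OF assms(1) multilinear_snoc[OF assms(2)]] in simp)

end

section \<open>The antipode\<close>

context hopf_algebra
begin

abbreviation S where "S \<equiv> antipode H"

lemma antipode_closed: "x \<in> carrier H \<Longrightarrow> S x \<in> carrier H"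
  by (rule module_hom_simps(1)[OF antipode_hom])

lemma antipode_hom': "g \<in> module_hom K N H \<Longrightarrow> (\<lambda>u. S (g u)) \<in> module_hom K N H"
  by (rule module_hom_comp[OF antipode_hom])

lemmas hom_rules = hom_intros antipode_hom'
lemmas closed_rules = closed_intros antipode_closed

lemma sweedler_antipode_left:
  assumes "module K N" "f \<in> module_hom K H N" "x \<in> carrier H"
  shows "sweedler N (\<lambda>a b. f (S a \<otimes> b)) x = counit H x \<odot>\<^bsub>N\<^esub> f \<one>"
proof -
  have "sweedler N (\<lambda>a b. f (S a \<otimes> b)) x = f (sweedler H (\<lambda>a b. S a \<otimes> b) x)"
    by (rule module_hom_sweedler[OF module_M assms, symmetric]) (intro closed_rules)
  thus ?thesis
    using antipode_left[OF assms(3)] counit_closed[OF assms(3)]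
    by (simp add: sweedler_def module_hom_simps[OF assms(2)])
qed

lemma sweedler_antipode_right:
  assumes "module K N" "f \<in> module_hom K H N" "x \<in> carrier H"
  shows "sweedler N (\<lambda>a b. f (a \<otimes> S b)) x = counit H x \<odot>\<^bsub>N\<^esub> f \<one>"
proof -
  have "sweedler N (\<lambda>a b. f (a \<otimes> S b)) x = f (sweedler H (\<lambda>a b. a \<otimes> S b) x)"
    by (rule module_hom_sweedler[OF module_M assms, symmetric]) (intro closed_rules)
  thus ?thesis
    using antipode_right[OF assms(3)] counit_closed[OF assms(3)]
    by (simp add: sweedler_def module_hom_simps[OF assms(2)])
qed

text \<open>Stands for \<open>S(x\<^sub>1) x\<^sub>2 \<otimes> x\<^sub>3 = 1 \<otimes> x\<close>. It
  serves to insert a cancelling pair into an expression.\<close>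

lemma sweedler_collapse_left:
  assumes "module K N" "bilin N f" "x \<in> carrier H"
  shows "sweedler N (\<lambda>a b. sweedler N (\<lambda>c d. f (S c \<otimes> d) b) a) x = f \<one> x"
proof -
  note b1 = bilin_hom_left[OF assms(2)] and b2 = bilin_hom_right[OF assms(2)]
  have "sweedler N (\<lambda>a b. sweedler N (\<lambda>c d. f (S c \<otimes> d) b) a) x = sweedler N (\<lambda>a b. counit H a \<odot>\<^bsub>N\<^esub> f \<one> b) x"
    by (rule sweedler_cong[OF assms(3)], rule sweedler_antipode_left[OF assms(1)])
      (auto intro!: b1 module_hom_id)
  also have "\<dots> = f \<one> x"
    by (rule sweedler_counit_left[OF assms(1) _ assms(3)]) (intro b2 module_hom_id one_closed)
  finally show ?thesis .
qed

lemma antipode_one: "S \<one> = \<one>"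
proof -
  have "bilin H (\<lambda>a b. S a \<otimes> b)" by (intro hom_rules closed_rules; assumption)
  hence "S \<one> \<otimes> \<one> = sweedler H (\<lambda>a b. S a \<otimes> b) \<one>"
    by (rule sweedler_one[OF module_M, symmetric])
  also have "\<dots> = \<one>" 
    using sweedler_antipode_left[OF module_M module_hom_id one_closed] by (simp add: counit_one)
  finally show ?thesis by (simp add: antipode_closed)
qed

text \<open>Both \<open>S(x y)\<close> and \<open>S(y) S(x)\<close> are convolution inverses of the
  multiplication on \<open>H \<otimes> H\<close>. Uniqueness of the inverse, written out, is the
  chain \<open>S(x y) = S(y\<^sub>1) S(x\<^sub>1) x\<^sub>2 y\<^sub>2 S(x\<^sub>3 y\<^sub>3) = S(y)
  S(x)\<close>.\<close>

lemma antipode_mult: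
  assumes x: "x \<in> carrier H" and y: "y \<in> carrier H"
  shows "S (x \<otimes> y) = S y \<otimes> S x"
proof -
  \<comment> \<open>In use, \<open>c\<close> is \<open>y\<^sub>1\<close> and \<open>r\<close> is
    \<open>x\<^sub>1\<close>, while \<open>u\<close> and \<open>v\<close> are
    \<open>x\<^sub>2 y\<^sub>2\<close> and \<open>x\<^sub>3 y\<^sub>3\<close>.\<close>
  let ?E = "\<lambda>c r u v. (S c \<otimes> S r) \<otimes> (u \<otimes> S v)"
  note closed = closed_rules module_M counit_closed
  have 1: "S (x \<otimes> y) = sweedler H (\<lambda>a b. sweedler H (\<lambda>c d. (S c \<otimes> d) \<otimes> S (x \<otimes> b)) a) y"
    using assms by (subst sweedler_collapse_left[OF module_M _ y, where f = "\<lambda>u v. u \<otimes> S (x \<otimes> v)"])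
      (auto intro!: hom_rules closed simp: antipode_closed)
  \<comment> \<open>A second cancelling pair, made of the first two legs of x, goes between
    \<open>S c\<close> and \<open>d\<close>.\<close>
  have 2: "(S c \<otimes> d) \<otimes> S (x \<otimes> b) = sweedler H (\<lambda>r q. sweedler H (\<lambda>s q. ?E c r (s \<otimes> d) (q \<otimes> b)) q) x"
    if c: "b \<in> carrier H" "c \<in> carrier H" "d \<in> carrier H" for b c d
  proof -
    have "(S c \<otimes> d) \<otimes> S (x \<otimes> b) = sweedler H (\<lambda>p q. sweedler H (\<lambda>r s. (S c \<otimes> ((S r \<otimes> s) \<otimes> d)) \<otimes> S (q \<otimes> b)) p) x"
      using c x by (subst sweedler_collapse_left[OF module_M _ x, where f = "\<lambda>u v. (S c \<otimes> (u \<otimes> d)) \<otimes> S (v \<otimes> b)"])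
        (auto intro!: hom_rules closed)
    also have "\<dots> = sweedler H (\<lambda>p q. sweedler H (\<lambda>r s. ?E c r (s \<otimes> d) (q \<otimes> b)) p) x"
      using c x by (simp add: antipode_closed m_assoc cong: sweedler_cong)
    also have "\<dots> = sweedler H (\<lambda>r q. sweedler H (\<lambda>s q. ?E c r (s \<otimes> d) (q \<otimes> b)) q) x"
      using c by (intro sweedler_coassoc[OF module_M _ x]) (auto intro!: hom_rules closed)
    finally show ?thesis .
  qed
  \<comment> \<open>Together the two sums run over the comultiplication of the product of
    \<open>q'\<close> and \<open>b'\<close>, so the antipode axiom turns them into a counit.\<close>
  have 3: "sweedler H (\<lambda>d b. sweedler H (\<lambda>s q. ?E c r (s \<otimes> d) (q \<otimes> b)) q') b' = counit H q' \<odot> (counit H b' \<odot> (S c \<otimes> S r))"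
    if c: "b' \<in> carrier H" "c \<in> carrier H" "q' \<in> carrier H" "r \<in> carrier H" for b' c q' r
  proof -
    have "sweedler H (\<lambda>d b. sweedler H (\<lambda>s q. ?E c r (s \<otimes> d) (q \<otimes> b)) q') b' =
        sweedler H (\<lambda>s q. sweedler H (\<lambda>d b. ?E c r (s \<otimes> d) (q \<otimes> b)) b') q'"
      using c by (intro sweedler_swap[OF module_M]) (auto intro!: closed)
    also have "\<dots> = sweedler H (?E c r) (q' \<otimes> b')"
      using c by (intro sweedler_mult[OF module_M, symmetric]) (auto intro!: hom_rules closed)
    also have "\<dots> = counit H (q' \<otimes> b') \<odot> ((S c \<otimes> S r) \<otimes> \<one>)"
      using c by (intro sweedler_antipode_right[OF module_M]) (auto intro!: hom_rules closed)
    finally show ?thesis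
      using c counit_ring_hom by (simp add: ring_hom_mult smult_assoc1 counit_closed antipode_closed)
  qed
  have "S (x \<otimes> y) = sweedler H (\<lambda>a b. sweedler H (\<lambda>c d. sweedler H (\<lambda>r q. sweedler H (\<lambda>s q. ?E c r (s \<otimes> d) (q \<otimes> b)) q) x) a) y"
    unfolding 1 by (intro sweedler_cong y) (simp_all add: 2)
  \<comment> \<open>This reassociation and the swap after it bring together the second and third
    legs of x and of y, as the collapse requires.\<close>
  also have "\<dots> = sweedler H (\<lambda>c b. sweedler H (\<lambda>d b. sweedler H (\<lambda>r q. sweedler H (\<lambda>s q. ?E c r (s \<otimes> d) (q \<otimes> b)) q) x) b) y"
    using x by (intro sweedler_coassoc[OF module_M _ y]) (auto intro!: hom_rules closed)
  also have "\<dots> = sweedler H (\<lambda>c b. sweedler H (\<lambda>r q. sweedler H (\<lambda>d b. sweedler H (\<lambda>s q. ?E c r (s \<otimes> d) (q \<otimes> b)) q) b) x) y"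
    using x y by (intro sweedler_cong sweedler_swap[OF module_M]) (auto intro!: closed)
  also have "\<dots> = sweedler H (\<lambda>c b. sweedler H (\<lambda>r q. counit H q \<odot> (counit H b \<odot> (S c \<otimes> S r))) x) y"
    using x y by (simp add: 3 cong: sweedler_cong)
  also have "\<dots> = sweedler H (\<lambda>c b. counit H b \<odot> (S c \<otimes> S x)) y"
    using x y by (intro sweedler_cong sweedler_counit_right[OF module_M])
      (auto intro!: hom_rules closed module_hom_smult[OF module_M])
  also have "\<dots> = S y \<otimes> S x"
    using x by (intro sweedler_counit_right[OF module_M _ y]) (auto intro!: hom_rules closed)
  finally show ?thesis .
qed

text \<open>The dual argument: \<open>\<Delta> S(x)\<close> and
  \<open>S(x\<^sub>2) \<otimes> S(x\<^sub>1)\<close> are both convolution inverses of the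
  comultiplication.\<close>

lemma sweedler_antipode:
  assumes N: "module K N" and f: "bilin N f" and x: "x \<in> carrier H"
  shows "sweedler N f (S x) = sweedler N (\<lambda>a b. f (S b) (S a)) x"
proof -
  note closed = closed_rules N module_M counit_closed bilin_closed[OF f]
  note hom = hom_rules N bilin_hom_left[OF f] bilin_hom_right[OF f]
  \<comment> \<open>The intermediate expression: \<open>c\<close>, \<open>u\<close>,
    \<open>v\<close>, \<open>q\<close> are the first four legs of x in this order, and
    \<open>r\<close>, \<open>s\<close> are the legs of \<open>S(x\<^sub>5)\<close>.\<close>
  let ?E = "\<lambda>c u v q r s. f (S u \<otimes> (v \<otimes> r)) (S c \<otimes> (q \<otimes> s))"
  have 1: "sweedler N f (S x) = sweedler N (\<lambda>a b. sweedler N (\<lambda>c d. sweedler N (\<lambda>r s. f r ((S c \<otimes> d) \<otimes> s)) (S b)) a) x"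
  proof (subst sweedler_collapse_left[OF N _ x, where f = "\<lambda>u v. sweedler N (\<lambda>r s. f r (u \<otimes> s)) (S v)"])
    show "bilin N (\<lambda>u v. sweedler N (\<lambda>r s. f r (u \<otimes> s)) (S v))" by (intro hom closed)
    show "sweedler N f (S x) = sweedler N (\<lambda>r s. f r (\<one> \<otimes> s)) (S x)"
      using x by (simp add: antipode_closed cong: sweedler_cong)
  qed
  have 2: "f r ((S c \<otimes> d) \<otimes> s) = sweedler N (\<lambda>u w. sweedler N (\<lambda>v q. ?E c u v q r s) w) d"
    if c: "c \<in> carrier H" "d \<in> carrier H" "r \<in> carrier H" "s \<in> carrier H" for c d r s
  proof -
    have "f r ((S c \<otimes> d) \<otimes> s) = sweedler N (\<lambda>p q. sweedler N (\<lambda>u v. f ((S u \<otimes> v) \<otimes> r) ((S c \<otimes> q) \<otimes> s)) p) d"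
      using c by (subst sweedler_collapse_left[OF N _ c(2), where f = "\<lambda>w q. f (w \<otimes> r) ((S c \<otimes> q) \<otimes> s)"])
        (auto intro!: hom closed)
    also have "\<dots> = sweedler N (\<lambda>p q. sweedler N (\<lambda>u v. ?E c u v q r s) p) d"
      using c by (simp add: antipode_closed m_assoc cong: sweedler_cong)
    also have "\<dots> = sweedler N (\<lambda>u w. sweedler N (\<lambda>v q. ?E c u v q r s) w) d"
      using c by (intro sweedler_coassoc[OF N]) (auto intro!: hom closed)
    finally show ?thesis .
  qed
  \<comment> \<open>Multiplicativity merges the legs of \<open>h\<close> with those of
    \<open>S b\<close> into the comultiplication of their product, which the antipode axiom turns
    into a multiple of \<open>1 \<otimes> 1\<close>.\<close>
  have 3: "sweedler N (\<lambda>h b. sweedler N (\<lambda>v q. sweedler N (\<lambda>r s. ?E c u v q r s) (S b)) h) g =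
      counit H g \<odot>\<^bsub>N\<^esub> f (S u) (S c)" if c: "c \<in> carrier H" "u \<in> carrier H" "g \<in> carrier H" for c u g
  proof -
    have "sweedler N (\<lambda>h b. sweedler N (\<lambda>v q. sweedler N (\<lambda>r s. ?E c u v q r s) (S b)) h) g =
        sweedler N (\<lambda>h b. sweedler N (\<lambda>m n. f (S u \<otimes> m) (S c \<otimes> n)) (h \<otimes> S b)) g"
      using c by (intro sweedler_cong sweedler_mult[OF N, symmetric]) (auto intro!: hom closed)
    also have "\<dots> = counit H g \<odot>\<^bsub>N\<^esub> sweedler N (\<lambda>m n. f (S u \<otimes> m) (S c \<otimes> n)) \<one>"
      using c by (intro sweedler_antipode_right[OF N]) (auto intro!: hom closed)
    also have "sweedler N (\<lambda>m n. f (S u \<otimes> m) (S c \<otimes> n)) \<one> = f (S u \<otimes> \<one>) (S c \<otimes> \<one>)"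
      using c by (intro sweedler_one[OF N]) (auto intro!: hom closed)
    finally show ?thesis using c by (simp add: antipode_closed)
  qed
  have "sweedler N f (S x) = sweedler N (\<lambda>a b. sweedler N (\<lambda>c d. sweedler N (\<lambda>r s.
      sweedler N (\<lambda>u w. sweedler N (\<lambda>v q. ?E c u v q r s) w) d) (S b)) a) x"
    unfolding 1 using x by (intro sweedler_cong) (simp_all add: 2 antipode_closed)
  also have "\<dots> = sweedler N (\<lambda>a b. sweedler N (\<lambda>c d. sweedler N (\<lambda>u w.
      sweedler N (\<lambda>r s. sweedler N (\<lambda>v q. ?E c u v q r s) w) (S b)) d) a) x"
    using x by (intro sweedler_cong sweedler_swap[OF N]) (auto intro!: closed)
  also have "\<dots> = sweedler N (\<lambda>a b. sweedler N (\<lambda>c d. sweedler N (\<lambda>u w.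
      sweedler N (\<lambda>v q. sweedler N (\<lambda>r s. ?E c u v q r s) (S b)) w) d) a) x"
    using x by (intro sweedler_cong sweedler_swap[OF N]) (auto intro!: closed)
  \<comment> \<open>In this step and the next the first two legs are gathered in \<open>e\<close>
    and the last three in \<open>g\<close>, so that the sum over \<open>g\<close> can be
    collapsed.\<close>
  also have "\<dots> = sweedler N (\<lambda>a b. sweedler N (\<lambda>e w. sweedler N (\<lambda>c u.
      sweedler N (\<lambda>v q. sweedler N (\<lambda>r s. ?E c u v q r s) (S b)) w) e) a) x"
    using x by (intro sweedler_cong sweedler_coassoc[OF N, symmetric]) (auto intro!: hom closed)
  also have "\<dots> = sweedler N (\<lambda>e g. sweedler N (\<lambda>w b. sweedler N (\<lambda>c u.
      sweedler N (\<lambda>v q. sweedler N (\<lambda>r s. ?E c u v q r s) (S b)) w) e) g) x"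
    using x by (intro sweedler_coassoc[OF N]) (auto intro!: hom closed)
  also have "\<dots> = sweedler N (\<lambda>e g. sweedler N (\<lambda>c u. sweedler N (\<lambda>w b.
      sweedler N (\<lambda>v q. sweedler N (\<lambda>r s. ?E c u v q r s) (S b)) w) g) e) x"
    using x by (intro sweedler_cong sweedler_swap[OF N]) (auto intro!: closed)
  also have "\<dots> = sweedler N (\<lambda>e g. sweedler N (\<lambda>c u. counit H g \<odot>\<^bsub>N\<^esub> f (S u) (S c)) e) x"
    using x by (simp add: 3 cong: sweedler_cong)
  also have "\<dots> = sweedler N (\<lambda>e g. counit H g \<odot>\<^bsub>N\<^esub> sweedler N (\<lambda>c u. f (S u) (S c)) e) x"
    using x by (intro sweedler_cong module_hom_sweedler[OF N N, symmetric] module_hom_smult[OF N module_hom_id])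
      (auto intro!: closed)
  also have "\<dots> = sweedler N (\<lambda>c u. f (S u) (S c)) x"
    using x by (intro sweedler_counit_right[OF N]) (auto intro!: hom closed)
  finally show ?thesis .
qed

section \<open>The product\<close>

lemma Khat_eq: "Khat K H n = T (Suc n)"
  by (simp add: Khat_def)

text \<open>The letters that the last letter of a left word produces, given the list
  \<open>zs\<close> of its 2m + 1 legs. Places count from zero: \<open>zs ! (2 * m - i)\<close> is
  the leg numbered 2m + 1 - i in Sweedler notation.\<close>

definition mult_word
  where "mult_word m ys zs = map (\<lambda>i. zs ! i \<otimes> ys ! i \<otimes> S (zs ! (2 * m - i))) [0..<m] @ [zs ! m \<otimes> ys ! m]"

lemma mult_word_in_words:
  assumes "ys \<in> words H (Suc m)" "zs \<in> words H (Suc (2 * m))"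
  shows "mult_word m ys zs \<in> words H (Suc m)"
proof -
  have "zs ! i \<otimes> ys ! i \<otimes> S (zs ! (2 * m - i)) \<in> carrier H" if "i < m" for i
    using that by (intro m_closed antipode_closed nth_words[OF assms(1)] nth_words[OF assms(2)]) auto
  moreover have "zs ! m \<otimes> ys ! m \<in> carrier H"
    by (intro m_closed nth_words[OF assms(1)] nth_words[OF assms(2)]) auto
  ultimately show ?thesis by (auto simp: mult_word_def words_def)
qed

text \<open>The pairs i and 2m - i are nested like brackets: inside the outermost pair the same
  expression for m remains.\<close>

lemma mult_word_Suc:
  assumes "length zs = Suc (2 * m)"
  shows "mult_word (Suc m) (y # ys) (a # zs @ [c]) = (a \<otimes> y \<otimes> S c) # mult_word m ys zs"
proof -
  have "[0..<Suc m] = 0 # map Suc [0..<m]" by (simp add: map_Suc_upt upt_conv_Cons)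
  \<comment> \<open>Dropping the head shifts every place by one; as \<open>i < m\<close>, the
    subtraction is not truncated.\<close>
  moreover have "(a # zs @ [c]) ! (2 * Suc m - Suc i) = zs ! (2 * m - i)" if "i < m" for i
  proof -
    have "2 * Suc m - Suc i = Suc (2 * m - i)" using that by auto
    thus ?thesis using assms by (simp add: nth_append less_Suc_eq_le)
  qed
  moreover have "(a # zs @ [c]) ! (2 * Suc m) = c" using assms by (simp add: nth_append)
  ultimately show ?thesis using assms by (auto simp: mult_word_def nth_append simp del: upt_Suc)
qed

lemma tensor_mult_word_Suc:
  assumes "y \<in> carrier H" "ys \<in> words H (Suc m)" "a \<in> carrier H" "c \<in> carrier H" "zs \<in> words H (Suc (2 * m))"
  shows "tensor K H (mult_word (Suc m) (y # ys) (a # zs @ [c])) =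
    tensor_cons (Suc m) (a \<otimes> y \<otimes> S c) (tensor K H (mult_word m ys zs))"
  unfolding mult_word_Suc[OF length_words[OF assms(5)]]
  using assms by (simp add: tensor_cons_tensor mult_word_in_words antipode_closed)

lemma tensor_single_hom: "g \<in> module_hom K N H \<Longrightarrow> (\<lambda>u. tensor K H [g u]) \<in> module_hom K N (T (Suc 0))"
  using module_hom_comp[OF multilinear_hd[OF multilinear_tensor, of "[]" 0]] by simp

text \<open>Removing the head of \<open>ys\<close> takes both outer legs with it, hence the
  criterion with two ends.\<close>

lemma multilinear_mult_word:
  "ys \<in> words H (Suc m) \<Longrightarrow> multilinear K H (Suc (2 * m)) (T (Suc m)) (\<lambda>zs. tensor K H (mult_word m ys zs))"
proof (induct m arbitrary: ys)
  case 0
  then obtain y where y: "ys = [y]" "y \<in> carrier H" by (auto elim!: words_SucE)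
  have "(\<lambda>x. tensor K H (mult_word 0 ys [x])) \<in> module_hom K H (T (Suc 0))"
    unfolding y(1) mult_word_def by (simp, intro tensor_single_hom mult_hom_left module_hom_id y(2))
  moreover have "tensor K H (mult_word 0 ys [x]) \<in> carrier (T (Suc 0))" if "x \<in> carrier H" for x
    using that y by (intro tensor_closed) (simp add: mult_word_def)
  ultimately show ?case by (auto intro!: multilinear_SucI multilinear_0)
next
  case (Suc m)
  then obtain y ys' where y: "ys = y # ys'" "y \<in> carrier H" "ys' \<in> words H (Suc m)" by (blast elim: words_SucE)
  note eq = tensor_mult_word_Suc[OF y(2,3)]
  have "multilinear K H (Suc (Suc (Suc (2 * m)))) (T (Suc (Suc m))) (\<lambda>zs. tensor K H (mult_word (Suc m) ys zs))"
    unfolding y(1)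
  proof (rule multilinear_both_endsI)
    fix zs c assume zs: "zs \<in> words H (Suc (2 * m))" and c: "c \<in> carrier H"
    have "(\<lambda>a. tensor_cons (Suc m) (a \<otimes> y \<otimes> S c) (tensor K H (mult_word m ys' zs))) \<in> module_hom K H (T (Suc (Suc m)))"
      "(\<lambda>a. tensor_cons (Suc m) (c \<otimes> y \<otimes> S a) (tensor K H (mult_word m ys' zs))) \<in> module_hom K H (T (Suc (Suc m)))"
      by (intro hom_rules closed_rules tensor_closed mult_word_in_words zs c y)+
    thus "(\<lambda>a. tensor K H (mult_word (Suc m) (y # ys') (a # zs @ [c]))) \<in> module_hom K H (T (Suc (Suc m)))"
      "(\<lambda>a. tensor K H (mult_word (Suc m) (y # ys') (c # zs @ [a]))) \<in> module_hom K H (T (Suc (Suc m)))"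
      by (auto intro: module_hom_cong[OF module_M eq[symmetric]] zs c)
  next
    fix a c assume ac: "a \<in> carrier H" "c \<in> carrier H"
    have "multilinear K H (Suc (2 * m)) (T (Suc (Suc m))) (\<lambda>zs. tensor_cons (Suc m) (a \<otimes> y \<otimes> S c) (tensor K H (mult_word m ys' zs)))"
      by (intro module_hom_multilinear[OF tensor_cons_hom_right] Suc(1) y closed_rules ac)
    thus "multilinear K H (Suc (2 * m)) (T (Suc (Suc m))) (\<lambda>zs. tensor K H (mult_word (Suc m) (y # ys') (a # zs @ [c])))"
      by (rule multilinear_cong) (simp add: eq ac)
  qed
  thus ?case by simp
qed

section \<open>The product of two words\<close>

lemma Khat_mult_pure_eq:
  "Khat_mult_pure K H n m xs ys =
    tensor_lift K (T (Suc (n + m))) (\<lambda>zs. tensor K H (take n xs @ mult_word m ys zs)) (iter_comult K H (2 * m) (xs ! n))"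
  by (simp add: Khat_mult_pure_def mult_word_def Khat_eq)

lemma mult_word_prepend:
  assumes "xs \<in> words H (Suc n)" "ys \<in> words H (Suc m)" "zs \<in> words H (Suc (2 * m))"
  shows "take n xs @ mult_word m ys zs \<in> words H (Suc (n + m))"
  using assms(1) mult_word_in_words[OF assms(2,3)] by (auto simp: words_def dest: in_set_takeD)

lemma Khat_mult_pure_closed:
  assumes "xs \<in> words H (Suc n)" "ys \<in> words H (Suc m)"
  shows "Khat_mult_pure K H n m xs ys \<in> carrier (T (Suc (n + m)))"
  unfolding Khat_mult_pure_eq
  by (intro tensor_lift_closed[OF module_T iter_comult_closed] nth_words[OF assms(1)]
      tensor_closed mult_word_prepend assms) auto

text \<open>Only the last letter of the left word is comultiplied; all earlier letters are carried
  along unchanged.\<close>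

lemma Khat_mult_pure_Cons:
  assumes "x \<in> carrier H" "xs \<in> words H (Suc n)" "ys \<in> words H (Suc m)"
  shows "Khat_mult_pure K H (Suc n) m (x # xs) ys = tensor_cons (Suc (n + m)) x (Khat_mult_pure K H n m xs ys)"
proof -
  have c: "iter_comult K H (2 * m) (xs ! n) \<in> carrier (T (Suc (2 * m)))"
    by (intro iter_comult_closed nth_words[OF assms(2)]) simp
  note w = mult_word_prepend[OF assms(2,3)]
  have "tensor_cons (Suc (n + m)) x (Khat_mult_pure K H n m xs ys) =
      tensor_lift K (T (Suc (Suc (n + m)))) (\<lambda>zs. tensor_cons (Suc (n + m)) x (tensor K H (take n xs @ mult_word m ys zs)))
        (iter_comult K H (2 * m) (xs ! n))"
    unfolding Khat_mult_pure_eq by (rule tensor_cons_tensor_lift[OF assms(1) c tensor_closed[OF w]])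
  also have "\<dots> = Khat_mult_pure K H (Suc n) m (x # xs) ys"
    unfolding Khat_mult_pure_eq by (simp, rule tensor_lift_cong[OF c]) (simp add: tensor_cons_tensor[OF assms(1) w])
  finally show ?thesis ..
qed

lemma Khat_mult_pure_single_single:
  assumes "x \<in> carrier H" "y \<in> carrier H"
  shows "Khat_mult_pure K H 0 0 [x] [y] = tensor K H [x \<otimes> y]"
proof -
  have "multilinear K H (Suc 0) (T (Suc 0)) (\<lambda>zs. tensor K H (mult_word 0 [y] zs))"
    using multilinear_mult_word[of "[y]" 0] assms by simp
  from tensor_lift_pure[OF module_T this, of "[x]"] assms show ?thesis
    by (simp add: Khat_mult_pure_eq mult_word_def)
qed

text \<open>Of the 2m + 3 legs of \<open>x\<close> the outer two enclose \<open>y\<close>; the inner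
  2m + 1 come from the middle leg and make up its product with \<open>ys\<close>.\<close>

lemma Khat_mult_pure_single_Cons:
  assumes x: "x \<in> carrier H" and y: "y \<in> carrier H" and ys: "ys \<in> words H (Suc m)"
  shows "Khat_mult_pure K H 0 (Suc m) [x] (y # ys) = sweedler (T (Suc (Suc m))) (\<lambda>e c.
    sweedler (T (Suc (Suc m))) (\<lambda>a b. tensor_cons (Suc m) (a \<otimes> y \<otimes> S c) (Khat_mult_pure K H 0 m [b] ys)) e) x"
proof -
  have m: "multilinear K H (Suc (Suc (Suc (2 * m)))) (T (Suc (Suc m))) (\<lambda>zs. tensor K H (mult_word (Suc m) (y # ys) zs))"
    using multilinear_mult_word[of "y # ys" "Suc m"] y ys by simp
  have "Khat_mult_pure K H 0 (Suc m) [x] (y # ys) =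
      tensor_lift K (T (Suc (Suc m))) (\<lambda>zs. tensor K H (mult_word (Suc m) (y # ys) zs)) (iter_comult K H (Suc (Suc (2 * m))) x)"
    by (simp add: Khat_mult_pure_eq del: iter_comult.simps)
  also have "\<dots> = sweedler (T (Suc (Suc m))) (\<lambda>e c. sweedler (T (Suc (Suc m))) (\<lambda>a b.
      tensor_lift K (T (Suc (Suc m))) (\<lambda>zs. tensor K H (mult_word (Suc m) (y # ys) (a # zs @ [c]))) (iter_comult K H (2 * m) b)) e) x"
    by (rule iter_comult_both_ends[OF module_T m x])
  also have "\<dots> = sweedler (T (Suc (Suc m))) (\<lambda>e c. sweedler (T (Suc (Suc m))) (\<lambda>a b.
      tensor_cons (Suc m) (a \<otimes> y \<otimes> S c) (Khat_mult_pure K H 0 m [b] ys)) e) x"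
  proof (intro sweedler_cong x)
    fix a b c assume abc: "a \<in> carrier H" "b \<in> carrier H" "c \<in> carrier H"
    have h: "a \<otimes> y \<otimes> S c \<in> carrier H" by (intro closed_rules abc y)
    note c = iter_comult_closed[OF abc(2), of "2 * m"]
    have "tensor_lift K (T (Suc (Suc m))) (\<lambda>zs. tensor K H (mult_word (Suc m) (y # ys) (a # zs @ [c]))) (iter_comult K H (2 * m) b) =
        tensor_lift K (T (Suc (Suc m))) (\<lambda>zs. tensor_cons (Suc m) (a \<otimes> y \<otimes> S c) (tensor K H (mult_word m ys zs))) (iter_comult K H (2 * m) b)"
      by (rule tensor_lift_cong[OF c tensor_mult_word_Suc[OF y ys abc(1,3)]])
    also have "\<dots> = tensor_cons (Suc m) (a \<otimes> y \<otimes> S c) (Khat_mult_pure K H 0 m [b] ys)"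
      by (simp add: Khat_mult_pure_eq tensor_cons_tensor_lift[OF h c tensor_closed[OF mult_word_in_words[OF ys]]])
    finally show "tensor_lift K (T (Suc (Suc m))) (\<lambda>zs. tensor K H (mult_word (Suc m) (y # ys) (a # zs @ [c]))) (iter_comult K H (2 * m) b) =
        tensor_cons (Suc m) (a \<otimes> y \<otimes> S c) (Khat_mult_pure K H 0 m [b] ys)" .
  qed
  finally show ?thesis .
qed

lemma Khat_mult_pure_single_hom:
  assumes "ys \<in> words H (Suc m)"
  shows "(\<lambda>x. Khat_mult_pure K H 0 m [x] ys) \<in> module_hom K H (T (Suc m))"
  using tensor_lift_iter_comult_hom[OF module_T multilinear_mult_word[OF assms] module_hom_id]
  by (simp add: Khat_mult_pure_eq)

lemma multilinear_Khat_mult_pure_left: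
  "ys \<in> words H (Suc m) \<Longrightarrow> multilinear K H (Suc n) (T (Suc (n + m))) (\<lambda>xs. Khat_mult_pure K H n m xs ys)"
proof (induct n)
  case 0
  thus ?case using Khat_mult_pure_single_hom Khat_mult_pure_closed[of "[_]" 0 ys m]
    by (auto intro!: multilinear_SucI multilinear_0)
next
  case (Suc n)
  note eq = Khat_mult_pure_Cons[OF _ _ Suc(2)]
  show ?case unfolding add_Suc
  proof (rule multilinear_SucI)
    fix xs assume xs: "xs \<in> words H (Suc n)"
    show "(\<lambda>x. Khat_mult_pure K H (Suc n) m (x # xs) ys) \<in> module_hom K H (T (Suc (Suc (n + m))))"
      by (rule module_hom_cong[OF module_M eq[symmetric]])
        (auto intro!: tensor_cons_hom_left Khat_mult_pure_closed xs Suc(2))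
  next
    fix x assume x: "x \<in> carrier H"
    show "multilinear K H (Suc n) (T (Suc (Suc (n + m)))) (\<lambda>xs. Khat_mult_pure K H (Suc n) m (x # xs) ys)"
      by (rule multilinear_cong[OF module_hom_multilinear[OF tensor_cons_hom_right[OF x] Suc(1)[OF Suc(2)]] eq[OF x]])
  qed
qed

lemma multilinear_Khat_mult_pure_single:
  "x \<in> carrier H \<Longrightarrow> multilinear K H (Suc m) (T (Suc m)) (Khat_mult_pure K H 0 m [x])"
proof (induct m arbitrary: x)
  case 0
  have "(\<lambda>y. Khat_mult_pure K H 0 0 [x] [y]) \<in> module_hom K H (T (Suc 0))"
    by (rule module_hom_cong[OF module_M Khat_mult_pure_single_single[OF 0, symmetric]])
      (auto intro!: tensor_single_hom hom_rules 0)
  thus ?case using 0 Khat_mult_pure_closed[of "[x]" 0 "[_]" 0]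
    by (auto intro!: multilinear_SucI multilinear_0)
next
  case (Suc m)
  note eq = Khat_mult_pure_single_Cons[OF Suc(2)]
  show ?case
  proof (rule multilinear_SucI)
    fix ys assume ys: "ys \<in> words H (Suc m)"
    show "(\<lambda>y. Khat_mult_pure K H 0 (Suc m) [x] (y # ys)) \<in> module_hom K H (T (Suc (Suc m)))"
      by (rule module_hom_cong[OF module_M eq[OF _ ys, symmetric]])
        (use Khat_mult_pure_closed[of "[_]" 0 ys m] ys Suc(2) in \<open>auto intro!: hom_rules closed_rules\<close>)
  next
    fix y assume y: "y \<in> carrier H"
    show "multilinear K H (Suc m) (T (Suc (Suc m))) (\<lambda>ys. Khat_mult_pure K H 0 (Suc m) [x] (y # ys))"
      by (rule multilinear_cong[OF _ eq[OF y]])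
        (auto intro!: multilinear_sweedler module_T Suc y closed_rules module_hom_multilinear[OF tensor_cons_hom_right])
  qed
qed

lemma multilinear_Khat_mult_pure_right:
  "xs \<in> words H (Suc n) \<Longrightarrow> multilinear K H (Suc m) (T (Suc (n + m))) (Khat_mult_pure K H n m xs)"
proof (induct n arbitrary: xs)
  case 0
  thus ?case using multilinear_Khat_mult_pure_single by (auto elim!: words_SucE)
next
  case (Suc n)
  from Suc(2) obtain x xs' where x: "xs = x # xs'" "x \<in> carrier H" "xs' \<in> words H (Suc n)" by (rule words_SucE)
  show ?case unfolding x(1) add_Suc
    by (rule multilinear_cong[OF module_hom_multilinear[OF tensor_cons_hom_right[OF x(2)] Suc(1)[OF x(3)]]
        Khat_mult_pure_Cons[OF x(2,3)]])
qed

section \<open>The product of arbitrary elements\<close>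

abbreviation mul where "mul \<equiv> Khat_mult K H"

lemma mul_eq: "mul n m X Y = tensor_lift K (T (Suc (n + m))) (\<lambda>xs. tensor_lift K (T (Suc (n + m))) (Khat_mult_pure K H n m xs) Y) X"
  by (simp add: Khat_mult_def Khat_eq)

lemma mul_hom_right:
  assumes "X \<in> carrier (T (Suc n))"
  shows "mul n m X \<in> module_hom K (T (Suc m)) (T (Suc (n + m)))"
  unfolding mul_eq
  by (intro tensor_lift_linear[OF module_T assms] tensor_lift_hom module_T multilinear_Khat_mult_pure_right)

lemma mul_hom_left:
  assumes "Y \<in> carrier (T (Suc m))"
  shows "(\<lambda>X. mul n m X Y) \<in> module_hom K (T (Suc n)) (T (Suc (n + m)))"
  unfolding mul_eq
  by (intro tensor_lift_hom module_T multilinear_lift_inner[OF module_T assms] multilinear_Khat_mult_pure_left)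

lemma mul_closed: "X \<in> carrier (T (Suc n)) \<Longrightarrow> Y \<in> carrier (T (Suc m)) \<Longrightarrow> mul n m X Y \<in> carrier (T (Suc (n + m)))"
  by (rule module_hom_simps(1)[OF mul_hom_right])

lemma mul_tensor:
  assumes "xs \<in> words H (Suc n)" "ys \<in> words H (Suc m)"
  shows "mul n m (tensor K H xs) (tensor K H ys) = Khat_mult_pure K H n m xs ys"
proof -
  have "multilinear K H (Suc n) (T (Suc (n + m))) (\<lambda>xs. tensor_lift K (T (Suc (n + m))) (Khat_mult_pure K H n m xs) (tensor K H ys))"
    by (intro module_T multilinear_lift_inner[OF module_T tensor_closed[OF assms(2)]] multilinear_Khat_mult_pure_left)
  from tensor_lift_pure[OF module_T this assms(1)]
    tensor_lift_pure[OF module_T multilinear_Khat_mult_pure_right[OF assms(1)] assms(2)]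
  show ?thesis by (simp add: mul_eq)
qed

lemma mul_hom_right': "g \<in> module_hom K N (T (Suc m)) \<Longrightarrow> X \<in> carrier (T (Suc n)) \<Longrightarrow> (\<lambda>u. mul n m X (g u)) \<in> module_hom K N (T (Suc (n + m)))"
  by (rule module_hom_comp[OF mul_hom_right])

lemma mul_hom_left': "g \<in> module_hom K N (T (Suc n)) \<Longrightarrow> Y \<in> carrier (T (Suc m)) \<Longrightarrow> (\<lambda>u. mul n m (g u) Y) \<in> module_hom K N (T (Suc (n + m)))"
  by (rule module_hom_comp[OF mul_hom_left])

text \<open>Both sides are linear in \<open>X\<close> and in \<open>Y\<close>, so two successive
  tests on pure tensors suffice.\<close>

lemma mul_cons:
  assumes "x \<in> carrier H" "X \<in> carrier (T (Suc n))" "Y \<in> carrier (T (Suc m))"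
  shows "mul (Suc n) m (tensor_cons (Suc n) x X) Y = tensor_cons (Suc (n + m)) x (mul n m X Y)"
proof (rule tensor_power_hom_eqI[OF module_T _ _ _ assms(2)])
  show "(\<lambda>X. mul (Suc n) m (tensor_cons (Suc n) x X) Y) \<in> module_hom K (T (Suc n)) (T (Suc (Suc (n + m))))"
    using mul_hom_left'[OF tensor_cons_hom_right[OF assms(1)] assms(3), where n = "Suc n"] by simp
  show "(\<lambda>X. tensor_cons (Suc (n + m)) x (mul n m X Y)) \<in> module_hom K (T (Suc n)) (T (Suc (Suc (n + m))))"
    by (intro tensor_cons_hom_right' mul_hom_left assms)
  fix xs assume xs: "xs \<in> words H (Suc n)"
  note c = tensor_closed[OF xs]
  show "mul (Suc n) m (tensor_cons (Suc n) x (tensor K H xs)) Y = tensor_cons (Suc (n + m)) x (mul n m (tensor K H xs) Y)"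
  proof (rule tensor_power_hom_eqI[OF module_T _ _ _ assms(3)])
    show "mul (Suc n) m (tensor_cons (Suc n) x (tensor K H xs)) \<in> module_hom K (T (Suc m)) (T (Suc (Suc (n + m))))"
      using mul_hom_right[OF tensor_cons_closed[OF assms(1) c]] by simp
    show "(\<lambda>Y. tensor_cons (Suc (n + m)) x (mul n m (tensor K H xs) Y)) \<in> module_hom K (T (Suc m)) (T (Suc (Suc (n + m))))"
      by (intro tensor_cons_hom_right' mul_hom_right c assms)
  qed (use xs assms(1) in \<open>simp add: tensor_cons_tensor mul_tensor Khat_mult_pure_Cons\<close>)
qed

lemma mul_single_single:
  "x \<in> carrier H \<Longrightarrow> y \<in> carrier H \<Longrightarrow> mul 0 0 (tensor K H [x]) (tensor K H [y]) = tensor K H [x \<otimes> y]"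
  by (simp add: mul_tensor Khat_mult_pure_single_single)

section \<open>The action of H in each degree\<close>

definition act
  where "act m x Y = mul 0 m (tensor K H [x]) Y"

lemma tensor_single_closed: "x \<in> carrier H \<Longrightarrow> tensor K H [x] \<in> carrier (T (Suc 0))"
  by (rule tensor_closed) simp

lemma act_closed: "x \<in> carrier H \<Longrightarrow> Y \<in> carrier (T (Suc m)) \<Longrightarrow> act m x Y \<in> carrier (T (Suc m))"
  using mul_closed[OF tensor_single_closed] by (simp add: act_def)

lemma act_hom_right: "g \<in> module_hom K N (T (Suc m)) \<Longrightarrow> x \<in> carrier H \<Longrightarrow> (\<lambda>u. act m x (g u)) \<in> module_hom K N (T (Suc m))"
  using mul_hom_right'[OF _ tensor_single_closed] by (simp add: act_def)

lemma act_hom_left: "g \<in> module_hom K N H \<Longrightarrow> Y \<in> carrier (T (Suc m)) \<Longrightarrow> (\<lambda>u. act m (g u) Y) \<in> module_hom K N (T (Suc m))"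
  using mul_hom_left'[OF tensor_single_hom] by (simp add: act_def)

lemma act_single: "x \<in> carrier H \<Longrightarrow> y \<in> carrier H \<Longrightarrow> act 0 x (tensor K H [y]) = tensor K H [x \<otimes> y]"
  by (simp add: act_def mul_single_single)

text \<open>In the algebraic arguments that follow, this recursion with three legs stands in for the
  formula with 2m + 1 legs.\<close>

lemma act_cons:
  assumes "x \<in> carrier H" "y \<in> carrier H" "Y \<in> carrier (T (Suc m))"
  shows "act (Suc m) x (tensor_cons (Suc m) y Y) = sweedler (T (Suc (Suc m))) (\<lambda>e c.
    sweedler (T (Suc (Suc m))) (\<lambda>a b. tensor_cons (Suc m) (a \<otimes> y \<otimes> S c) (act m b Y)) e) x"
proof (rule tensor_power_hom_eqI[OF module_T _ _ _ assms(3)])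
  show "(\<lambda>Y. act (Suc m) x (tensor_cons (Suc m) y Y)) \<in> module_hom K (T (Suc m)) (T (Suc (Suc m)))"
    by (intro act_hom_right tensor_cons_hom_right assms)
  show "(\<lambda>Y. sweedler (T (Suc (Suc m))) (\<lambda>e c.
    sweedler (T (Suc (Suc m))) (\<lambda>a b. tensor_cons (Suc m) (a \<otimes> y \<otimes> S c) (act m b Y)) e) x) \<in> module_hom K (T (Suc m)) (T (Suc (Suc m)))"
    by (intro hom_rules act_hom_right closed_rules assms)
  fix ys assume ys: "ys \<in> words H (Suc m)"
  show "act (Suc m) x (tensor_cons (Suc m) y (tensor K H ys)) = sweedler (T (Suc (Suc m))) (\<lambda>e c.
    sweedler (T (Suc (Suc m))) (\<lambda>a b. tensor_cons (Suc m) (a \<otimes> y \<otimes> S c) (act m b (tensor K H ys))) e) x"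
    using assms ys by (simp add: act_def tensor_cons_tensor mul_tensor Khat_mult_pure_single_Cons cong: sweedler_cong)
qed

subsection \<open>Associativity\<close>

lemmas hom_all = hom_rules act_hom_right act_hom_left
lemmas closed_all = closed_rules act_closed module_T

text \<open>As \<open>\<Delta> 1 = 1 \<otimes> 1\<close> and \<open>S(1) = 1\<close>, both Sweedler
  sums reduce to a single term and the head is left as it is.\<close>

lemma act_one: "Y \<in> carrier (T (Suc m)) \<Longrightarrow> act m \<one> Y = Y"
proof (induct m arbitrary: Y)
  case 0
  show ?case
    by (rule tensor_power_1_hom_eqI[OF module_T act_hom_right[OF module_hom_id one_closed] module_hom_id _ 0])
      (simp add: act_single)
next
  case (Suc m)
  show ?case
  proof (rule tensor_power_Suc_hom_eqI[OF module_T act_hom_right[OF module_hom_id one_closed] module_hom_id _ Suc(2)])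
    fix y Y assume y: "y \<in> carrier H" "Y \<in> carrier (T (Suc m))"
    have "act (Suc m) \<one> (tensor_cons (Suc m) y Y) = sweedler (T (Suc (Suc m))) (\<lambda>e c.
        sweedler (T (Suc (Suc m))) (\<lambda>a b. tensor_cons (Suc m) (a \<otimes> y \<otimes> S c) (act m b Y)) e) \<one>"
      using y by (simp add: act_cons)
    also have "\<dots> = sweedler (T (Suc (Suc m))) (\<lambda>a b. tensor_cons (Suc m) (a \<otimes> y \<otimes> S \<one>) (act m b Y)) \<one>"
      using y by (intro sweedler_one module_T) (auto intro!: hom_all closed_all)
    also have "\<dots> = tensor_cons (Suc m) (\<one> \<otimes> y \<otimes> S \<one>) (act m \<one> Y)"
      using y by (intro sweedler_one module_T) (auto intro!: hom_all closed_all)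
    finally show "act (Suc m) \<one> (tensor_cons (Suc m) y Y) = tensor_cons (Suc m) y Y"
      using y Suc(1) by (simp add: antipode_one)
  qed
qed

text \<open>The heads match through \<open>a a' y S(c') S(c) = (a a') y S(c c')\<close>, the middle
  legs by the induction hypothesis, and multiplicativity of \<Delta> joins the legs of the two
  elements.\<close>

lemma act_mult:
  "x \<in> carrier H \<Longrightarrow> x' \<in> carrier H \<Longrightarrow> Y \<in> carrier (T (Suc m)) \<Longrightarrow> act m (x \<otimes> x') Y = act m x (act m x' Y)"
proof (induct m arbitrary: x x' Y)
  case 0
  show ?case
    by (rule tensor_power_1_hom_eqI[OF module_T _ _ _ 0(3)])
      (use 0 in \<open>auto intro!: hom_all closed_all simp: act_single m_assoc\<close>)
next
  case (Suc m)
  show ?case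
  proof (rule tensor_power_Suc_hom_eqI[OF module_T _ _ _ Suc(4)])
    show "act (Suc m) (x \<otimes> x') \<in> module_hom K (T (Suc (Suc m))) (T (Suc (Suc m)))"
      using Suc(2,3) by (intro act_hom_right[OF module_hom_id]) simp
    show "(\<lambda>Y. act (Suc m) x (act (Suc m) x' Y)) \<in> module_hom K (T (Suc (Suc m))) (T (Suc (Suc m)))"
      using Suc(2,3) by (intro act_hom_right module_hom_id)
    fix y Y assume y: "y \<in> carrier H" "Y \<in> carrier (T (Suc m))"
    let ?N = "T (Suc (Suc m))"
    let ?F = "\<lambda>a b c. tensor_cons (Suc m) (a \<otimes> y \<otimes> S c) (act m b Y)"
    have "act (Suc m) x (act (Suc m) x' (tensor_cons (Suc m) y Y)) =
        act (Suc m) x (sweedler ?N (\<lambda>e' c'. sweedler ?N (\<lambda>a' b'. ?F a' b' c') e') x')"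
      using Suc(2,3) y by (simp add: act_cons)
    also have "\<dots> = sweedler ?N (\<lambda>e' c'. sweedler ?N (\<lambda>a' b'. act (Suc m) x (?F a' b' c')) e') x'"
      using Suc(2,3) y by (intro module_hom_sweedler2[OF module_T module_T]) (auto intro!: act_hom_right[OF module_hom_id] closed_all)
    also have "\<dots> = sweedler ?N (\<lambda>e' c'. sweedler ?N (\<lambda>a' b'. sweedler ?N (\<lambda>e c. sweedler ?N (\<lambda>a b.
        ?F (a \<otimes> a') (b \<otimes> b') (c \<otimes> c')) e) x) e') x'"
      using Suc y by (intro sweedler_cong)
        (auto simp: act_cons antipode_closed act_closed antipode_mult m_assoc intro!: sweedler_cong)
    \<comment> \<open>Three swaps put the sums for \<open>x\<close> and \<open>x'\<close> next to
      each other at both levels, ready to be merged by \<open>sweedler_mult\<close>.\<close>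
    also have "\<dots> = sweedler ?N (\<lambda>e' c'. sweedler ?N (\<lambda>e c. sweedler ?N (\<lambda>a' b'. sweedler ?N (\<lambda>a b.
        ?F (a \<otimes> a') (b \<otimes> b') (c \<otimes> c')) e) e') x) x'"
      using Suc y by (intro sweedler_cong sweedler_swap[OF module_T]) (auto intro!: closed_all)
    also have "\<dots> = sweedler ?N (\<lambda>e c. sweedler ?N (\<lambda>e' c'. sweedler ?N (\<lambda>a' b'. sweedler ?N (\<lambda>a b.
        ?F (a \<otimes> a') (b \<otimes> b') (c \<otimes> c')) e) e') x') x"
      using Suc y by (intro sweedler_swap[OF module_T]) (auto intro!: closed_all)
    also have "\<dots> = sweedler ?N (\<lambda>e c. sweedler ?N (\<lambda>e' c'. sweedler ?N (\<lambda>a b. sweedler ?N (\<lambda>a' b'.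
        ?F (a \<otimes> a') (b \<otimes> b') (c \<otimes> c')) e') e) x') x"
      using Suc y by (intro sweedler_cong sweedler_swap[OF module_T]) (auto intro!: closed_all)
    also have "\<dots> = sweedler ?N (\<lambda>e c. sweedler ?N (\<lambda>e' c'. sweedler ?N (\<lambda>a b. ?F a b (c \<otimes> c')) (e \<otimes> e')) x') x"
      using Suc y by (intro sweedler_cong sweedler_mult[OF module_T, symmetric]) (auto intro!: hom_all closed_all)
    also have "\<dots> = sweedler ?N (\<lambda>e c. sweedler ?N (\<lambda>a b. ?F a b c) e) (x \<otimes> x')"
      using Suc y by (intro sweedler_mult[OF module_T, symmetric]) (auto intro!: hom_all closed_all)
    also have "\<dots> = act (Suc m) (x \<otimes> x') (tensor_cons (Suc m) y Y)"
      using Suc(2,3) y by (simp add: act_cons)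
    finally show "act (Suc m) (x \<otimes> x') (tensor_cons (Suc m) y Y) = act (Suc m) x (act (Suc m) x' (tensor_cons (Suc m) y Y))" ..
  qed
qed

text \<open>Acting alters the head and hands the middle leg to the tail, while multiplication by
  \<open>Z\<close> from the right passes the head by; so the tail falls under the induction
  hypothesis. The base case is \<open>act_mult\<close>.\<close>

lemma act_mul:
  assumes "Z \<in> carrier (T (Suc l))"
  shows "x \<in> carrier H \<Longrightarrow> Y \<in> carrier (T (Suc m)) \<Longrightarrow> mul m l (act m x Y) Z = act (m + l) x (mul m l Y Z)"
proof (induct m arbitrary: x Y)
  case 0
  show ?case
  proof (rule tensor_power_1_hom_eqI[OF module_T _ _ _ 0(2)])
    show "(\<lambda>Y. mul 0 l (act 0 x Y) Z) \<in> module_hom K (T (Suc 0)) (T (Suc (0 + l)))"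
      by (intro mul_hom_left' act_hom_right module_hom_id 0 assms)
    show "(\<lambda>Y. act (0 + l) x (mul 0 l Y Z)) \<in> module_hom K (T (Suc 0)) (T (Suc (0 + l)))"
      by (intro act_hom_right mul_hom_left 0 assms)
    fix y assume "y \<in> carrier H"
    thus "mul 0 l (act 0 x (tensor K H [y])) Z = act (0 + l) x (mul 0 l (tensor K H [y]) Z)"
      using act_mult[OF 0(1) _ assms] 0 by (simp add: act_single, simp add: act_def)
  qed
next
  case (Suc m)
  show ?case
  proof (rule tensor_power_Suc_hom_eqI[OF module_T _ _ _ Suc(3)])
    show "(\<lambda>Y. mul (Suc m) l (act (Suc m) x Y) Z) \<in> module_hom K (T (Suc (Suc m))) (T (Suc (Suc m + l)))"
      by (intro mul_hom_left' act_hom_right module_hom_id Suc assms)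
    show "(\<lambda>Y. act (Suc m + l) x (mul (Suc m) l Y Z)) \<in> module_hom K (T (Suc (Suc m))) (T (Suc (Suc m + l)))"
      by (intro act_hom_right mul_hom_left Suc assms)
    fix y Y assume y: "y \<in> carrier H" "Y \<in> carrier (T (Suc m))"
    let ?N = "T (Suc (Suc m))" and ?N' = "T (Suc (Suc m + l))"
    have "mul (Suc m) l (act (Suc m) x (tensor_cons (Suc m) y Y)) Z =
        mul (Suc m) l (sweedler ?N (\<lambda>e c. sweedler ?N (\<lambda>a b. tensor_cons (Suc m) (a \<otimes> y \<otimes> S c) (act m b Y)) e) x) Z"
      using Suc y by (simp add: act_cons)
    also have "\<dots> = sweedler ?N' (\<lambda>e c. sweedler ?N' (\<lambda>a b. mul (Suc m) l (tensor_cons (Suc m) (a \<otimes> y \<otimes> S c) (act m b Y)) Z) e) x"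
      using Suc(2) y by (intro module_hom_sweedler2[OF module_T module_T mul_hom_left[OF assms]]) (auto intro!: closed_all)
    also have "\<dots> = sweedler ?N' (\<lambda>e c. sweedler ?N' (\<lambda>a b. tensor_cons (Suc (m + l)) (a \<otimes> y \<otimes> S c) (act (m + l) b (mul m l Y Z))) e) x"
      using Suc y assms by (intro sweedler_cong) (auto simp: mul_cons antipode_closed act_closed)
    also have "\<dots> = act (Suc m + l) x (mul (Suc m) l (tensor_cons (Suc m) y Y) Z)"
      using Suc y assms by (simp add: act_cons mul_cons mul_closed)
    finally show "mul (Suc m) l (act (Suc m) x (tensor_cons (Suc m) y Y)) Z = act (Suc m + l) x (mul (Suc m) l (tensor_cons (Suc m) y Y) Z)" .
  qed
qed

text \<open>Letters in front of the last one pass outside all products, which reduces the claim to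
  \<open>act_mul\<close>.\<close>

lemma mul_assoc:
  assumes "Y \<in> carrier (T (Suc m))" "Z \<in> carrier (T (Suc l))"
  shows "X \<in> carrier (T (Suc n)) \<Longrightarrow> mul (n + m) l (mul n m X Y) Z = mul n (m + l) X (mul m l Y Z)"
proof (induct n arbitrary: X)
  case 0
  show ?case
    using act_mul[OF assms(2) _ assms(1)] mul_closed[OF assms] assms mul_hom_left'[OF mul_hom_left[OF assms(1), of 0] assms(2)]
    by (intro tensor_power_1_hom_eqI[OF module_T _ mul_hom_left _ 0]) (auto simp: act_def)
next
  case (Suc n)
  show ?case
  proof (rule tensor_power_Suc_hom_eqI[OF module_T _ _ _ Suc(2)])
    show "(\<lambda>X. mul (Suc n + m) l (mul (Suc n) m X Y) Z) \<in> module_hom K (T (Suc (Suc n))) (T (Suc (Suc n + m + l)))"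
      by (intro mul_hom_left' module_hom_id assms)
    show "(\<lambda>X. mul (Suc n) (m + l) X (mul m l Y Z)) \<in> module_hom K (T (Suc (Suc n))) (T (Suc (Suc n + m + l)))"
      unfolding add.assoc by (intro mul_hom_left mul_closed assms)
  qed (use Suc(1) assms in \<open>simp add: mul_cons mul_closed add.assoc\<close>)
qed

section \<open>The unit\<close>

lemma one_mul: "X \<in> carrier (T (Suc n)) \<Longrightarrow> mul 0 n (tensor K H [\<one>]) X = X"
  using act_one by (simp add: act_def)

lemma mul_one: "X \<in> carrier (T (Suc n)) \<Longrightarrow> mul n 0 X (tensor K H [\<one>]) = X"
proof (induct n arbitrary: X)
  case 0
  show ?case
    using mul_hom_left[of "tensor K H [\<one>]" 0 0] tensor_single_closed[of \<one>] 
    by (intro tensor_power_1_hom_eqI[OF module_T _ module_hom_id _ 0]) (auto simp: mul_single_single)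
next
  case (Suc n)
  show ?case
    using mul_hom_left[of "tensor K H [\<one>]" 0 "Suc n"] tensor_single_closed[of \<one>] 
    by (intro tensor_power_Suc_hom_eqI[OF module_T _ module_hom_id _ Suc(2)]) (auto simp: mul_cons Suc(1))
qed

section \<open>The differential\<close>

text \<open>The summand j = 0 of D at \<open>x \<otimes> X\<close>, where \<open>X\<close> has
  \<open>n\<close> factors.\<close>

definition comult_cons
  where "comult_cons n x X = sweedler (T (Suc (Suc n))) (\<lambda>a b. tensor_cons (Suc n) a (tensor_cons n b X)) x"

lemma comult_cons_hom_right:
  "g \<in> module_hom K N (T n) \<Longrightarrow> x \<in> carrier H \<Longrightarrow> (\<lambda>u. comult_cons n x (g u)) \<in> module_hom K N (T (Suc (Suc n)))"
  unfolding comult_cons_def by (intro hom_all)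

lemma comult_cons_closed: "x \<in> carrier H \<Longrightarrow> X \<in> carrier (T n) \<Longrightarrow> comult_cons n x X \<in> carrier (T (Suc (Suc n)))"
  unfolding comult_cons_def by (intro closed_all)

lemma comult_cons_one: "X \<in> carrier (T n) \<Longrightarrow> comult_cons n \<one> X = tensor_cons (Suc n) \<one> (tensor_cons n \<one> X)"
  unfolding comult_cons_def by (intro sweedler_one hom_all closed_all)

section \<open>The operator D\<close>

abbreviation comult_lift where "comult_lift n j \<equiv> tensor_lift K (T (Suc n)) (comult_at K H j)"

lemma comult_lift_hom: "j < n \<Longrightarrow> comult_lift n j \<in> module_hom K (T n) (T (Suc n))"
  by (intro tensor_lift_hom module_T multilinear_comult_at)

lemma comult_lift_tensor: "j < n \<Longrightarrow> xs \<in> words H n \<Longrightarrow> comult_lift n j (tensor K H xs) = comult_at K H j xs"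
  by (intro tensor_lift_pure[where n = n] module_T multilinear_comult_at)

lemma comult_lift_0:
  assumes "x \<in> carrier H" "X \<in> carrier (T n)"
  shows "comult_lift (Suc n) 0 (tensor_cons n x X) = comult_cons n x X"
proof (rule tensor_power_hom_eqI[OF module_T _ comult_cons_hom_right[OF module_hom_id assms(1)] _ assms(2)])
  show "(\<lambda>X. comult_lift (Suc n) 0 (tensor_cons n x X)) \<in> module_hom K (T n) (T (Suc (Suc n)))"
    by (rule module_hom_comp[OF comult_lift_hom tensor_cons_hom_right[OF assms(1)]]) simp
qed (use assms(1) in \<open>simp add: tensor_cons_tensor comult_lift_tensor comult_at_0 comult_cons_def\<close>)

lemma comult_lift_Suc:
  assumes "x \<in> carrier H" "X \<in> carrier (T n)" "j < n"
  shows "comult_lift (Suc n) (Suc j) (tensor_cons n x X) = tensor_cons (Suc n) x (comult_lift n j X)"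
  by (rule tensor_power_hom_eqI[OF module_T _ _ _ assms(2)])
    (use assms(1,3) in \<open>auto intro!: module_hom_comp[OF comult_lift_hom tensor_cons_hom_right]
      tensor_cons_hom_right' comult_lift_hom simp: tensor_cons_tensor comult_lift_tensor comult_at_Suc\<close>)

text \<open>This is D: the differential of the cobar construction on the first n factors, with the
  last of the n + 1 factors as a coefficient that is not comultiplied.\<close>

definition cobar
  where "cobar n X = (\<Oplus>\<^bsub>T (Suc (Suc n))\<^esub>j \<in> {..<n}. sgn j \<odot>\<^bsub>T (Suc (Suc n))\<^esub> comult_lift (Suc n) j X)"

lemma cobar_hom: "cobar n \<in> module_hom K (T (Suc n)) (T (Suc (Suc n)))"
  unfolding cobar_def
  by (intro module_hom_sum module_T module_hom_smult sgn_closed comult_lift_hom) auto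

lemma cobar_hom': "g \<in> module_hom K N (T (Suc n)) \<Longrightarrow> (\<lambda>u. cobar n (g u)) \<in> module_hom K N (T (Suc (Suc n)))"
  by (rule module_hom_comp[OF cobar_hom])

lemma cobar_closed: "X \<in> carrier (T (Suc n)) \<Longrightarrow> cobar n X \<in> carrier (T (Suc (Suc n)))"
  by (rule module_hom_simps(1)[OF cobar_hom])

lemma cobar_0: "cobar 0 X = \<zero>\<^bsub>T (Suc (Suc 0))\<^esub>"
proof -
  interpret V: module K "T (Suc (Suc 0))" by (rule module_T)
  show ?thesis by (simp add: cobar_def)
qed

lemma cobar_cons:
  assumes x: "x \<in> carrier H" and X: "X \<in> carrier (T (Suc n))"
  shows "cobar (Suc n) (tensor_cons (Suc n) x X) =
    comult_cons (Suc n) x X \<ominus>\<^bsub>T (Suc (Suc (Suc n)))\<^esub> tensor_cons (Suc (Suc n)) x (cobar n X)"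
proof -
  let ?V = "T (Suc (Suc (Suc n)))" and ?W = "T (Suc (Suc n))"
  interpret V: module K ?V by (rule module_T)
  interpret W: module K ?W by (rule module_T)
  note h = module_hom_simps[OF tensor_cons_hom_right[OF x, of "Suc (Suc n)"]]
  let ?f = "\<lambda>j. sgn j \<odot>\<^bsub>?V\<^esub> comult_lift (Suc (Suc n)) j (tensor_cons (Suc n) x X)"
  have c: "comult_lift (Suc n) j X \<in> carrier ?W" if "j < n" for j
    using module_hom_simps(1)[OF comult_lift_hom, of j "Suc n" X] that X by simp
  have fc: "?f j \<in> carrier ?V" if "j < Suc n" for j
    using module_hom_simps(1)[OF comult_lift_hom, of j "Suc (Suc n)"] that X x
    by (intro V.smult_closed sgn_closed) (simp add: tensor_cons_closed)
  have fS: "?f (Suc j) = \<ominus>\<^bsub>?V\<^esub> tensor_cons (Suc (Suc n)) x (sgn j \<odot>\<^bsub>?W\<^esub> comult_lift (Suc n) j X)" if "j < n" for j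
    using that c[OF that] x X sgn_closed[of j] by (simp add: comult_lift_Suc sgn_Suc h V.smult_l_minus)
  \<comment> \<open>The summand j = 0 splits the head; the others move down by one place, which
    costs a sign.\<close>
  have "cobar (Suc n) (tensor_cons (Suc n) x X) = (\<Oplus>\<^bsub>?V\<^esub>j \<in> insert 0 (Suc ` {..<n}). ?f j)"
    unfolding cobar_def lessThan_Suc_eq_insert_0 ..
  also have "\<dots> = ?f 0 \<oplus>\<^bsub>?V\<^esub> (\<Oplus>\<^bsub>?V\<^esub>j \<in> Suc ` {..<n}. ?f j)"
    using fc by (intro V.M.finsum_insert) auto
  also have "?f 0 = comult_cons (Suc n) x X"
    using x X comult_cons_closed[OF x X] by (simp add: comult_lift_0 sgn_0)
  also have "(\<Oplus>\<^bsub>?V\<^esub>j \<in> Suc ` {..<n}. ?f j) = (\<Oplus>\<^bsub>?V\<^esub>j \<in> {..<n}. ?f (Suc j))"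
    using fc by (intro V.M.finsum_reindex) auto
  also have "\<dots> = (\<Oplus>\<^bsub>?V\<^esub>j \<in> {..<n}. \<ominus>\<^bsub>?V\<^esub> tensor_cons (Suc (Suc n)) x (sgn j \<odot>\<^bsub>?W\<^esub> comult_lift (Suc n) j X))"
    using fS by (intro finsum_cong_on) simp
  also have "\<dots> = \<ominus>\<^bsub>?V\<^esub> tensor_cons (Suc (Suc n)) x (cobar n X)"
    unfolding cobar_def using c sgn_closed
    by (intro module_hom_finsum[OF module_T module_T module_hom_uminus[OF module_T tensor_cons_hom_right[OF x]], symmetric]) auto
  finally show ?thesis by (simp add: a_minus_def)
qed

text \<open>Both sides equal \<open>x\<^sub>1 y\<^sub>1 S(x\<^sub>5) \<otimes> x\<^sub>2 y\<^sub>2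
  S(x\<^sub>4) \<otimes> x\<^sub>3 Y\<close>: the left by two uses of the recursion for the action,
  the right by comultiplying \<open>x\<^sub>1 y S(x\<^sub>3)\<close>, where S reverses the order of
  the legs.\<close>

lemma act_comult_cons:
  assumes x: "x \<in> carrier H" and y: "y \<in> carrier H" and Y: "Y \<in> carrier (T (Suc m))"
  shows "act (Suc (Suc m)) x (comult_cons (Suc m) y Y) = sweedler (T (Suc (Suc (Suc m)))) (\<lambda>e c.
    sweedler (T (Suc (Suc (Suc m)))) (\<lambda>a b. comult_cons (Suc m) (a \<otimes> y \<otimes> S c) (act m b Y)) e) x"
proof -
  let ?N = "T (Suc (Suc (Suc m)))"
  \<comment> \<open>The five legs in order are \<open>a1\<close>, \<open>a2\<close>,
    \<open>b\<close>, \<open>c1\<close>, \<open>c2\<close>. That \<open>c2\<close> goes with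
    \<open>a1\<close> and \<open>c1\<close> with \<open>a2\<close> is the reversal in
    \<open>sweedler_antipode\<close>.\<close>
  let ?G = "\<lambda>y1 y2 a1 a2 b c1 c2. tensor_cons (Suc (Suc m)) (a1 \<otimes> y1 \<otimes> S c2) (tensor_cons (Suc m) (a2 \<otimes> y2 \<otimes> S c1) (act m b Y))"
  have *: "act (Suc (Suc m)) x (tensor_cons (Suc (Suc m)) y1 (tensor_cons (Suc m) y2 Y)) =
      sweedler ?N (\<lambda>e c. sweedler ?N (\<lambda>a b. sweedler ?N (\<lambda>a1 a2. sweedler ?N (\<lambda>c1 c2. ?G y1 y2 a1 a2 b c1 c2) c) a) e) x"
    if y12: "y1 \<in> carrier H" "y2 \<in> carrier H" for y1 y2
  proof -
    \<comment> \<open>The chain regroups the legs until the middle three belong to one element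
      \<open>v\<close>, whose action on the inner part can then be recognised.\<close>
    have "sweedler ?N (\<lambda>e c. sweedler ?N (\<lambda>a b. sweedler ?N (\<lambda>a1 a2. sweedler ?N (\<lambda>c1 c2. ?G y1 y2 a1 a2 b c1 c2) c) a) e) x =
        sweedler ?N (\<lambda>e c. sweedler ?N (\<lambda>a1 h. sweedler ?N (\<lambda>a2 b. sweedler ?N (\<lambda>c1 c2. ?G y1 y2 a1 a2 b c1 c2) c) h) e) x"
      using x y12 Y by (intro sweedler_cong sweedler_coassoc[OF module_T]) (auto intro!: hom_all closed_all)
    also have "\<dots> = sweedler ?N (\<lambda>e c. sweedler ?N (\<lambda>a1 h. sweedler ?N (\<lambda>c1 c2. sweedler ?N (\<lambda>a2 b. ?G y1 y2 a1 a2 b c1 c2) h) c) e) x"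
      using x y12 Y by (intro sweedler_cong sweedler_swap[OF module_T]) (auto intro!: closed_all)
    also have "\<dots> = sweedler ?N (\<lambda>e c. sweedler ?N (\<lambda>c1 c2. sweedler ?N (\<lambda>a1 h. sweedler ?N (\<lambda>a2 b. ?G y1 y2 a1 a2 b c1 c2) h) e) c) x"
      using x y12 Y by (intro sweedler_cong sweedler_swap[OF module_T]) (auto intro!: closed_all)
    also have "\<dots> = sweedler ?N (\<lambda>w c2. sweedler ?N (\<lambda>e c1. sweedler ?N (\<lambda>a1 h. sweedler ?N (\<lambda>a2 b. ?G y1 y2 a1 a2 b c1 c2) h) e) w) x"
      using x y12 Y by (intro sweedler_coassoc[OF module_T, symmetric]) (auto intro!: hom_all closed_all)
    also have "\<dots> = sweedler ?N (\<lambda>w c2. sweedler ?N (\<lambda>a1 v. sweedler ?N (\<lambda>h c1. sweedler ?N (\<lambda>a2 b. ?G y1 y2 a1 a2 b c1 c2) h) v) w) x"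
      using x y12 Y by (intro sweedler_cong sweedler_coassoc[OF module_T]) (auto intro!: hom_all closed_all)
    also have "\<dots> = sweedler ?N (\<lambda>w c2. sweedler ?N (\<lambda>a1 v. tensor_cons (Suc (Suc m)) (a1 \<otimes> y1 \<otimes> S c2) (act (Suc m) v (tensor_cons (Suc m) y2 Y))) w) x"
    proof (intro sweedler_cong x)
      fix w a1 v c2 assume *: "w \<in> carrier H" "a1 \<in> carrier H" "v \<in> carrier H" "c2 \<in> carrier H"
      show "sweedler ?N (\<lambda>h c1. sweedler ?N (\<lambda>a2 b. ?G y1 y2 a1 a2 b c1 c2) h) v =
          tensor_cons (Suc (Suc m)) (a1 \<otimes> y1 \<otimes> S c2) (act (Suc m) v (tensor_cons (Suc m) y2 Y))"
        unfolding act_cons[OF *(3) y12(2) Y] using * y12 Y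
        by (intro module_hom_sweedler2[OF module_T module_T tensor_cons_hom_right, symmetric]) (auto intro!: closed_all)
    qed
    also have "\<dots> = act (Suc (Suc m)) x (tensor_cons (Suc (Suc m)) y1 (tensor_cons (Suc m) y2 Y))"
      using x y12 Y by (intro act_cons[symmetric]) (auto intro!: closed_all)
    finally show ?thesis ..
  qed
  \<comment> \<open>With the action known on each term of the comultiplication of \<open>y\<close>,
    the sum over \<open>y\<close> is moved inwards to meet the legs of \<open>a\<close> and
    \<open>c\<close>.\<close>
  have "act (Suc (Suc m)) x (comult_cons (Suc m) y Y) =
      sweedler ?N (\<lambda>y1 y2. act (Suc (Suc m)) x (tensor_cons (Suc (Suc m)) y1 (tensor_cons (Suc m) y2 Y))) y"
    unfolding comult_cons_def using x y Y
    by (intro module_hom_sweedler[OF module_T module_T act_hom_right[OF module_hom_id]]) (auto intro!: closed_all)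
  also have "\<dots> = sweedler ?N (\<lambda>y1 y2. sweedler ?N (\<lambda>e c. sweedler ?N (\<lambda>a b. sweedler ?N (\<lambda>a1 a2. sweedler ?N (\<lambda>c1 c2. ?G y1 y2 a1 a2 b c1 c2) c) a) e) x) y"
    using y by (intro sweedler_cong *)
  also have "\<dots> = sweedler ?N (\<lambda>e c. sweedler ?N (\<lambda>y1 y2. sweedler ?N (\<lambda>a b. sweedler ?N (\<lambda>a1 a2. sweedler ?N (\<lambda>c1 c2. ?G y1 y2 a1 a2 b c1 c2) c) a) e) y) x"
    using x y Y by (intro sweedler_swap[OF module_T]) (auto intro!: closed_all)
  also have "\<dots> = sweedler ?N (\<lambda>e c. sweedler ?N (\<lambda>a b. sweedler ?N (\<lambda>y1 y2. sweedler ?N (\<lambda>a1 a2. sweedler ?N (\<lambda>c1 c2. ?G y1 y2 a1 a2 b c1 c2) c) a) y) e) x"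
    using x y Y by (intro sweedler_cong sweedler_swap[OF module_T]) (auto intro!: closed_all)
  also have "\<dots> = sweedler ?N (\<lambda>e c. sweedler ?N (\<lambda>a b. sweedler ?N (\<lambda>a1 a2. sweedler ?N (\<lambda>y1 y2. sweedler ?N (\<lambda>c1 c2. ?G y1 y2 a1 a2 b c1 c2) c) y) a) e) x"
    using x y Y by (intro sweedler_cong sweedler_swap[OF module_T]) (auto intro!: closed_all)
  also have "\<dots> = sweedler ?N (\<lambda>e c. sweedler ?N (\<lambda>a b. comult_cons (Suc m) (a \<otimes> y \<otimes> S c) (act m b Y)) e) x"
  proof (intro sweedler_cong x)
    fix a b c assume abc: "a \<in> carrier H" "b \<in> carrier H" "c \<in> carrier H"
    let ?g = "\<lambda>p q. tensor_cons (Suc (Suc m)) p (tensor_cons (Suc m) q (act m b Y))"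
    have "comult_cons (Suc m) (a \<otimes> y \<otimes> S c) (act m b Y) = sweedler ?N (\<lambda>p q. sweedler ?N (\<lambda>r s. ?g (p \<otimes> r) (q \<otimes> s)) (S c)) (a \<otimes> y)"
      unfolding comult_cons_def using abc y Y by (intro sweedler_mult[OF module_T]) (auto intro!: hom_all closed_all)
    also have "\<dots> = sweedler ?N (\<lambda>a1 a2. sweedler ?N (\<lambda>y1 y2. sweedler ?N (\<lambda>r s. ?g (a1 \<otimes> y1 \<otimes> r) (a2 \<otimes> y2 \<otimes> s)) (S c)) y) a"
      using abc y Y by (intro sweedler_mult[OF module_T]) (auto intro!: hom_all closed_all)
    also have "\<dots> = sweedler ?N (\<lambda>a1 a2. sweedler ?N (\<lambda>y1 y2. sweedler ?N (\<lambda>c1 c2. ?G y1 y2 a1 a2 b c1 c2) c) y) a"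
      using abc y Y by (intro sweedler_cong sweedler_antipode[OF module_T]) (auto intro!: hom_all closed_all)
    finally show "sweedler ?N (\<lambda>a1 a2. sweedler ?N (\<lambda>y1 y2. sweedler ?N (\<lambda>c1 c2. ?G y1 y2 a1 a2 b c1 c2) c) y) a =
      comult_cons (Suc m) (a \<otimes> y \<otimes> S c) (act m b Y)" ..
  qed
  finally show ?thesis .
qed

text \<open>In degree 0 both sides vanish, since D does not touch the last factor. In the step, the
  comultiplied head is settled by \<open>act_comult_cons\<close> and the tail by the induction
  hypothesis.\<close>

lemma cobar_act:
  "x \<in> carrier H \<Longrightarrow> Y \<in> carrier (T (Suc m)) \<Longrightarrow> cobar m (act m x Y) = act (Suc m) x (cobar m Y)"
proof (induct m arbitrary: x Y)
  case 0
  show ?case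
    using module_hom_zero[OF module_T module_T act_hom_right[OF module_hom_id 0(1), of "Suc 0"]] by (simp add: cobar_0)
next
  case (Suc m)
  show ?case
  proof (rule tensor_power_Suc_hom_eqI[OF module_T _ _ _ Suc(3)])
    show "(\<lambda>Y. cobar (Suc m) (act (Suc m) x Y)) \<in> module_hom K (T (Suc (Suc m))) (T (Suc (Suc (Suc m))))"
      by (intro cobar_hom' act_hom_right module_hom_id Suc)
    show "(\<lambda>Y. act (Suc (Suc m)) x (cobar (Suc m) Y)) \<in> module_hom K (T (Suc (Suc m))) (T (Suc (Suc (Suc m))))"
      by (intro cobar_hom act_hom_right Suc)
    fix y Y assume y: "y \<in> carrier H" "Y \<in> carrier (T (Suc m))"
    let ?N = "T (Suc (Suc m))" and ?N' = "T (Suc (Suc (Suc m)))"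
    interpret N': module K ?N' by (rule module_T)
    note cl = closed_all comult_cons_closed cobar_closed N'.minus_closed
    have "cobar (Suc m) (act (Suc m) x (tensor_cons (Suc m) y Y)) =
        cobar (Suc m) (sweedler ?N (\<lambda>e c. sweedler ?N (\<lambda>a b. tensor_cons (Suc m) (a \<otimes> y \<otimes> S c) (act m b Y)) e) x)"
      using Suc(2) y by (simp add: act_cons)
    also have "\<dots> = sweedler ?N' (\<lambda>e c. sweedler ?N' (\<lambda>a b. cobar (Suc m) (tensor_cons (Suc m) (a \<otimes> y \<otimes> S c) (act m b Y))) e) x"
      using Suc(2) y by (intro module_hom_sweedler2[OF module_T module_T cobar_hom]) (auto intro!: cl)
    also have "\<dots> = sweedler ?N' (\<lambda>e c. sweedler ?N' (\<lambda>a b. comult_cons (Suc m) (a \<otimes> y \<otimes> S c) (act m b Y) \<ominus>\<^bsub>?N'\<^esub>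
        tensor_cons (Suc (Suc m)) (a \<otimes> y \<otimes> S c) (act (Suc m) b (cobar m Y))) e) x"
      using Suc y by (intro sweedler_cong) (auto simp: cobar_cons antipode_closed act_closed)
    also have "\<dots> = sweedler ?N' (\<lambda>e c. sweedler ?N' (\<lambda>a b. comult_cons (Suc m) (a \<otimes> y \<otimes> S c) (act m b Y)) e \<ominus>\<^bsub>?N'\<^esub>
        sweedler ?N' (\<lambda>a b. tensor_cons (Suc (Suc m)) (a \<otimes> y \<otimes> S c) (act (Suc m) b (cobar m Y))) e) x"
      using Suc(2) y by (intro sweedler_cong sweedler_diff[OF module_T]) (auto intro!: cl)
    also have "\<dots> = sweedler ?N' (\<lambda>e c. sweedler ?N' (\<lambda>a b. comult_cons (Suc m) (a \<otimes> y \<otimes> S c) (act m b Y)) e) x \<ominus>\<^bsub>?N'\<^esub>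
        sweedler ?N' (\<lambda>e c. sweedler ?N' (\<lambda>a b. tensor_cons (Suc (Suc m)) (a \<otimes> y \<otimes> S c) (act (Suc m) b (cobar m Y))) e) x"
      using Suc(2) y by (intro sweedler_diff[OF module_T]) (auto intro!: cl)
    also have "\<dots> = act (Suc (Suc m)) x (comult_cons (Suc m) y Y) \<ominus>\<^bsub>?N'\<^esub> act (Suc (Suc m)) x (tensor_cons (Suc (Suc m)) y (cobar m Y))"
      using Suc(2) y by (simp add: act_comult_cons act_cons cobar_closed)
    also have "\<dots> = act (Suc (Suc m)) x (cobar (Suc m) (tensor_cons (Suc m) y Y))"
      using Suc(2) y module_hom_minus[OF module_T module_T act_hom_right[OF module_hom_id Suc(2)]]
      by (simp add: cobar_cons cl)
    finally show "cobar (Suc m) (act (Suc m) x (tensor_cons (Suc m) y Y)) = act (Suc (Suc m)) x (cobar (Suc m) (tensor_cons (Suc m) y Y))" .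
  qed
qed

section \<open>The Leibniz rule for D and the square of D\<close>

lemma comult_cons_mul:
  assumes "x \<in> carrier H" "X \<in> carrier (T (Suc n))" "Y \<in> carrier (T (Suc m))"
  shows "mul (Suc (Suc n)) m (comult_cons (Suc n) x X) Y = comult_cons (Suc (n + m)) x (mul n m X Y)"
proof -
  have "mul (Suc (Suc n)) m (comult_cons (Suc n) x X) Y =
      sweedler (T (Suc (Suc (Suc n) + m))) (\<lambda>a b. mul (Suc (Suc n)) m (tensor_cons (Suc (Suc n)) a (tensor_cons (Suc n) b X)) Y) x"
    unfolding comult_cons_def using assms
    by (intro module_hom_sweedler[OF module_T module_T mul_hom_left]) (auto intro!: closed_all)
  also have "\<dots> = comult_cons (Suc (n + m)) x (mul n m X Y)"
    unfolding comult_cons_def using assms by (auto simp: mul_cons tensor_cons_closed intro!: sweedler_cong)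
  finally show ?thesis .
qed

text \<open>For a single letter on the left this is \<open>cobar_act\<close>. Every further letter
  in front contributes one sign through \<open>cobar_cons\<close>, and these add up to the sign of
  the degree.\<close>

lemma cobar_mul:
  assumes Y: "Y \<in> carrier (T (Suc m))"
  shows "X \<in> carrier (T (Suc n)) \<Longrightarrow> cobar (n + m) (mul n m X Y) =
    mul (Suc n) m (cobar n X) Y \<oplus>\<^bsub>T (Suc (Suc (n + m)))\<^esub> sgn n \<odot>\<^bsub>T (Suc (Suc (n + m)))\<^esub> mul n (Suc m) X (cobar m Y)"
proof (induct n arbitrary: X)
  case 0
  let ?V = "T (Suc (Suc m))"
  interpret V: module K ?V by (rule module_T)
  have c: "mul 0 (Suc m) X (cobar m Y) \<in> carrier ?V" using mul_closed[OF 0 cobar_closed[OF Y]] by simp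
  have "cobar m (mul 0 m X Y) = mul 0 (Suc m) X (cobar m Y)"
  proof (rule tensor_power_1_hom_eqI[OF module_T _ _ _ 0])
    show "(\<lambda>X. cobar m (mul 0 m X Y)) \<in> module_hom K (T (Suc 0)) ?V"
      using mul_hom_left[OF Y, of 0] by (intro cobar_hom') simp
    show "(\<lambda>X. mul 0 (Suc m) X (cobar m Y)) \<in> module_hom K (T (Suc 0)) ?V"
      using mul_hom_left[OF cobar_closed[OF Y], of 0] by simp
    show "cobar m (mul 0 m (tensor K H [x]) Y) = mul 0 (Suc m) (tensor K H [x]) (cobar m Y)" if "x \<in> carrier H" for x
      using cobar_act[OF that Y] by (simp add: act_def)
  qed
  \<comment> \<open>D vanishes on degree 0, so the first summand of the rule is a product with
    zero.\<close>
  moreover have "mul (Suc 0) m \<zero>\<^bsub>T (Suc (Suc 0))\<^esub> Y = \<zero>\<^bsub>?V\<^esub>"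
    using module_hom_zero[OF module_T module_T mul_hom_left[OF Y, of "Suc 0"]] by simp
  ultimately show ?case using c by (simp add: cobar_0 sgn_0)
next
  case (Suc n)
  let ?V = "T (Suc (Suc (Suc (n + m))))" and ?W = "T (Suc (Suc (n + m)))"
  interpret V: module K ?V by (rule module_T)
  interpret W: module K ?W by (rule module_T)
  have "cobar (Suc (n + m)) (mul (Suc n) m X Y) =
    mul (Suc (Suc n)) m (cobar (Suc n) X) Y \<oplus>\<^bsub>?V\<^esub> sgn (Suc n) \<odot>\<^bsub>?V\<^esub> mul (Suc n) (Suc m) X (cobar m Y)"
  proof (rule tensor_power_Suc_hom_eqI[OF module_T _ _ _ Suc(2)])
    show "(\<lambda>X. cobar (Suc (n + m)) (mul (Suc n) m X Y)) \<in> module_hom K (T (Suc (Suc n))) ?V"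
      using cobar_hom'[OF mul_hom_left[OF Y, of "Suc n"]] by simp
    show "(\<lambda>X. mul (Suc (Suc n)) m (cobar (Suc n) X) Y \<oplus>\<^bsub>?V\<^esub> sgn (Suc n) \<odot>\<^bsub>?V\<^esub> mul (Suc n) (Suc m) X (cobar m Y)) \<in> module_hom K (T (Suc (Suc n))) ?V"
      using mul_hom_left'[OF cobar_hom Y, of "Suc n"] mul_hom_left[OF cobar_closed[OF Y], of "Suc n"]
      by (intro module_hom_add module_T module_hom_smult sgn_closed) simp_all
    fix x X assume x: "x \<in> carrier H" and X: "X \<in> carrier (T (Suc n))"
    let ?A = "comult_cons (Suc (n + m)) x (mul n m X Y)"
    let ?B = "tensor_cons (Suc (Suc (n + m))) x (mul (Suc n) m (cobar n X) Y)"
    let ?C = "tensor_cons (Suc (Suc (n + m))) x (mul n (Suc m) X (cobar m Y))"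
    note h = module_hom_simps[OF tensor_cons_hom_right[OF x, of "Suc (Suc (n + m))"]]
    have c1: "mul n m X Y \<in> carrier (T (Suc (n + m)))" using X Y by (rule mul_closed)
    have c2: "mul (Suc n) m (cobar n X) Y \<in> carrier ?W" "mul n (Suc m) X (cobar m Y) \<in> carrier ?W"
      using mul_closed[OF cobar_closed[OF X] Y] mul_closed[OF X cobar_closed[OF Y]] by simp_all
    have cl: "?A \<in> carrier ?V" "?B \<in> carrier ?V" "?C \<in> carrier ?V" "sgn n \<odot>\<^bsub>?V\<^esub> ?C \<in> carrier ?V"
      using c1 c2 x sgn_closed by (auto intro: comult_cons_closed tensor_cons_closed)
    have "cobar (Suc (n + m)) (mul (Suc n) m (tensor_cons (Suc n) x X) Y) =
        ?A \<ominus>\<^bsub>?V\<^esub> tensor_cons (Suc (Suc (n + m))) x (cobar (n + m) (mul n m X Y))"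
      using x X Y c1 by (simp add: mul_cons cobar_cons)
    also have "\<dots> = ?A \<ominus>\<^bsub>?V\<^esub> (?B \<oplus>\<^bsub>?V\<^esub> sgn n \<odot>\<^bsub>?V\<^esub> ?C)"
      using c2 sgn_closed[of n] by (simp add: Suc(1)[OF X] h)
    also have "\<dots> = (?A \<ominus>\<^bsub>?V\<^esub> ?B) \<oplus>\<^bsub>?V\<^esub> sgn (Suc n) \<odot>\<^bsub>?V\<^esub> ?C"
      using cl sgn_closed[of n] by (simp add: a_minus_def V.M.minus_add V.M.a_assoc sgn_Suc V.smult_l_minus)
    also have "?A \<ominus>\<^bsub>?V\<^esub> ?B = mul (Suc (Suc n)) m (cobar (Suc n) (tensor_cons (Suc n) x X)) Y"
      using module_hom_minus[OF module_T module_T mul_hom_left[OF Y, of "Suc (Suc n)"]] x X Y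
      by (simp add: cobar_cons comult_cons_mul mul_cons comult_cons_closed tensor_cons_closed cobar_closed)
    also have "?C = mul (Suc n) (Suc m) (tensor_cons (Suc n) x X) (cobar m Y)"
      using x X cobar_closed[OF Y] by (simp add: mul_cons)
    finally show "cobar (Suc (n + m)) (mul (Suc n) m (tensor_cons (Suc n) x X) Y) =
      mul (Suc (Suc n)) m (cobar (Suc n) (tensor_cons (Suc n) x X)) Y \<oplus>\<^bsub>?V\<^esub>
      sgn (Suc n) \<odot>\<^bsub>?V\<^esub> mul (Suc n) (Suc m) (tensor_cons (Suc n) x X) (cobar m Y)" .
  qed
  thus ?case by simp
qed

text \<open>D comultiplies the two legs of \<open>x\<close> with opposite signs, and the results
  cancel by coassociativity. Only D on the tail survives, with two signs that cancel.\<close>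

lemma cobar_comult_cons:
  assumes x: "x \<in> carrier H" and X: "X \<in> carrier (T (Suc n))"
  shows "cobar (Suc (Suc n)) (comult_cons (Suc n) x X) = comult_cons (Suc (Suc n)) x (cobar n X)"
proof -
  let ?V = "T (Suc (Suc (Suc (Suc n))))"
  interpret V: module K ?V by (rule module_T)
  interpret W: module K "T (Suc (Suc (Suc n)))" by (rule module_T)
  let ?c = "\<lambda>a b. tensor_cons (Suc (Suc (Suc n))) a b"
  \<comment> \<open>The three terms come from comultiplying the first leg, from comultiplying the
    second leg, and from D on \<open>X\<close>.\<close>
  let ?f = "\<lambda>a b. comult_cons (Suc (Suc n)) a (tensor_cons (Suc n) b X)"
  let ?g = "\<lambda>a b. ?c a (comult_cons (Suc n) b X)"
  let ?h = "\<lambda>a b. ?c a (tensor_cons (Suc (Suc n)) b (cobar n X))"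
  note cl = closed_all comult_cons_closed cobar_closed V.minus_closed W.minus_closed
  have "cobar (Suc (Suc n)) (comult_cons (Suc n) x X) =
      sweedler ?V (\<lambda>a b. cobar (Suc (Suc n)) (tensor_cons (Suc (Suc n)) a (tensor_cons (Suc n) b X))) x"
    unfolding comult_cons_def using x X
    by (intro module_hom_sweedler[OF module_T module_T cobar_hom]) (auto intro!: closed_all)
  also have "\<dots> = sweedler ?V (\<lambda>a b. ?f a b \<ominus>\<^bsub>?V\<^esub> (?g a b \<ominus>\<^bsub>?V\<^esub> ?h a b)) x"
    using x X by (intro sweedler_cong)
      (simp_all add: cobar_cons module_hom_minus[OF module_T module_T tensor_cons_hom_right] cl)
  also have "\<dots> = sweedler ?V ?f x \<ominus>\<^bsub>?V\<^esub> (sweedler ?V ?g x \<ominus>\<^bsub>?V\<^esub> sweedler ?V ?h x)"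
    using x X by (subst sweedler_diff[OF module_T x], (auto intro!: cl)[2], subst sweedler_diff[OF module_T x]) (auto intro!: cl)
  also have "sweedler ?V ?g x = sweedler ?V (\<lambda>a b. sweedler ?V (\<lambda>c d. ?c a (tensor_cons (Suc (Suc n)) c (tensor_cons (Suc n) d X))) b) x"
    unfolding comult_cons_def using x X
    by (intro sweedler_cong module_hom_sweedler[OF module_T module_T tensor_cons_hom_right]) (auto intro!: cl)
  also have "\<dots> = sweedler ?V ?f x"
    unfolding comult_cons_def using x X
    by (intro sweedler_coassoc[OF module_T, symmetric]) (auto intro!: hom_all cl)
  also have "sweedler ?V ?h x = comult_cons (Suc (Suc n)) x (cobar n X)"
    by (simp add: comult_cons_def)
  finally have "cobar (Suc (Suc n)) (comult_cons (Suc n) x X) = sweedler ?V ?f x \<ominus>\<^bsub>?V\<^esub> (sweedler ?V ?f x \<ominus>\<^bsub>?V\<^esub> comult_cons (Suc (Suc n)) x (cobar n X))" .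
  moreover have "sweedler ?V ?f x \<in> carrier ?V" "comult_cons (Suc (Suc n)) x (cobar n X) \<in> carrier ?V"
    using x X by (auto intro!: cl)
  ultimately show ?thesis by (simp add: a_minus_def V.M.minus_add V.M.r_neg2)
qed

text \<open>At \<open>x \<otimes> X\<close> the two terms of D each yield
  \<open>\<Delta> x \<otimes> D X\<close>, with opposite signs; the remaining term contains
  \<open>D (D X)\<close>, which is zero by induction.\<close>

lemma cobar_D: "X \<in> carrier (T (Suc n)) \<Longrightarrow> cobar (Suc n) (cobar n X) = \<zero>\<^bsub>T (Suc (Suc (Suc n)))\<^esub>"
proof (induct n arbitrary: X)
  case 0
  show ?case using module_hom_zero[OF module_T module_T cobar_hom[of "Suc 0"]] by (simp add: cobar_0)
next
  case (Suc n)
  let ?V = "T (Suc (Suc (Suc (Suc n))))"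
  interpret V: module K ?V by (rule module_T)
  show ?case
  proof (rule tensor_power_Suc_hom_eqI[OF module_T cobar_hom'[OF cobar_hom] module_hom_const_zero[OF module_T] _ Suc(2)])
    fix x X assume x: "x \<in> carrier H" and X: "X \<in> carrier (T (Suc n))"
    have z: "tensor_cons (Suc (Suc (Suc n))) x \<zero>\<^bsub>T (Suc (Suc (Suc n)))\<^esub> = \<zero>\<^bsub>?V\<^esub>"
      by (rule module_hom_zero[OF module_T module_T tensor_cons_hom_right[OF x]])
    have "cobar (Suc (Suc n)) (cobar (Suc n) (tensor_cons (Suc n) x X)) =
        cobar (Suc (Suc n)) (comult_cons (Suc n) x X) \<ominus>\<^bsub>?V\<^esub> cobar (Suc (Suc n)) (tensor_cons (Suc (Suc n)) x (cobar n X))"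
      using x X module_hom_minus[OF module_T module_T cobar_hom]
      by (simp add: cobar_cons comult_cons_closed tensor_cons_closed cobar_closed)
    also have "\<dots> = comult_cons (Suc (Suc n)) x (cobar n X) \<ominus>\<^bsub>?V\<^esub> comult_cons (Suc (Suc n)) x (cobar n X)"
      using x X comult_cons_closed[OF x cobar_closed[OF X]]
      by (simp add: cobar_comult_cons cobar_cons[of _ _ "Suc n"] cobar_closed Suc(1) z a_minus_def V.M.minus_equality[of "\<zero>\<^bsub>?V\<^esub>" "\<zero>\<^bsub>?V\<^esub>"])
    finally show "cobar (Suc (Suc n)) (cobar (Suc n) (tensor_cons (Suc n) x X)) = \<zero>\<^bsub>?V\<^esub>"
      using comult_cons_closed[OF x cobar_closed[OF X]] by (simp add: a_minus_def V.M.r_neg)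
  qed
qed

section \<open>Multiplication by \<omega>\<close>

definition omega where "omega = tensor K H [\<one>, \<one>]"

abbreviation L where "L n \<equiv> tensor_cons (Suc n) \<one>"
abbreviation R where "R n X \<equiv> mul n (Suc 0) X omega"

lemma omega_closed: "omega \<in> carrier (T (Suc (Suc 0)))"
  unfolding omega_def by (rule tensor_closed) simp

lemma omega_eq: "omega = L 0 (tensor K H [\<one>])"
  by (simp add: omega_def tensor_cons_tensor)

lemma L_hom: "L n \<in> module_hom K (T (Suc n)) (T (Suc (Suc n)))"
  by (rule tensor_cons_hom_right) simp

lemma R_hom: "R n \<in> module_hom K (T (Suc n)) (T (Suc (Suc n)))"
  using mul_hom_left[OF omega_closed, of n] by simp

lemmas L_closed = module_hom_simps(1)[OF L_hom] and R_closed = module_hom_simps(1)[OF R_hom]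

text \<open>The second factor of \<omega> acts trivially and the first is prepended. Hence
  \<open>L\<close> is left multiplication by \<omega>.\<close>

lemma omega_mul: "X \<in> carrier (T (Suc n)) \<Longrightarrow> mul (Suc 0) n omega X = L n X"
  using mul_cons[of \<one> "tensor K H [\<one>]" 0 X n] tensor_single_closed[of \<one>] by (simp add: omega_eq one_mul)

lemma L_mul: "X \<in> carrier (T (Suc n)) \<Longrightarrow> Y \<in> carrier (T (Suc m)) \<Longrightarrow> mul (Suc n) m (L n X) Y = L (n + m) (mul n m X Y)"
  by (rule mul_cons) simp_all

lemma mul_R: "X \<in> carrier (T (Suc n)) \<Longrightarrow> Y \<in> carrier (T (Suc m)) \<Longrightarrow> mul n (Suc m) X (R m Y) = R (n + m) (mul n m X Y)"
  using mul_assoc[OF _ omega_closed] by simp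

text \<open>Associativity moves \<omega> from one factor to the other; this is the cross term that
  has to cancel in the Leibniz rule.\<close>

lemma R_mul: "X \<in> carrier (T (Suc n)) \<Longrightarrow> Y \<in> carrier (T (Suc m)) \<Longrightarrow> mul (Suc n) m (R n X) Y = mul n (Suc m) X (L m Y)"
  using mul_assoc[OF omega_closed, of Y m X n] by (simp add: omega_mul)

lemma R_L: "X \<in> carrier (T (Suc n)) \<Longrightarrow> R (Suc n) (L n X) = L (Suc n) (R n X)"
  using L_mul[OF _ omega_closed] by simp

lemma cobar_L: "X \<in> carrier (T (Suc n)) \<Longrightarrow> cobar (Suc n) (L n X) = L (Suc n) (L n X) \<ominus>\<^bsub>T (Suc (Suc (Suc n)))\<^esub> L (Suc n) (cobar n X)"
  by (simp add: cobar_cons comult_cons_one)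

text \<open>The right-hand side is \<open>\<omega>\<^sup>2\<close> by \<open>omega_mul\<close>. As D
  vanishes on the unit, only the first term of \<open>cobar_L\<close> is left.\<close>

lemma cobar_omega: "cobar (Suc 0) omega = L (Suc 0) omega"
proof -
  interpret V: module K "T (Suc (Suc (Suc 0)))" by (rule module_T)
  show ?thesis
    using cobar_L[OF tensor_single_closed[OF one_closed]] L_closed[OF omega_closed]
      module_hom_zero[OF module_T module_T L_hom[of "Suc 0"]]
      V.M.minus_equality[of "\<zero>\<^bsub>T (Suc (Suc (Suc 0)))\<^esub>" "\<zero>\<^bsub>T (Suc (Suc (Suc 0)))\<^esub>"]
    by (simp add: omega_eq[symmetric] cobar_0 a_minus_def)
qed

lemma cobar_R:
  assumes "X \<in> carrier (T (Suc n))"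
  shows "cobar (Suc n) (R n X) = R (Suc n) (cobar n X) \<oplus>\<^bsub>T (Suc (Suc (Suc n)))\<^esub> sgn n \<odot>\<^bsub>T (Suc (Suc (Suc n)))\<^esub> R (Suc n) (R n X)"
  using cobar_mul[OF omega_closed assms] R_mul[OF assms omega_closed] by (simp add: cobar_omega)

text \<open>Given on arbitrary elements as a sum of linear operators; its agreement with the
  differential defined on words is \<open>Khat_diff_eq\<close>.\<close>

definition khat_d
  where "khat_d n X = (\<ominus>\<^bsub>T (Suc (Suc n))\<^esub> L n X) \<oplus>\<^bsub>T (Suc (Suc n))\<^esub> cobar n X \<oplus>\<^bsub>T (Suc (Suc n))\<^esub> sgn n \<odot>\<^bsub>T (Suc (Suc n))\<^esub> R n X"

lemma khat_d_hom: "khat_d n \<in> module_hom K (T (Suc n)) (T (Suc (Suc n)))"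
  unfolding khat_d_def by (intro module_hom_add module_hom_uminus module_hom_smult module_T L_hom R_hom cobar_hom sgn_closed)

text \<open>With \<open>[\<omega>, X]\<close> for the graded commutator, the square of d at X is
  \<open>D (D X) - [D \<omega>, X] + [\<omega>, [\<omega>, X]]\<close>, and the last term is
  \<open>[\<omega>\<^sup>2, X]\<close> because \<omega> has odd degree.\<close>

lemma khat_d_d:
  assumes X: "X \<in> carrier (T (Suc n))"
  shows "khat_d (Suc n) (khat_d n X) = \<zero>\<^bsub>T (Suc (Suc (Suc n)))\<^esub>"
proof -
  let ?V = "T (Suc (Suc (Suc n)))" and ?W = "T (Suc (Suc n))"
  interpret V: module K ?V by (rule module_T)
  interpret W: module K ?W by (rule module_T)
  have c: "L n X \<in> carrier ?W" "cobar n X \<in> carrier ?W" "R n X \<in> carrier ?W" "sgn n \<odot>\<^bsub>?W\<^esub> R n X \<in> carrier ?W"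
    "\<ominus>\<^bsub>?W\<^esub> L n X \<in> carrier ?W"
    using X by (auto intro!: L_closed R_closed cobar_closed sgn_closed)
  have split: "\<phi> (khat_d n X) = (\<ominus>\<^bsub>?V\<^esub> \<phi> (L n X)) \<oplus>\<^bsub>?V\<^esub> \<phi> (cobar n X) \<oplus>\<^bsub>?V\<^esub> sgn n \<odot>\<^bsub>?V\<^esub> \<phi> (R n X)"
    if h: "\<phi> \<in> module_hom K ?W ?V" for \<phi>
  proof -
    note hs = module_hom_simps[OF h]
    have "\<phi> (\<ominus>\<^bsub>?W\<^esub> L n X) = \<ominus>\<^bsub>?V\<^esub> \<phi> (L n X)"
      using module_hom_minus[OF module_T module_T h W.M.zero_closed c(1)] module_hom_zero[OF module_T module_T h] c hs(1)[OF c(1)]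
      by (simp add: a_minus_def)
    thus ?thesis unfolding khat_d_def using c sgn_closed by (simp add: hs)
  qed
  \<comment> \<open>\<open>?P\<close> and \<open>?Q\<close> are the two terms of D at
    \<open>R n X\<close>, multiplied by the sign of \<open>n\<close>; in \<open>?Q\<close> that sign
    has squared to one.\<close>
  let ?A = "L (Suc n) (L n X)" and ?B = "L (Suc n) (cobar n X)" and ?C = "sgn n \<odot>\<^bsub>?V\<^esub> L (Suc n) (R n X)"
    and ?P = "sgn n \<odot>\<^bsub>?V\<^esub> R (Suc n) (cobar n X)" and ?Q = "R (Suc n) (R n X)"
  have cl: "?A \<in> carrier ?V" "?B \<in> carrier ?V" "?C \<in> carrier ?V" "?P \<in> carrier ?V" "?Q \<in> carrier ?V"
    "L (Suc n) (R n X) \<in> carrier ?V" "R (Suc n) (cobar n X) \<in> carrier ?V"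
    using c by (auto intro!: L_closed R_closed sgn_closed)
  have "L (Suc n) (khat_d n X) = (\<ominus>\<^bsub>?V\<^esub> ?A) \<oplus>\<^bsub>?V\<^esub> ?B \<oplus>\<^bsub>?V\<^esub> ?C"
    by (rule split[OF L_hom])
  moreover have "cobar (Suc n) (khat_d n X) = (\<ominus>\<^bsub>?V\<^esub> (?A \<ominus>\<^bsub>?V\<^esub> ?B)) \<oplus>\<^bsub>?V\<^esub> (?P \<oplus>\<^bsub>?V\<^esub> ?Q)"
    using cl sgn_closed[of n] X
    by (simp add: split[OF cobar_hom] cobar_L cobar_R cobar_D V.smult_r_distr V.smult_assoc1[symmetric] sgn_square)
  moreover have "sgn (Suc n) \<odot>\<^bsub>?V\<^esub> R (Suc n) (khat_d n X) = ?C \<ominus>\<^bsub>?V\<^esub> (?P \<oplus>\<^bsub>?V\<^esub> ?Q)"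
    using cl sgn_closed[of n] X
    by (simp add: split[OF R_hom] R_L sgn_Suc V.smult_r_distr V.smult_l_minus V.smult_r_minus V.smult_assoc1[symmetric]
        minus_sgn_mult_sgn a_minus_def V.M.minus_add V.M.a_assoc)
  ultimately have "khat_d (Suc n) (khat_d n X) = (\<ominus>\<^bsub>?V\<^esub> ((\<ominus>\<^bsub>?V\<^esub> ?A) \<oplus>\<^bsub>?V\<^esub> ?B \<oplus>\<^bsub>?V\<^esub> ?C)) \<oplus>\<^bsub>?V\<^esub>
      ((\<ominus>\<^bsub>?V\<^esub> (?A \<ominus>\<^bsub>?V\<^esub> ?B)) \<oplus>\<^bsub>?V\<^esub> (?P \<oplus>\<^bsub>?V\<^esub> ?Q)) \<oplus>\<^bsub>?V\<^esub> (?C \<ominus>\<^bsub>?V\<^esub> (?P \<oplus>\<^bsub>?V\<^esub> ?Q))"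
    by (simp add: khat_d_def[of "Suc n"])
  \<comment> \<open>The sum of \<open>?P\<close> and \<open>?Q\<close> enters as one element
    \<open>p\<close>; then each letter occurs once with either sign.\<close>
  moreover have "(\<ominus>\<^bsub>?V\<^esub> ((\<ominus>\<^bsub>?V\<^esub> a) \<oplus>\<^bsub>?V\<^esub> b \<oplus>\<^bsub>?V\<^esub> c)) \<oplus>\<^bsub>?V\<^esub>
      ((\<ominus>\<^bsub>?V\<^esub> (a \<ominus>\<^bsub>?V\<^esub> b)) \<oplus>\<^bsub>?V\<^esub> p) \<oplus>\<^bsub>?V\<^esub> (c \<ominus>\<^bsub>?V\<^esub> p) = \<zero>\<^bsub>?V\<^esub>"
    if "a \<in> carrier ?V" "b \<in> carrier ?V" "c \<in> carrier ?V" "p \<in> carrier ?V" for a b c p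
  proof -
    have "(\<ominus>\<^bsub>?V\<^esub> ((\<ominus>\<^bsub>?V\<^esub> a) \<oplus>\<^bsub>?V\<^esub> b \<oplus>\<^bsub>?V\<^esub> c)) \<oplus>\<^bsub>?V\<^esub>
      ((\<ominus>\<^bsub>?V\<^esub> (a \<ominus>\<^bsub>?V\<^esub> b)) \<oplus>\<^bsub>?V\<^esub> p) \<oplus>\<^bsub>?V\<^esub> (c \<ominus>\<^bsub>?V\<^esub> p) =
      (a \<oplus>\<^bsub>?V\<^esub> \<ominus>\<^bsub>?V\<^esub> a) \<oplus>\<^bsub>?V\<^esub> (b \<oplus>\<^bsub>?V\<^esub> \<ominus>\<^bsub>?V\<^esub> b) \<oplus>\<^bsub>?V\<^esub> (c \<oplus>\<^bsub>?V\<^esub> \<ominus>\<^bsub>?V\<^esub> c) \<oplus>\<^bsub>?V\<^esub> (p \<oplus>\<^bsub>?V\<^esub> \<ominus>\<^bsub>?V\<^esub> p)"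
      using that by (simp add: a_minus_def V.M.minus_add V.M.a_ac del: V.M.r_neg V.M.l_neg)
    thus ?thesis using that by (simp add: V.M.r_neg)
  qed
  ultimately show ?thesis using cl by simp
qed

text \<open>D obeys the Leibniz rule, and so does a graded commutator: the term \<open>?C\<close>,
  with \<omega> between \<open>X\<close> and \<open>Y\<close>, arises from both factors with
  opposite signs.\<close>

lemma khat_d_mul:
  assumes X: "X \<in> carrier (T (Suc n))" and Y: "Y \<in> carrier (T (Suc m))"
  shows "khat_d (n + m) (mul n m X Y) = mul (Suc n) m (khat_d n X) Y \<oplus>\<^bsub>T (Suc (Suc (n + m)))\<^esub>
    sgn n \<odot>\<^bsub>T (Suc (Suc (n + m)))\<^esub> mul n (Suc m) X (khat_d m Y)"
proof -
  let ?V = "T (Suc (Suc (n + m)))" and ?W = "T (Suc (Suc n))" and ?U = "T (Suc (Suc m))"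
  interpret V: module K ?V by (rule module_T)
  interpret W: module K ?W by (rule module_T)
  interpret U: module K ?U by (rule module_T)
  note XY = mul_closed[OF X Y]
  have hX: "mul n (Suc m) X \<in> module_hom K ?U ?V" using mul_hom_right[OF X, of "Suc m"] by simp
  have hY: "(\<lambda>X. mul (Suc n) m X Y) \<in> module_hom K ?W ?V" using mul_hom_left[OF Y, of "Suc n"] by simp
  have um: "\<phi> (\<ominus>\<^bsub>T i\<^esub> x) = \<ominus>\<^bsub>?V\<^esub> \<phi> x" if h: "\<phi> \<in> module_hom K (T i) ?V" and x: "x \<in> carrier (T i)" for \<phi> i x
  proof -
    interpret I: module K "T i" by (rule module_T)
    show ?thesis
      using module_hom_minus[OF module_T module_T h I.M.zero_closed x] module_hom_zero[OF module_T module_T h] x module_hom_simps(1)[OF h x]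
      by (simp add: a_minus_def)
  qed
  let ?A = "L (n + m) (mul n m X Y)" and ?B = "mul (Suc n) m (cobar n X) Y" and ?C = "sgn n \<odot>\<^bsub>?V\<^esub> mul n (Suc m) X (L m Y)"
    and ?E = "sgn n \<odot>\<^bsub>?V\<^esub> mul n (Suc m) X (cobar m Y)" and ?F = "sgn (n + m) \<odot>\<^bsub>?V\<^esub> R (n + m) (mul n m X Y)"
  have cX: "L n X \<in> carrier ?W" "cobar n X \<in> carrier ?W" "R n X \<in> carrier ?W" and cY: "L m Y \<in> carrier ?U" "cobar m Y \<in> carrier ?U" "R m Y \<in> carrier ?U"
    using X Y by (auto intro!: L_closed R_closed cobar_closed)
  note c = module_hom_simps(1)[OF hX] module_hom_simps(1)[OF hY]
  have cl: "?A \<in> carrier ?V" "?B \<in> carrier ?V" "?C \<in> carrier ?V" "?E \<in> carrier ?V" "?F \<in> carrier ?V" "R (n + m) (mul n m X Y) \<in> carrier ?V"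
    using XY cX cY by (auto intro!: c L_closed R_closed sgn_closed)
  have "mul (Suc n) m (khat_d n X) Y = (\<ominus>\<^bsub>?V\<^esub> ?A) \<oplus>\<^bsub>?V\<^esub> ?B \<oplus>\<^bsub>?V\<^esub> ?C"
    unfolding khat_d_def using cX sgn_closed X Y by (simp add: module_hom_simps[OF hY] um[OF hY] L_mul R_mul)
  moreover have "sgn n \<odot>\<^bsub>?V\<^esub> mul n (Suc m) X (khat_d m Y) = (\<ominus>\<^bsub>?V\<^esub> ?C) \<oplus>\<^bsub>?V\<^esub> ?E \<oplus>\<^bsub>?V\<^esub> ?F"
    unfolding khat_d_def using cY cl sgn_closed X Y c(1)
    by (simp add: module_hom_simps[OF hX] um[OF hX] mul_R V.smult_r_distr V.smult_r_minus sgn_add V.smult_assoc1)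
  moreover have "khat_d (n + m) (mul n m X Y) = (\<ominus>\<^bsub>?V\<^esub> ?A) \<oplus>\<^bsub>?V\<^esub> (?B \<oplus>\<^bsub>?V\<^esub> ?E) \<oplus>\<^bsub>?V\<^esub> ?F"
    using cobar_mul[OF Y X] by (simp add: khat_d_def)
  moreover have "a \<oplus>\<^bsub>?V\<^esub> b \<oplus>\<^bsub>?V\<^esub> c \<oplus>\<^bsub>?V\<^esub> ((\<ominus>\<^bsub>?V\<^esub> c) \<oplus>\<^bsub>?V\<^esub> e \<oplus>\<^bsub>?V\<^esub> f) = a \<oplus>\<^bsub>?V\<^esub> (b \<oplus>\<^bsub>?V\<^esub> e) \<oplus>\<^bsub>?V\<^esub> f"
    if "a \<in> carrier ?V" "b \<in> carrier ?V" "c \<in> carrier ?V" "e \<in> carrier ?V" "f \<in> carrier ?V" for a b c e f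
    using that by (simp add: V.M.a_assoc V.M.r_neg2)
  ultimately show ?thesis using cl by simp
qed

text \<open>For m = 1 and the right word 1, 1 the product formula uses the legs at places 0, 1, 2
  and becomes the last summand of the differential; the other summands match term by term.\<close>

lemma Khat_diff_eq:
  assumes X: "X \<in> carrier (T (Suc n))"
  shows "Khat_diff K H n X = khat_d n X"
proof -
  have "tensor_lift K (T (Suc (Suc n))) (Khat_diff_pure K H n) X = khat_d n X"
  proof (rule tensor_lift_eq_hom[OF module_T khat_d_hom _ X])
    fix xs assume xs: "xs \<in> words H (Suc n)"
    have "Khat_mult_pure K H n (Suc 0) xs [\<one>, \<one>] = tensor_lift K (T (Suc (Suc n)))
        (\<lambda>zs. tensor K H (take n xs @ [zs ! 0 \<otimes> S (zs ! 2), zs ! 1])) (iter_comult K H 2 (xs ! n))"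
    proof -
      have "take n xs @ mult_word (Suc 0) [\<one>, \<one>] zs = take n xs @ [zs ! 0 \<otimes> S (zs ! 2), zs ! 1]" if "zs \<in> words H (Suc 2)" for zs
        using nth_words[OF that, of 0] nth_words[OF that, of 1] by (simp add: mult_word_def)
      hence "tensor_lift K (T (Suc (Suc n))) (\<lambda>zs. tensor K H (take n xs @ mult_word (Suc 0) [\<one>, \<one>] zs)) (iter_comult K H 2 (xs ! n)) =
          tensor_lift K (T (Suc (Suc n))) (\<lambda>zs. tensor K H (take n xs @ [zs ! 0 \<otimes> S (zs ! 2), zs ! 1])) (iter_comult K H 2 (xs ! n))"
        using nth_words[OF xs, of n] by (intro tensor_lift_cong[OF iter_comult_closed]) simp_all
      thus ?thesis by (simp add: Khat_mult_pure_eq)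
    qed
    moreover have "R n (tensor K H xs) = Khat_mult_pure K H n (Suc 0) xs [\<one>, \<one>]"
      unfolding omega_def by (intro mul_tensor xs) simp
    moreover have "cobar n (tensor K H xs) = (\<Oplus>\<^bsub>T (Suc (Suc n))\<^esub>j \<in> {..<n}. sgn j \<odot>\<^bsub>T (Suc (Suc n))\<^esub> comult_at K H j xs)"
      unfolding cobar_def by (rule finsum_cong_on) (simp add: comult_lift_tensor[OF _ xs])
    ultimately show "Khat_diff_pure K H n xs = khat_d n (tensor K H xs)"
      using xs by (simp add: Khat_diff_pure_def Let_def Khat_eq khat_d_def tensor_cons_tensor)
  qed
  thus ?thesis by (simp add: Khat_diff_def Khat_eq)
qed

lemma Khat_diff_hom: "Khat_diff K H n \<in> module_hom K (T (Suc n)) (T (Suc (Suc n)))"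
  by (rule module_hom_cong[OF module_T Khat_diff_eq[symmetric] khat_d_hom])

end

theorem proposition3p11:
  fixes K :: "('k, 'r) ring_scheme" and H :: "('k, 'h, 's) hopf_scheme"
  assumes "field K" and "hopf_algebra K H"
  shows "dg_algebra K (Khat K H) (Khat_mult K H) (tensor K H [\<one>\<^bsub>H\<^esub>]) (Khat_diff K H)"
proof -
  interpret hopf_algebra K H by fact
  show ?thesis
  proof (intro dg_algebra.intro dg_algebra_axioms.intro assms(1), unfold Khat_eq)
    fix n m l X Y Z
    show "module K (T (Suc n))" by (rule module_T)
    show "tensor K H [\<one>\<^bsub>H\<^esub>] \<in> carrier (T (Suc 0))" by (rule tensor_single_closed) simp
    show "Khat_diff K H n \<in> module_hom K (T (Suc n)) (T (Suc (n + 1)))" using Khat_diff_hom by simp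
    assume X: "X \<in> carrier (T (Suc n))"
    show "mul n m X \<in> module_hom K (T (Suc m)) (T (Suc (n + m)))" by (rule mul_hom_right[OF X])
    \<comment> \<open>Here \<open>X\<close> is the right factor, so the degrees \<open>n\<close> and
      \<open>m\<close> trade places.\<close>
    show "(\<lambda>Y. mul m n Y X) \<in> module_hom K (T (Suc m)) (T (Suc (m + n)))" by (rule mul_hom_left[OF X])
    show "mul 0 n (tensor K H [\<one>\<^bsub>H\<^esub>]) X = X" by (rule one_mul[OF X])
    show "mul n 0 X (tensor K H [\<one>\<^bsub>H\<^esub>]) = X" by (rule mul_one[OF X])
    show "Khat_diff K H (n + 1) (Khat_diff K H n X) = \<zero>\<^bsub>T (Suc (n + 2))\<^esub>"
      using X module_hom_simps(1)[OF khat_d_hom X] by (simp add: Khat_diff_eq khat_d_d)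
    assume Y: "Y \<in> carrier (T (Suc m))"
    show "Khat_diff K H (n + m) (mul n m X Y) = mul (n + 1) m (Khat_diff K H n X) Y \<oplus>\<^bsub>T (Suc (n + m + 1))\<^esub>
        koszul_sign K n \<odot>\<^bsub>T (Suc (n + m + 1))\<^esub> mul n (m + 1) X (Khat_diff K H m Y)"
      using khat_d_mul[OF X Y] X Y mul_closed[OF X Y] by (simp add: Khat_diff_eq)
    assume Z: "Z \<in> carrier (T (Suc l))"
    show "mul (n + m) l (mul n m X Y) Z = mul n (m + l) X (mul m l Y Z)" by (rule mul_assoc[OF Y Z X])
  qed
qed

end
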